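(* Let $W_n=((x_{\min\{i,j\},\max\{i,j\}}))_{1\le i,j\le n}$ (symmetric Wigner) and $H_n=((x_{i+j}))_{1\le i,j\le n}$ (Hankel), where in each case the real input variables satisfy (A1), (A2) or (A3), and let $\widehat{W}_n=M_n\odot W_n$ and $\widehat{H}_n=M_n\odot H_n$. Then the LSD of $n^{-1/2}\widehat{W}_n$ exists and is the same as the LSD of $n^{-1/2}W_n$, and the LSD of $n^{-1/2}\widehat{H}_n$ exists and is the same as the LSD of $n^{-1/2}H_n$.
   Context: Assumptions on the real input random variables ($\{x_{a,b}:1\le a\le b\}$ for the Wigner matrix, $\{x_i\}_{i\ge0}$ for the Hankel matrix): (A1) they are independent and uniformly bounded with mean $0$ and variance $1$; (A2) they are i.i.d. with mean $0$ and variance $1$; (A3) they are independent with mean $0$ and variance $1$, and with uniformly bounded moments of all orders. $M_n=((m_{ij}))_{1\le i,j\le n}$ is the symmetric matrix with $m_{ij}=1$ if $i+j<n+1$, $m_{ij}=0$ if $i+j=n+1$, and $m_{ij}=-1$ if $i+j>n+1$. The symbol $\odot$ denotes the entrywise (Schur–Hadamard) product. For a real symmetric $n\times n$ matrix $A$ with eigenvalues $\lambda_1,\dots,\lambda_n$, the empirical spectral distribution is $F^A(x)=\frac1n\#\{j:\lambda_j\le x\}$. A non-random distribution function $F$ is the limiting spectral distribution (LSD) of a sequence $A_n$ if, outside a null set, $F^{A_n}(x)\to F(x)$ as $n\to\infty$ at all continuity points $x$ of $F$. It is known that under any of (A1), (A2), (A3) the LSDs of $n^{-1/2}W_n$ and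 $n^{-1/2}H_n$ exist and do not depend on the distribution of the input variables; the former is the semi-circular law. *)

theory Defs
  imports "HOL-Probability.Probability" "Jordan_Normal_Form.Char_Poly"
begin

definition std_indep_inputs ::
  "'a measure \<Rightarrow> 'i set \<Rightarrow> ('i \<Rightarrow> 'a \<Rightarrow> real) \<Rightarrow> bool" where
  "std_indep_inputs P I x \<longleftrightarrow>
     prob_space P \<and>
     prob_space.indep_vars P (\<lambda>_. borel) x I \<and>
     (\<forall>i\<in>I. integrable P (x i) \<and> integrable P (\<lambda>\<omega>. (x i \<omega>)\<^sup>2) \<and>
        prob_space.expectation P (x i) = 0 \<and> prob_space.variance P (x i) = 1)"

definition assumption_A1 ::
  "'a measure \<Rightarrow> 'i set \<Rightarrow> ('i \<Rightarrow> 'a \<Rightarrow> real) \<Rightarrow> bool" where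
  "assumption_A1 P I x \<longleftrightarrow>
     std_indep_inputs P I x \<and> (\<exists>C. \<forall>i\<in>I. AE \<omega> in P. \<bar>x i \<omega>\<bar> \<le> C)"

definition assumption_A2 ::
  "'a measure \<Rightarrow> 'i set \<Rightarrow> ('i \<Rightarrow> 'a \<Rightarrow> real) \<Rightarrow> bool" where
  "assumption_A2 P I x \<longleftrightarrow>
     std_indep_inputs P I x \<and>
     (\<forall>i\<in>I. \<forall>j\<in>I. distr P borel (x i) = distr P borel (x j))"

definition assumption_A3 ::
  "'a measure \<Rightarrow> 'i set \<Rightarrow> ('i \<Rightarrow> 'a \<Rightarrow> real) \<Rightarrow> bool" where
  "assumption_A3 P I x \<longleftrightarrow>
     std_indep_inputs P I x \<and>
     (\<forall>k::nat. \<exists>C. \<forall>i\<in>I. integrable P (\<lambda>\<omega>. \<bar>x i \<omega>\<bar> ^ k) \<and>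
        prob_space.expectation P (\<lambda>\<omega>. \<bar>x i \<omega>\<bar> ^ k) \<le> C)"

definition admissible_inputs ::
  "'a measure \<Rightarrow> 'i set \<Rightarrow> ('i \<Rightarrow> 'a \<Rightarrow> real) \<Rightarrow> bool" where
  "admissible_inputs P I x \<longleftrightarrow>
     assumption_A1 P I x \<or> assumption_A2 P I x \<or> assumption_A3 P I x"

definition wigner_index :: "(nat \<times> nat) set" where
  "wigner_index = {(a, b). 1 \<le> a \<and> a \<le> b}"

text \<open>Type \<open>mat\<close> has indices starting at 0; \<open>mat_1based n f\<close> is the
  matrix \<open>((f i j))\<close> with \<open>1 \<le> i, j \<le> n\<close>.\<close>

definition mat_1based :: "nat \<Rightarrow> (nat \<Rightarrow> nat \<Rightarrow> real) \<Rightarrow> real mat" where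
  "mat_1based n f = Matrix.mat n n (\<lambda>(i, j). f (i + 1) (j + 1))"

definition wigner_mat :: "(nat \<times> nat \<Rightarrow> 'a \<Rightarrow> real) \<Rightarrow> nat \<Rightarrow> 'a \<Rightarrow> real mat" where
  "wigner_mat x n \<omega> = mat_1based n (\<lambda>i j. x (min i j, max i j) \<omega>)"

definition hankel_mat :: "(nat \<Rightarrow> 'a \<Rightarrow> real) \<Rightarrow> nat \<Rightarrow> 'a \<Rightarrow> real mat" where
  "hankel_mat x n \<omega> = mat_1based n (\<lambda>i j. x (i + j) \<omega>)"

definition sign_mat :: "nat \<Rightarrow> real mat" where
  "sign_mat n = mat_1based n
     (\<lambda>i j. if i + j < n + 1 then 1 else if i + j = n + 1 then 0 else - 1)"

definition schur_hadamard :: "real mat \<Rightarrow> real mat \<Rightarrow> real mat" (infixl "\<odot>" 70) where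
  "A \<odot> B = Matrix.mat (dim_row A) (dim_col A) (\<lambda>(i, j). A $$ (i, j) * B $$ (i, j))"

text \<open>Eigenvalues are counted with algebraic multiplicity, so for a real symmetric
  \<open>n \<times> n\<close> matrix the sum is \<open>#{j. \<lambda>\<^sub>j \<le> t}\<close> for the list
  \<open>\<lambda>\<^sub>1, \<dots>, \<lambda>\<^sub>n\<close> of its eigenvalues.\<close>

definition esd :: "real mat \<Rightarrow> real \<Rightarrow> real" where
  "esd A t = real (\<Sum>l | eigenvalue A l \<and> l \<le> t. order l (char_poly A)) / real (dim_row A)"

text \<open>The functions \<open>cdf \<mu>\<close> of Borel probability measures \<open>\<mu>\<close> on the reals are exactly the
  distribution functions, and \<open>weak_conv\<close> is pointwise convergence at all continuity
  points of the limit.\<close>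

definition is_LSD :: "'a measure \<Rightarrow> (nat \<Rightarrow> 'a \<Rightarrow> real mat) \<Rightarrow> (real \<Rightarrow> real) \<Rightarrow> bool" where
  "is_LSD P A F \<longleftrightarrow>
     (\<exists>\<mu>. real_distribution \<mu> \<and> F = cdf \<mu>) \<and>
     (AE \<omega> in P. weak_conv (\<lambda>n. esd (A n \<omega>)) F)"

end

theory Submission
  imports Defs
begin

text \<open>
  Both matrices have the form \<open>(x (L i j))\<close> for a symmetric link function \<open>L\<close> with \<open>L i j = L i j'\<close> only for
  \<open>j = j'\<close>, and the sign matrix acts on the letters because \<open>i + j\<close> is a function of \<open>L i j\<close>. So
  the signed matrix is again of this form, with independent inputs \<open>\<plusminus>x\<close> of mean 0 and variance 1
  whose signs depend on \<open>n\<close>.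

  For bounded inputs the expected trace moments are, up to lower order, numbers of circuits whose
  letters are matched in pairs. In such a circuit every sign occurs squared, hence the moment
  limits do not see the signs. The variance of a trace moment is \<open>O(1/n)\<close>, which gives almost sure
  convergence along \<open>n = j\<^sup>2\<close>; the intermediate \<open>n\<close>, the zero antidiagonal and the truncation of
  unbounded inputs are handled by the inequality
  \<open>\<bar>tr e\<^sup>i\<^sup>t\<^sup>A - tr e\<^sup>i\<^sup>t\<^sup>B\<bar> \<le> \<bar>t\<bar> \<surd>n \<parallel>A - B\<parallel>\<close> with the Frobenius norm. The pairing counts divided by
  their order of magnitude converge by dominated convergence: the free vertices of a random circuit
  become independent uniform variables.
\<close>

section \<open>The spectral theorem for real symmetric matrices\<close>

text \<open>The limit law is never identified. It arises as one subsequential limit, chosen before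
  the choice between the signed and the unsigned matrix; both versions have the same limit moments,
  so both converge to it. The moment bound \<open>4 ^ h * (2*h) ^ h = (8*h) ^ h\<close> makes the
  Taylor remainders of characteristic functions small, and therefore equal moment limits force equal
  limits. Two obstacles shape the argument. An antidiagonal zero has variance 0, so the moment
  computation puts the sign -1 there, and these at most \<open>n\<close> entries are corrected at
  the end. The signs move with \<open>n\<close>; between consecutive squares the dimension grows by
  O(\<open>sqrt n\<close>), so only a fraction O(1 / \<open>sqrt n\<close>) of the entries changes
  its sign. Comparing characteristic functions instead of distribution functions keeps the Frobenius
  estimate elementary, since no ordering of eigenvalues enters. Under (A2) only second moments
  exist, so the truncation error needs a law of large numbers. All three assumptions are first
  reduced to the common property \<open>uniform_squares\<close>.\<close>

lemma complex_root_exists: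
  fixes p :: "complex poly"
  assumes "degree p > 0"
  shows "\<exists>z. poly p z = 0"
  using assms fundamental_theorem_of_algebra[of p] by (simp add: constant_degree)

text \<open>The characteristic polynomial has a complex root \<open>z\<close>. For an eigenvector
  \<open>c\<close>, symmetry gives \<open>z * S = cnj z * S\<close> with \<open>S\<close> the
  squared norm of \<open>c\<close>, so \<open>z\<close> is real. Real and imaginary parts of
  \<open>c\<close> then satisfy the eigenvalue equation separately.\<close>

lemma real_symmetric_eigenvector:
  fixes f :: "nat \<Rightarrow> nat \<Rightarrow> real"
  assumes n: "n > 0" and sym: "\<And>i j. i < n \<Longrightarrow> j < n \<Longrightarrow> f i j = f j i"
  shows "\<exists>l v. (\<Sum>i<n. (v i)\<^sup>2) = 1 \<and> (\<forall>i<n. (\<Sum>j<n. f i j * v j) = l * v i)"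
proof -
  define A where "A = Matrix.mat n n (\<lambda>(i,j). complex_of_real (f i j))"
  have A: "A \<in> carrier_mat n n" by (simp add: A_def)
  have "degree (char_poly A) = n" using degree_monic_char_poly[OF A] by simp
  then obtain z where "poly (char_poly A) z = 0" using complex_root_exists n by metis
  then have "eigenvalue A z" using eigenvalue_root_char_poly[OF A] by simp
  then obtain w where w: "w \<in> carrier_vec n" "w \<noteq> 0\<^sub>v n" "A *\<^sub>v w = z \<cdot>\<^sub>v w"
    using A unfolding eigenvalue_def eigenvector_def by auto
  define c where "c i = w $ i" for i
  have eig: "(\<Sum>j<n. complex_of_real (f i j) * c j) = z * c i" if "i < n" for i
  proof -
    have "(A *\<^sub>v w) $ i = z * c i" using w that by (simp add: c_def)
    moreover have "(A *\<^sub>v w) $ i = (\<Sum>j<n. complex_of_real (f i j) * c j)"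
      using that w(1) by (simp add: A_def scalar_prod_def c_def lessThan_atLeast0)
    ultimately show ?thesis by simp
  qed
  obtain i0 where i0: "i0 < n" "c i0 \<noteq> 0"
    using w(1,2) by (auto simp: c_def vec_eq_iff)
  define S where "S = (\<Sum>i<n. cnj (c i) * c i)"
  have S_real: "S = complex_of_real (\<Sum>i<n. (cmod (c i))\<^sup>2)"
    unfolding S_def of_real_sum by (intro sum.cong refl) (metis complex_norm_square mult.commute of_real_power)
  have pos: "(\<Sum>i<n. (cmod (c i))\<^sup>2) > 0"
    using i0 by (intro sum_pos2[of _ i0]) auto
  have "z * S = (\<Sum>i<n. cnj (c i) * (\<Sum>j<n. complex_of_real (f i j) * c j))"
    unfolding S_def sum_distrib_left[of z] by (intro sum.cong refl) (subst eig, auto simp: algebra_simps)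
  also have "\<dots> = (\<Sum>j<n. (\<Sum>i<n. complex_of_real (f j i) * cnj (c i)) * c j)"
    unfolding sum_distrib_left sum_distrib_right
    by (subst sum.swap) (intro sum.cong refl, simp add: sym)
  also have "\<dots> = (\<Sum>j<n. cnj (z * c j) * c j)"
    by (intro sum.cong refl arg_cong2[where f="(*)"]) (simp add: eig[symmetric])
  also have "\<dots> = cnj z * S" unfolding S_def sum_distrib_left by (simp add: algebra_simps)
  finally have "z * S = cnj z * S" .
  moreover have "S \<noteq> 0" unfolding S_real using pos by (metis less_irrefl of_real_eq_0_iff)
  ultimately have "z = cnj z" by simp
  then have zr: "z = complex_of_real (Re z)" by (metis Reals_cnj_iff complex_is_Real_iff of_real_Re)
  have eR: "(\<Sum>j<n. f i j * Re (c j)) = Re z * Re (c i)" if "i < n" for i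
    using arg_cong[OF eig[OF that], of Re] by (subst (asm) zr) (simp add: Re_sum)
  have eI: "(\<Sum>j<n. f i j * Im (c j)) = Re z * Im (c i)" if "i < n" for i
    using arg_cong[OF eig[OF that], of Im] by (subst (asm) zr) (simp add: Im_sum)
  \<comment> \<open>Since \<open>c i0\<close> is nonzero, one of the two real vectors does not
    vanish at \<open>i0\<close>.\<close>
  obtain r where r: "r i0 \<noteq> (0::real)" "\<And>i. i < n \<Longrightarrow> (\<Sum>j<n. f i j * r j) = Re z * r i"
  proof (cases "Re (c i0) = 0")
    case True
    then have "Im (c i0) \<noteq> 0" using i0 by (simp add: complex_eq_iff)
    then show ?thesis using that[of "\<lambda>i. Im (c i)"] eI by blast
  next
    case False
    then show ?thesis using that[of "\<lambda>i. Re (c i)"] eR by blast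
  qed
  define N where "N = (\<Sum>i<n. (r i)\<^sup>2)"
  have N: "N > 0" unfolding N_def using i0 r by (intro sum_pos2[of _ i0]) auto
  define v where "v i = r i / sqrt N" for i
  have "(\<Sum>i<n. (v i)\<^sup>2) = 1"
    using N by (simp add: v_def power_divide N_def flip: sum_divide_distrib)
  moreover have "(\<Sum>j<n. f i j * v j) = Re z * v i" if "i < n" for i
    using r(2)[OF that] by (simp add: v_def flip: sum_divide_distrib)
  ultimately show ?thesis by blast
qed

text \<open>The Householder reflection with \<open>w = v - e0\<close>, where \<open>e0\<close> is
  the first unit vector, exchanges \<open>e0\<close> and \<open>v\<close>. It is symmetric and
  orthogonal, so its rows complete \<open>v\<close> to an orthonormal basis. If
  \<open>v = e0\<close> then \<open>w\<close> vanishes and the identity serves.\<close>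

lemma householder_basis:
  fixes v :: "nat \<Rightarrow> real"
  assumes n: "n > 0" and v: "(\<Sum>i<n. (v i)\<^sup>2) = 1"
  shows "\<exists>b. (\<forall>i<n. \<forall>j<n. b i j = b j i) \<and> (\<forall>i<n. b 0 i = v i) \<and>
           (\<forall>i<n. \<forall>j<n. (\<Sum>l<n. b i l * b j l) = (if i = j then 1 else (0::real)))"
proof (cases "\<forall>i<n. v i = (if i = 0 then 1 else 0)")
  case True
  define b :: "nat \<Rightarrow> nat \<Rightarrow> real" where "b i j = (if i = j then 1 else 0)" for i j
  have "(\<Sum>l<n. b i l * b j l) = (if i = j then 1 else 0)" if "i < n" for i j
  proof -
    have "(\<Sum>l<n. b i l * b j l) = (\<Sum>l<n. if l = i then (if i = j then 1 else 0) else 0)"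
      by (intro sum.cong refl) (simp add: b_def)
    then show ?thesis using that by simp
  qed
  moreover have "b 0 i = v i" if "i < n" for i using True that by (simp add: b_def)
  moreover have "b i j = b j i" for i j by (simp add: b_def)
  ultimately show ?thesis by blast
next
  case False
  define w where "w i = v i - (if i = 0 then 1 else 0)" for i
  define W where "W = (\<Sum>i<n. (w i)\<^sup>2)"
  obtain i0 where "i0 < n" "w i0 \<noteq> 0" using False by (auto simp: w_def)
  then have W: "W > 0" unfolding W_def by (intro sum_pos2[of _ i0]) auto
  have "W = (\<Sum>i<n. (v i)\<^sup>2 - 2 * (if i = 0 then v i else 0) + (if i = 0 then 1 else 0))"
    unfolding W_def w_def by (intro sum.cong refl) (auto simp: power2_eq_square algebra_simps)
  also have "\<dots> = 2 - 2 * v 0"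
    using n v by (simp add: sum.distrib sum_subtractf flip: sum_distrib_left)
  finally have W2: "W = 2 - 2 * v 0" .
  define k where "k = 2 / W"
  define b where "b i j = (if i = j then 1 else 0) - k * w i * w j" for i j
  have "(\<Sum>l<n. b i l * b j l) = (if i = j then 1 else 0)" if "i < n" "j < n" for i j
  proof -
    have "(\<Sum>l<n. b i l * b j l) = (\<Sum>l<n. (if l = i then (if i = j then 1 else 0) else 0)
       - (if l = i then k * w j * w l else 0) - (if l = j then k * w i * w l else 0)
       + k\<^sup>2 * w i * w j * (w l)\<^sup>2)"
      by (intro sum.cong refl) (auto simp: b_def power2_eq_square algebra_simps)
    also have "\<dots> = (if i = j then 1 else 0) - k * w j * w i - k * w i * w j + k\<^sup>2 * w i * w j * W"
      using that by (simp add: sum.distrib sum_subtractf W_def flip: sum_distrib_left)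
    also have "k\<^sup>2 * w i * w j * W = (k * W) * k * w i * w j" by (simp add: power2_eq_square)
    also have "k * W = 2" using W by (simp add: k_def)
    finally have "(\<Sum>l<n. b i l * b j l) = (if i = j then 1 else 0)" by simp
    then show ?thesis .
  qed
  moreover have "b 0 i = v i" for i
  proof -
    have "k * w 0 = - 1" using W W2 by (simp add: w_def k_def field_simps)
    then have "b 0 i = (if 0 = i then 1 else 0) + w i"
      by (simp add: b_def)
    then show ?thesis by (auto simp: w_def)
  qed
  moreover have "b i j = b j i" for i j by (simp add: b_def)
  ultimately show ?thesis by blast
qed

lemma orthonormal_expansion:
  fixes b :: "nat \<Rightarrow> nat \<Rightarrow> real"
  assumes dual: "\<And>i j. i < n \<Longrightarrow> j < n \<Longrightarrow> (\<Sum>a<n. b a i * b a j) = (if i = j then 1 else 0)"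
    and i: "i < n"
  shows "x i = (\<Sum>a<n. (\<Sum>l<n. b a l * x l) * b a i)"
proof -
  have "(\<Sum>a<n. (\<Sum>l<n. b a l * x l) * b a i) = (\<Sum>l<n. x l * (\<Sum>a<n. b a l * b a i))"
    unfolding sum_distrib_left sum_distrib_right by (subst sum.swap) (simp add: algebra_simps)
  also have "\<dots> = (\<Sum>l<n. x l * (if l = i then 1 else 0))"
    by (intro sum.cong refl) (use i dual in auto)
  also have "\<dots> = x i" using i by (simp add: if_distrib cong: if_cong)
  finally show ?thesis by simp
qed

text \<open>Orthonormal rows say that the matrix times its transpose is the identity; for square
  matrices a one-sided inverse is two-sided, which gives orthonormal columns.\<close>

lemma orthonormal_dual:
  fixes u :: "nat \<Rightarrow> nat \<Rightarrow> real"
  assumes o: "\<And>a b. a < n \<Longrightarrow> b < n \<Longrightarrow> (\<Sum>l<n. u a l * u b l) = (if a = b then 1 else 0)"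
    and ij: "i < n" "j < n"
  shows "(\<Sum>a<n. u a i * u a j) = (if i = j then 1 else 0)"
proof -
  define U where "U = Matrix.mat n n (\<lambda>(a,l). u a l)"
  have U: "U \<in> carrier_mat n n" by (simp add: U_def)
  have "U * transpose_mat U = 1\<^sub>m n"
    by (rule eq_matI) (auto simp: U_def scalar_prod_def o lessThan_atLeast0[symmetric])
  then have 1: "transpose_mat U * U = 1\<^sub>m n"
    using mat_mult_left_right_inverse[OF U, of "transpose_mat U"] by (simp add: U_def)
  have "(transpose_mat U * U) $$ (i,j) = (\<Sum>a<n. u a i * u a j)"
    using ij by (simp add: U_def scalar_prod_def lessThan_atLeast0)
  then show ?thesis using 1 ij by simp
qed

text \<open>Deflation: one unit eigenvector is completed to an orthonormal basis \<open>b\<close>,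
  the matrix is compressed to the complement of the eigenvector, and the eigenvectors of the
  compression are carried back through \<open>b\<close>.\<close>

lemma spectral_theorem_fun:
  fixes f :: "nat \<Rightarrow> nat \<Rightarrow> real"
  assumes "\<And>i j. i < n \<Longrightarrow> j < n \<Longrightarrow> f i j = f j i"
  shows "\<exists>es u. (\<forall>a<n. \<forall>b<n. (\<Sum>l<n. u a l * u b l) = (if a = b then 1 else 0)) \<and>
                (\<forall>a<n. \<forall>i<n. (\<Sum>j<n. f i j * u a j) = es a * u a i)"
  using assms
proof (induction n arbitrary: f)
  case 0
  then show ?case by simp
next
  case (Suc n)
  let ?N = "Suc n"
  obtain l v where v: "(\<Sum>i<?N. (v i)\<^sup>2) = 1" "\<And>i. i < ?N \<Longrightarrow> (\<Sum>j<?N. f i j * v j) = l * v i"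
    using real_symmetric_eigenvector[of ?N f] Suc.prems by blast
  obtain b where b: "\<And>i j. i < ?N \<Longrightarrow> j < ?N \<Longrightarrow> b i j = b j i" "\<And>i. i < ?N \<Longrightarrow> b 0 i = v i"
      "\<And>i j. i < ?N \<Longrightarrow> j < ?N \<Longrightarrow> (\<Sum>l<?N. b i l * b j l) = (if i = j then 1 else 0)"
    using householder_basis[OF _ v(1)] by (metis zero_less_Suc)
  define F where "F x i = (\<Sum>j<?N. f i j * x j)" for x i
  have self: "(\<Sum>i<?N. x i * F y i) = (\<Sum>i<?N. F x i * y i)" for x y
    unfolding F_def sum_distrib_left sum_distrib_right
    by (subst sum.swap) (intro sum.cong refl, simp add: Suc.prems)
  \<comment> \<open>The matrix of \<open>F\<close> on the span of the rows \<open>b (Suc j)\<close>,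
    the orthogonal complement of \<open>v\<close>.\<close>
  define g where "g i j = (\<Sum>m<?N. b (Suc i) m * F (b (Suc j)) m)" for i j
  have "g i j = g j i" for i j unfolding g_def by (subst self) (simp add: mult.commute)
  then obtain es' u' where u': "\<And>a c. a < n \<Longrightarrow> c < n \<Longrightarrow> (\<Sum>l<n. u' a l * u' c l) = (if a = c then 1 else 0)"
     "\<And>a i. a < n \<Longrightarrow> i < n \<Longrightarrow> (\<Sum>j<n. g i j * u' a j) = es' a * u' a i"
    using Suc.IH[of g] by blast
  define U where "U a i = (\<Sum>j<n. u' a j * b (Suc j) i)" for a i
  define u where "u a = (case a of 0 \<Rightarrow> v | Suc a \<Rightarrow> U a)" for a
  define es where "es a = (case a of 0 \<Rightarrow> l | Suc a \<Rightarrow> es' a)" for a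
  have bU: "(\<Sum>m<?N. b (Suc i) m * U a m) = u' a i" if "i < n" for a i
  proof -
    have "(\<Sum>m<?N. b (Suc i) m * U a m) = (\<Sum>j<n. u' a j * (\<Sum>m<?N. b (Suc i) m * b (Suc j) m))"
      unfolding U_def sum_distrib_left by (subst sum.swap) (simp only: algebra_simps)
    also have "\<dots> = (\<Sum>j<n. u' a j * (if j = i then 1 else 0))"
      by (intro sum.cong refl) (use that in \<open>auto simp: b(3) simp del: sum.lessThan_Suc\<close>)
    also have "\<dots> = u' a i" using that by (simp add: if_distrib cong: if_cong)
    finally show ?thesis .
  qed
  have vU: "(\<Sum>m<?N. v m * U a m) = 0" for a
  proof -
    have "(\<Sum>m<?N. v m * U a m) = (\<Sum>m<?N. b 0 m * U a m)"
      by (intro sum.cong refl) (simp add: b(2))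
    also have "\<dots> = (\<Sum>j<n. u' a j * (\<Sum>m<?N. b 0 m * b (Suc j) m))"
      unfolding U_def sum_distrib_left by (subst sum.swap) (simp only: algebra_simps)
    also have "\<dots> = 0"
      by (intro sum.neutral ballI) (auto simp: b(3) simp del: sum.lessThan_Suc)
    finally show ?thesis .
  qed
  have UU: "(\<Sum>m<?N. U a m * U c m) = (if a = c then 1 else 0)" if "a < n" "c < n" for a c
  proof -
    have "(\<Sum>m<?N. U a m * U c m) = (\<Sum>j<n. u' a j * (\<Sum>m<?N. b (Suc j) m * U c m))"
      unfolding U_def[of a] sum_distrib_left sum_distrib_right by (subst sum.swap) (simp only: algebra_simps)
    also have "\<dots> = (\<Sum>j<n. u' a j * u' c j)" by (intro sum.cong refl) (use bU in auto)
    finally show ?thesis using u'(1) that by simp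
  qed
  have ortho: "(\<Sum>m<?N. u a m * u c m) = (if a = c then 1 else 0)" if "a < ?N" "c < ?N" for a c
  proof (cases a)
    case 0
    show ?thesis
    proof (cases c)
      case 0 with \<open>a = 0\<close> show ?thesis using v(1) by (simp add: u_def power2_eq_square del: sum.lessThan_Suc)
    next
      case (Suc c') with \<open>a = 0\<close> show ?thesis using vU by (simp add: u_def del: sum.lessThan_Suc)
    qed
  next
    case (Suc a')
    show ?thesis
    proof (cases c)
      case 0 with Suc show ?thesis using vU[of a'] by (simp add: u_def mult.commute del: sum.lessThan_Suc)
    next
      case (Suc c') with \<open>a = Suc a'\<close> show ?thesis using UU that by (simp add: u_def del: sum.lessThan_Suc)
    qed
  qed
  have eig: "F (u a) i = es a * u a i" if a: "a < ?N" and i: "i < ?N" for a i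
  proof (cases a)
    case 0
    then show ?thesis using v(2)[OF i] by (simp add: u_def es_def F_def)
  next
    case (Suc a')
    then have a': "a' < n" using a by simp
    have FU: "F (U a') m = (\<Sum>j<n. u' a' j * F (b (Suc j)) m)" for m
      unfolding F_def U_def sum_distrib_left by (subst sum.swap) (simp only: algebra_simps)
    \<comment> \<open>Self-adjointness moves \<open>F\<close> to the eigenvector \<open>v\<close>,
      which is orthogonal to \<open>U a'\<close>. So \<open>F (U a')\<close> stays in the
      complement, and the compression describes it completely.\<close>
    have c0: "(\<Sum>m<?N. b 0 m * F (U a') m) = 0"
    proof -
      have "(\<Sum>m<?N. b 0 m * F (U a') m) = (\<Sum>m<?N. v m * F (U a') m)"
        by (intro sum.cong refl) (simp add: b(2))
      also have "\<dots> = (\<Sum>m<?N. F v m * U a' m)" by (rule self)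
      also have "\<dots> = (\<Sum>m<?N. l * (v m * U a' m))"
        by (intro sum.cong refl) (use v(2) in \<open>simp add: F_def\<close>)
      also have "\<dots> = 0" using vU[of a'] by (simp only: flip: sum_distrib_left)
      finally show ?thesis .
    qed
    have cS: "(\<Sum>m<?N. b (Suc j) m * F (U a') m) = es' a' * u' a' j" if "j < n" for j
    proof -
      have "(\<Sum>m<?N. b (Suc j) m * F (U a') m) = (\<Sum>k<n. g j k * u' a' k)"
        unfolding FU g_def sum_distrib_left sum_distrib_right by (subst sum.swap) (simp only: algebra_simps)
      then show ?thesis using u'(2) a' that by simp
    qed
    have "F (U a') i = (\<Sum>c<?N. (\<Sum>m<?N. b c m * F (U a') m) * b c i)"
      by (rule orthonormal_expansion[OF _ i]) (use orthonormal_dual[of ?N b] b(3) in blast)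
    also have "\<dots> = (\<Sum>j<n. (\<Sum>m<?N. b (Suc j) m * F (U a') m) * b (Suc j) i)"
      by (subst sum.lessThan_Suc_shift) (simp add: c0 del: sum.lessThan_Suc)
    also have "\<dots> = (\<Sum>j<n. es' a' * u' a' j * b (Suc j) i)"
      by (intro sum.cong refl) (simp add: cS del: sum.lessThan_Suc)
    also have "\<dots> = es' a' * U a' i" by (simp add: U_def sum_distrib_left algebra_simps)
    finally show ?thesis using Suc by (simp add: u_def es_def)
  qed
  show ?case using ortho eig unfolding F_def by blast
qed

section \<open>Empirical spectral distributions and their perturbation\<close>

definition fun_mat :: "nat \<Rightarrow> (nat \<Rightarrow> nat \<Rightarrow> real) \<Rightarrow> real mat" where
  "fun_mat n f = Matrix.mat n n (\<lambda>(i,j). f i j)"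

definition eigen_system :: "nat \<Rightarrow> (nat \<Rightarrow> nat \<Rightarrow> real) \<Rightarrow> (nat \<Rightarrow> real) \<Rightarrow> (nat \<Rightarrow> nat \<Rightarrow> real) \<Rightarrow> bool" where
  "eigen_system n f es u \<longleftrightarrow>
     (\<forall>a<n. \<forall>b<n. (\<Sum>l<n. u a l * u b l) = (if a = b then 1 else 0)) \<and>
     (\<forall>a<n. \<forall>i<n. (\<Sum>j<n. f i j * u a j) = es a * u a i)"

text \<open>The eigenvalues come in no particular order and the values beyond \<open>n\<close> are
  arbitrary. Only symmetric functions of the first \<open>n\<close> of them are ever formed: counts,
  power sums and exponential sums.\<close>

definition spec :: "nat \<Rightarrow> (nat \<Rightarrow> nat \<Rightarrow> real) \<Rightarrow> nat \<Rightarrow> real" where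
  "spec n f = (SOME es. \<exists>u. eigen_system n f es u)"

definition sym_on :: "nat \<Rightarrow> (nat \<Rightarrow> nat \<Rightarrow> real) \<Rightarrow> bool" where
  "sym_on n f \<longleftrightarrow> (\<forall>i<n. \<forall>j<n. f i j = f j i)"

lemma spec_eigen_system:
  assumes "sym_on n f"
  obtains u where "eigen_system n f (spec n f) u"
proof -
  have "\<exists>es u. eigen_system n f es u"
    using spectral_theorem_fun[of n f] assms unfolding eigen_system_def sym_on_def by blast
  then have "\<exists>u. eigen_system n f (spec n f) u" unfolding spec_def by (rule someI_ex)
  with that show ?thesis by blast
qed

lemma eigen_systemD:
  assumes "eigen_system n f es u"
  shows "\<And>a b. a < n \<Longrightarrow> b < n \<Longrightarrow> (\<Sum>l<n. u a l * u b l) = (if a = b then 1 else 0)"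
    and "\<And>a i. a < n \<Longrightarrow> i < n \<Longrightarrow> (\<Sum>j<n. f i j * u a j) = es a * u a i"
    and "\<And>i j. i < n \<Longrightarrow> j < n \<Longrightarrow> (\<Sum>a<n. u a i * u a j) = (if i = j then 1 else 0)"
  using assms orthonormal_dual[of n u] unfolding eigen_system_def by blast+

lemma eigen_system_decomp:
  assumes es: "eigen_system n f es u" and ij: "i < n" "j < n"
  shows "f i j = (\<Sum>a<n. es a * u a i * u a j)"
proof -
  have "(\<Sum>a<n. es a * u a i * u a j) = (\<Sum>a<n. (\<Sum>l<n. f i l * u a l) * u a j)"
    by (intro sum.cong refl) (use eigen_systemD(2)[OF es] ij in auto)
  also have "\<dots> = (\<Sum>l<n. f i l * (\<Sum>a<n. u a l * u a j))"
    unfolding sum_distrib_left sum_distrib_right by (subst sum.swap) (simp only: algebra_simps)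
  also have "\<dots> = (\<Sum>l<n. f i l * (if l = j then 1 else 0))"
    by (intro sum.cong refl) (use eigen_systemD(3)[OF es] ij in auto)
  also have "\<dots> = f i j" using ij by (simp add: if_distrib cong: if_cong)
  finally show ?thesis by simp
qed

lemma mult_mat_entry:
  assumes "A \<in> carrier_mat n n" "B \<in> carrier_mat n n" "i < n" "j < n"
  shows "(A * B) $$ (i,j) = (\<Sum>a<n. A $$ (i,a) * B $$ (a,j))"
  using assms by (simp add: scalar_prod_def lessThan_atLeast0)

text \<open>The rows of \<open>u\<close> form an orthogonal matrix \<open>U\<close> with
  \<open>fun_mat n f = U^T D U\<close>, so the matrix is similar to the diagonal matrix
  \<open>D\<close> of the numbers \<open>es a\<close>.\<close>

lemma char_poly_fun_mat:
  assumes es: "eigen_system n f es u"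
  shows "char_poly (fun_mat n f) = (\<Prod>a<n. [:- es a, 1:])"
proof -
  define U where "U = fun_mat n u"
  define D where "D = fun_mat n (\<lambda>a b. if a = b then es a else 0)"
  have c: "U \<in> carrier_mat n n" "D \<in> carrier_mat n n" "fun_mat n f \<in> carrier_mat n n"
    by (simp_all add: U_def D_def fun_mat_def)
  have 1: "U * transpose_mat U = 1\<^sub>m n"
    by (rule eq_matI) (auto simp: U_def fun_mat_def scalar_prod_def eigen_systemD(1)[OF es] lessThan_atLeast0[symmetric])
  have 2: "transpose_mat U * U = 1\<^sub>m n"
    using mat_mult_left_right_inverse[OF c(1) _ 1] c by simp
  have DU: "(D * U) $$ (a,j) = es a * u a j" if "a < n" "j < n" for a j
  proof -
    have "(D * U) $$ (a,j) = (\<Sum>b<n. (if a = b then es a else 0) * u b j)"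
      using that by (simp add: D_def U_def fun_mat_def scalar_prod_def lessThan_atLeast0)
    also have "\<dots> = (\<Sum>b<n. if b = a then es a * u a j else 0)" by (intro sum.cong refl) auto
    finally show ?thesis using that by simp
  qed
  have 3: "fun_mat n f = transpose_mat U * (D * U)"
  proof (rule eq_matI)
    fix i j assume ij: "i < dim_row (transpose_mat U * (D * U))" "j < dim_col (transpose_mat U * (D * U))"
    then have ij: "i < n" "j < n" using c by auto
    have "(transpose_mat U * (D * U)) $$ (i,j) = (\<Sum>a<n. u a i * (es a * u a j))"
      using ij c by (subst mult_mat_entry[of _ n]) (auto simp: DU simp del: index_mult_mat intro!: sum.cong, simp add: U_def fun_mat_def)
    also have "\<dots> = f i j" by (subst eigen_system_decomp[OF es ij]) (simp add: algebra_simps)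
    finally show "fun_mat n f $$ (i,j) = (transpose_mat U * (D * U)) $$ (i,j)"
      using ij by (simp add: fun_mat_def)
  qed (use c in auto)
  have "similar_mat (fun_mat n f) D"
    unfolding similar_mat_def similar_mat_wit_def
    by (rule exI[of _ "transpose_mat U"], rule exI[of _ U])
       (use c 1 2 3 in \<open>auto simp: Let_def assoc_mult_mat[of "transpose_mat U" n n D n U n]\<close>)
  then have "char_poly (fun_mat n f) = char_poly D" by (rule char_poly_similar)
  also have "\<dots> = (\<Prod> a \<leftarrow> diag_mat D. [:- a, 1:])"
    by (rule char_poly_upper_triangular[OF c(2)]) (auto simp: D_def fun_mat_def upper_triangular_def)
  also have "diag_mat D = map es [0..<n]"
    by (auto simp: diag_mat_def D_def fun_mat_def)
  also have "(\<Prod> a \<leftarrow> map es [0..<n]. [:- a, 1:]) = (\<Prod>a<n. [:- es a, 1:])"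
    using prod.distinct_set_conv_list[of "[0..<n]" "\<lambda>a. [:- es a, 1:]"] by (simp add: comp_def lessThan_atLeast0)
  finally show ?thesis .
qed

lemma order_prod_linear:
  assumes "finite S"
  shows "order x (\<Prod>a\<in>S. [:- es a, 1:]) = card {a\<in>S. es a = (x::real)}"
  using assms
proof induction
  case (insert a S)
  have nz: "[:- es a, 1:] * (\<Prod>a\<in>S. [:- es a, 1:]) \<noteq> 0"
    using insert by (intro no_zero_divisors) (simp_all add: prod_zero_iff)
  have 1: "order x [:- es a, 1:] = (if es a = x then 1 else 0)"
    using order_power_n_n[of x 1] by (auto intro: order_0I)
  have "{b\<in>insert a S. es b = x} = (if es a = x then insert a {b\<in>S. es b = x} else {b\<in>S. es b = x})"
    by auto
  moreover have "order x (\<Prod>b\<in>insert a S. [:- es b, 1:]) = order x [:- es a, 1:] + order x (\<Prod>b\<in>S. [:- es b, 1:])"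
    unfolding prod.insert[OF insert(1,2)] by (rule order_mult[OF nz])
  ultimately show ?case using insert by (simp only: 1) simp
qed auto

text \<open>The algebraic multiplicity of \<open>l\<close> is the number of indices \<open>a\<close>
  with \<open>spec n f a = l\<close>; summing over the distinct eigenvalues below \<open>t\<close>
  counts each index once.\<close>

lemma esd_fun_mat:
  assumes sym: "sym_on n f"
  shows "esd (fun_mat n f) t = real (card {a\<in>{..<n}. spec n f a \<le> t}) / real n"
proof -
  obtain u where es: "eigen_system n f (spec n f) u" using spec_eigen_system[OF sym] .
  define e where "e = spec n f"
  note cp = char_poly_fun_mat[OF es, folded e_def]
  have A: "fun_mat n f \<in> carrier_mat n n" by (simp add: fun_mat_def)
  have ev: "eigenvalue (fun_mat n f) l \<longleftrightarrow> (\<exists>a<n. e a = l)" for l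
    unfolding eigenvalue_root_char_poly[OF A] cp poly_prod by (auto simp: prod_zero_iff)
  have "{l. eigenvalue (fun_mat n f) l \<and> l \<le> t} = e ` {a\<in>{..<n}. e a \<le> t}"
    by (auto simp: ev)
  then have "(\<Sum>l | eigenvalue (fun_mat n f) l \<and> l \<le> t. order l (char_poly (fun_mat n f)))
     = (\<Sum>l\<in>e ` {a\<in>{..<n}. e a \<le> t}. card {a\<in>{..<n}. e a = l})"
    by (simp add: cp order_prod_linear)
  also have "\<dots> = (\<Sum>l\<in>e ` {a\<in>{..<n}. e a \<le> t}. card {a\<in>{a\<in>{..<n}. e a \<le> t}. e a = l})"
    by (intro sum.cong refl arg_cong[where f=card]) auto
  also have "\<dots> = card {a\<in>{..<n}. e a \<le> t}"
    using sum.image_gen[of "{a\<in>{..<n}. e a \<le> t}" "\<lambda>_. 1::nat" e] by simp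
  finally show ?thesis by (simp add: esd_def fun_mat_def e_def)
qed

subsection \<open>Power sums of the eigenvalues\<close>

text \<open>Entry \<open>(i, j)\<close> of the \<open>k\<close>-th power of the matrix
  \<open>f\<close>.\<close>

fun path_weight :: "nat \<Rightarrow> (nat \<Rightarrow> nat \<Rightarrow> real) \<Rightarrow> nat \<Rightarrow> nat \<Rightarrow> nat \<Rightarrow> real" where
  "path_weight n f 0 i j = (if i = j then 1 else 0)"
| "path_weight n f (Suc k) i j = (\<Sum>l<n. path_weight n f k i l * f l j)"

lemma path_weight_eigen:
  assumes es: "eigen_system n f es u" and ij: "i < n" "j < n"
  shows "path_weight n f k i j = (\<Sum>a<n. es a ^ k * u a i * u a j)"
  using ij
proof (induction k arbitrary: j)
  case 0
  then show ?case using eigen_systemD(3)[OF es] by simp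
next
  case (Suc k)
  have "path_weight n f (Suc k) i j = (\<Sum>l<n. (\<Sum>a<n. es a ^ k * u a i * u a l) * f l j)"
    using Suc by (simp add: mult.assoc)
  also have "\<dots> = (\<Sum>a<n. es a ^ k * u a i * (\<Sum>l<n. u a l * f l j))"
    unfolding sum_distrib_left sum_distrib_right by (subst sum.swap) (simp only: algebra_simps)
  also have "\<dots> = (\<Sum>a<n. es a ^ k * u a i * (es a * u a j))"
  proof (intro sum.cong refl arg_cong2[where f="(*)"])
    fix a assume "a \<in> {..<n}"
    then have a: "a < n" by simp
    have "(\<Sum>l<n. u a l * f l j) = (\<Sum>l<n. u a l * (\<Sum>c<n. es c * u c l * u c j))"
      using Suc.prems eigen_system_decomp[OF es] by (intro sum.cong refl) auto
    also have "\<dots> = (\<Sum>c<n. es c * u c j * (\<Sum>l<n. u a l * u c l))"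
      unfolding sum_distrib_left sum_distrib_right by (subst sum.swap) (simp only: algebra_simps)
    also have "\<dots> = (\<Sum>c<n. es c * u c j * (if c = a then 1 else 0))"
      by (intro sum.cong refl) (use a eigen_systemD(1)[OF es] in auto)
    also have "\<dots> = es a * u a j" using a by (simp add: if_distrib cong: if_cong)
    finally show "(\<Sum>l<n. u a l * f l j) = es a * u a j" .
  qed
  finally show ?case by (simp add: algebra_simps)
qed

lemma sum_PiE_lessThan_Suc:
  fixes F :: "(nat \<Rightarrow> 'b) \<Rightarrow> 'c::comm_monoid_add"
  shows "(\<Sum>p\<in>PiE {..<Suc k} (\<lambda>_. S). F p) = (\<Sum>p\<in>PiE {..<k} (\<lambda>_. S). \<Sum>x\<in>S. F (p(k := x)))"
proof -
  have eq: "PiE {..<Suc k} (\<lambda>_. S) = (\<lambda>(y, g). g(k := y)) ` (S \<times> PiE {..<k} (\<lambda>_. S))"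
    by (simp add: lessThan_Suc PiE_insert_eq)
  have inj: "inj_on (\<lambda>(y, g). g(k := y)) (S \<times> PiE {..<k} (\<lambda>_. S))"
    using inj_combinator[of k "{..<k}" "\<lambda>_. S"] by simp
  have "(\<Sum>p\<in>PiE {..<Suc k} (\<lambda>_. S). F p) = (\<Sum>(y,g)\<in>S \<times> PiE {..<k} (\<lambda>_. S). F (g(k := y)))"
    unfolding eq by (subst sum.reindex[OF inj]) (simp add: case_prod_unfold)
  also have "\<dots> = (\<Sum>p\<in>PiE {..<k} (\<lambda>_. S). \<Sum>x\<in>S. F (p(k := x)))"
    by (subst sum.cartesian_product[symmetric]) (rule sum.swap)
  finally show ?thesis .
qed

text \<open>An arbitrary weight \<open>g\<close> on the two end points lets the induction absorb the
  last step of the path into \<open>g\<close>. Taking \<open>g a b = f b a\<close> later closes the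
  path to a circuit.\<close>

lemma path_weight_sum:
  "(\<Sum>p\<in>PiE {..<Suc k} (\<lambda>_. {..<n}). (\<Prod>i<k. f (p i) (p (Suc i))) * g (p 0) (p k))
     = (\<Sum>i<n. \<Sum>j<n. path_weight n f k i j * g i j)"
proof (induction k arbitrary: g)
  case 0
  have "(\<Sum>i<n. \<Sum>j<n. (if i = j then 1 else 0) * g i j) = (\<Sum>i<n. \<Sum>j<n. if j = i then g i i else 0)"
    by (intro sum.cong refl) auto
  then show ?case by (simp add: sum_PiE_lessThan_Suc)
next
  case (Suc k)
  have "(\<Sum>p\<in>PiE {..<Suc (Suc k)} (\<lambda>_. {..<n}). (\<Prod>i<Suc k. f (p i) (p (Suc i))) * g (p 0) (p (Suc k)))
     = (\<Sum>p\<in>PiE {..<Suc k} (\<lambda>_. {..<n}). \<Sum>x<n. (\<Prod>i<k. f (p i) (p (Suc i))) * (f (p k) x * g (p 0) x))"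
    by (subst sum_PiE_lessThan_Suc) (intro sum.cong refl, auto simp: mult.assoc intro!: prod.cong)
  also have "\<dots> = (\<Sum>p\<in>PiE {..<Suc k} (\<lambda>_. {..<n}). (\<Prod>i<k. f (p i) (p (Suc i))) * (\<lambda>a b. \<Sum>x<n. f b x * g a x) (p 0) (p k))"
    by (simp add: sum_distrib_left)
  also have "\<dots> = (\<Sum>i<n. \<Sum>j<n. path_weight n f k i j * (\<Sum>x<n. f j x * g i x))"
    by (rule Suc.IH)
  also have "\<dots> = (\<Sum>i<n. \<Sum>x<n. (\<Sum>j<n. path_weight n f k i j * f j x) * g i x)"
    unfolding sum_distrib_left sum_distrib_right
    by (rule sum.cong[OF refl], subst sum.swap) (simp only: algebra_simps)
  finally show ?case by simp
qed

text \<open>A closed walk stored by its \<open>k\<close> vertices; the closing vertex is not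
  repeated, so the successor of position \<open>i\<close> is \<open>Suc i mod k\<close>. Vertices
  are counted from 0.\<close>

definition circuits :: "nat \<Rightarrow> nat \<Rightarrow> (nat \<Rightarrow> nat) set" where
  "circuits k n = PiE {..<k} (\<lambda>_. {..<n})"

text \<open>Both sides are the trace of the \<open>k\<close>-th power, once through the eigenvector
  expansion and once through sums over paths.\<close>

lemma spec_power_sum:
  assumes sym: "sym_on n f" and k: "k > 0"
  shows "(\<Sum>a<n. spec n f a ^ k) = (\<Sum>p\<in>circuits k n. \<Prod>i<k. f (p i) (p (Suc i mod k)))"
proof -
  obtain u where es: "eigen_system n f (spec n f) u" using spec_eigen_system[OF sym] .
  define e where "e = spec n f"
  note es = es[folded e_def]
  obtain m where m: "k = Suc m" using k by (cases k) auto
  have "(\<Sum>p\<in>circuits k n. \<Prod>i<k. f (p i) (p (Suc i mod k)))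
     = (\<Sum>p\<in>PiE {..<Suc m} (\<lambda>_. {..<n}). (\<Prod>i<m. f (p i) (p (Suc i))) * (\<lambda>a b. f b a) (p 0) (p m))"
    unfolding circuits_def m by (intro sum.cong refl) (auto intro!: prod.cong)
  also have "\<dots> = (\<Sum>i<n. \<Sum>j<n. path_weight n f m i j * f j i)" by (rule path_weight_sum)
  also have "\<dots> = (\<Sum>i<n. path_weight n f k i i)" by (simp add: m)
  also have "\<dots> = (\<Sum>i<n. \<Sum>a<n. e a ^ k * u a i * u a i)"
    by (intro sum.cong refl) (simp add: path_weight_eigen[OF es])
  also have "\<dots> = (\<Sum>a<n. e a ^ k * (\<Sum>i<n. u a i * u a i))"
    unfolding sum_distrib_left by (subst sum.swap) (simp only: algebra_simps)
  also have "\<dots> = (\<Sum>a<n. e a ^ k)" by (intro sum.cong refl) (simp add: eigen_systemD(1)[OF es])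
  finally show ?thesis by (simp add: e_def)
qed

subsection \<open>Perturbation\<close>

lemma iexp_Lipschitz: "cmod (iexp a - iexp b) \<le> \<bar>a - b\<bar>"
proof -
  have "iexp a - iexp b = iexp b * (iexp (a - b) - 1)"
    by (simp add: algebra_simps flip: exp_add)
  then have "cmod (iexp a - iexp b) = cmod (iexp (a - b) - 1)" by (simp add: norm_mult)
  also have "\<dots> \<le> \<bar>a - b\<bar>" using iexp_approx1[of "a - b" 0] by simp
  finally show ?thesis .
qed

definition spec_char :: "nat \<Rightarrow> (nat \<Rightarrow> nat \<Rightarrow> real) \<Rightarrow> real \<Rightarrow> complex" where
  "spec_char n f t = (\<Sum>a<n. iexp (t * spec n f a)) / of_nat n"

text \<open>The squared overlaps \<open>(q a b)\<^sup>2\<close> of the two eigenbases form a doubly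
  stochastic matrix, so both exponential sums become double sums with the same weights. The
  Lipschitz bound and Cauchy-Schwarz then leave the weighted sum of
  \<open>(e a - e' b)\<^sup>2\<close>, which is exactly the squared Frobenius norm of the
  difference.\<close>

lemma spec_char_perturb_sum:
  assumes symf: "sym_on n f" and symg: "sym_on n g"
  shows "cmod ((\<Sum>a<n. iexp (t * spec n f a)) - (\<Sum>a<n. iexp (t * spec n g a)))
     \<le> \<bar>t\<bar> * sqrt (real n * (\<Sum>i<n. \<Sum>j<n. (f i j - g i j)\<^sup>2))"
proof -
  obtain u where es: "eigen_system n f (spec n f) u" using spec_eigen_system[OF symf] .
  obtain v where es': "eigen_system n g (spec n g) v" using spec_eigen_system[OF symg] .
  define e e' where "e = spec n f" and "e' = spec n g"
  note es = es[folded e_def] and es' = es'[folded e'_def]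
  define q where "q a b = (\<Sum>i<n. u a i * v b i)" for a b
  have parseval: "(\<Sum>b<n. (\<Sum>i<n. x i * w b i)\<^sup>2) = (\<Sum>i<n. (x i)\<^sup>2)"
    if w: "\<And>i j. i < n \<Longrightarrow> j < n \<Longrightarrow> (\<Sum>a<n. w a i * w a j) = (if i = j then 1 else 0)"
    for x :: "nat \<Rightarrow> real" and w
  proof -
    have "(\<Sum>b<n. (\<Sum>i<n. x i * w b i)\<^sup>2) = (\<Sum>b<n. \<Sum>i<n. \<Sum>j<n. x i * x j * (w b i * w b j))"
      by (intro sum.cong refl) (simp add: power2_eq_square sum_product algebra_simps)
    also have "\<dots> = (\<Sum>i<n. \<Sum>b<n. \<Sum>j<n. x i * x j * (w b i * w b j))" by (rule sum.swap)
    also have "\<dots> = (\<Sum>i<n. \<Sum>j<n. x i * x j * (\<Sum>b<n. w b i * w b j))"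
      unfolding sum_distrib_left by (intro sum.cong refl sum.swap)
    also have "\<dots> = (\<Sum>i<n. \<Sum>j<n. if j = i then x i * x i else 0)"
      by (intro sum.cong refl) (auto simp: w)
    finally show ?thesis by (simp add: power2_eq_square)
  qed
  have q1: "(\<Sum>b<n. (q a b)\<^sup>2) = 1" if "a < n" for a
  proof -
    have "(\<Sum>b<n. (q a b)\<^sup>2) = (\<Sum>i<n. (u a i)\<^sup>2)"
      unfolding q_def by (rule parseval) (rule eigen_systemD(3)[OF es'])
    then show ?thesis using eigen_systemD(1)[OF es that that] by (simp add: power2_eq_square)
  qed
  have q2: "(\<Sum>a<n. (q a b)\<^sup>2) = 1" if "b < n" for b
  proof -
    have "(\<Sum>a<n. (q a b)\<^sup>2) = (\<Sum>i<n. (v b i)\<^sup>2)"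
      unfolding q_def mult.commute[of "u _ _"] by (rule parseval) (rule eigen_systemD(3)[OF es])
    then show ?thesis using eigen_systemD(1)[OF es' that that] by (simp add: power2_eq_square)
  qed
  \<comment> \<open>The bilinear form of \<open>f - g\<close> at \<open>u a\<close> and
    \<open>v b\<close>, evaluated by letting \<open>f\<close> act on \<open>u a\<close> and
    \<open>g\<close> act on \<open>v b\<close>. These numbers are the entries of
    \<open>f - g\<close> in the two bases.\<close>
  have key: "(\<Sum>i<n. u a i * (\<Sum>j<n. (f i j - g i j) * v b j)) = (e a - e' b) * q a b"
    if ab: "a < n" "b < n" for a b
  proof -
    have "(\<Sum>i<n. u a i * (\<Sum>j<n. f i j * v b j)) = (\<Sum>j<n. (\<Sum>i<n. f j i * u a i) * v b j)"
      unfolding sum_distrib_left sum_distrib_right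
      by (subst sum.swap) (use symf in \<open>auto simp: sym_on_def intro!: sum.cong\<close>)
    also have "\<dots> = (\<Sum>j<n. e a * u a j * v b j)"
      by (intro sum.cong refl) (use eigen_systemD(2)[OF es] ab in auto)
    also have "\<dots> = e a * q a b" by (simp add: q_def sum_distrib_left mult.assoc)
    finally have 1: "(\<Sum>i<n. u a i * (\<Sum>j<n. f i j * v b j)) = e a * q a b" .
    have "(\<Sum>i<n. u a i * (\<Sum>j<n. g i j * v b j)) = (\<Sum>i<n. u a i * (e' b * v b i))"
      by (intro sum.cong refl) (use eigen_systemD(2)[OF es'] ab in auto)
    also have "\<dots> = e' b * q a b" by (simp add: q_def sum_distrib_left algebra_simps)
    finally have 2: "(\<Sum>i<n. u a i * (\<Sum>j<n. g i j * v b j)) = e' b * q a b" .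
    show ?thesis using 1 2 by (simp add: left_diff_distrib right_diff_distrib sum_subtractf)
  qed
  have frob: "(\<Sum>a<n. \<Sum>b<n. ((e a - e' b) * q a b)\<^sup>2) = (\<Sum>i<n. \<Sum>j<n. (f i j - g i j)\<^sup>2)"
  proof -
    have "(\<Sum>a<n. \<Sum>b<n. ((e a - e' b) * q a b)\<^sup>2)
        = (\<Sum>b<n. \<Sum>a<n. (\<Sum>i<n. (\<Sum>j<n. (f i j - g i j) * v b j) * u a i)\<^sup>2)"
      by (subst sum.swap) (intro sum.cong refl, simp only: mult.commute[of "sum _ _"] key lessThan_iff)
    also have "\<dots> = (\<Sum>b<n. \<Sum>i<n. (\<Sum>j<n. (f i j - g i j) * v b j)\<^sup>2)"
      by (intro sum.cong refl parseval eigen_systemD(3)[OF es])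
    also have "\<dots> = (\<Sum>i<n. \<Sum>b<n. (\<Sum>j<n. (f i j - g i j) * v b j)\<^sup>2)" by (rule sum.swap)
    also have "\<dots> = (\<Sum>i<n. \<Sum>j<n. (f i j - g i j)\<^sup>2)"
      by (intro sum.cong refl parseval eigen_systemD(3)[OF es'])
    finally show ?thesis .
  qed
  have sq: "(q a b)\<^sup>2 * (T * D) = T * (\<bar>q a b\<bar> * (\<bar>q a b\<bar> * D))" for a b T D
  proof -
    have "(q a b)\<^sup>2 = \<bar>q a b\<bar> * \<bar>q a b\<bar>" by (simp add: power2_eq_square)
    then show ?thesis by (simp only: ac_simps)
  qed
  have 1: "(\<Sum>a<n. iexp (t * e a)) = (\<Sum>a<n. \<Sum>b<n. of_real ((q a b)\<^sup>2) * iexp (t * e a))"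
    by (intro sum.cong refl) (simp only: q1 lessThan_iff of_real_1 mult_1 flip: sum_distrib_right of_real_sum)
  have 2: "(\<Sum>b<n. iexp (t * e' b)) = (\<Sum>a<n. \<Sum>b<n. of_real ((q a b)\<^sup>2) * iexp (t * e' b))"
    by (subst sum.swap, intro sum.cong refl) (simp only: q2 lessThan_iff of_real_1 mult_1 flip: sum_distrib_right of_real_sum)
  have "cmod ((\<Sum>a<n. iexp (t * e a)) - (\<Sum>a<n. iexp (t * e' a)))
     = cmod (\<Sum>(a,b)\<in>{..<n}\<times>{..<n}. of_real ((q a b)\<^sup>2) * (iexp (t * e a) - iexp (t * e' b)))"
    unfolding 1 2 by (simp add: sum.cartesian_product sum_subtractf[symmetric] case_prod_unfold right_diff_distrib)
  also have "\<dots> \<le> (\<Sum>(a,b)\<in>{..<n}\<times>{..<n}. (q a b)\<^sup>2 * (\<bar>t\<bar> * \<bar>e a - e' b\<bar>))"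
  proof (rule sum_norm_le, clarify)
    fix a b
    have "cmod (iexp (t * e a) - iexp (t * e' b)) \<le> \<bar>t\<bar> * \<bar>e a - e' b\<bar>"
      using iexp_Lipschitz[of "t * e a" "t * e' b"] by (simp add: abs_mult flip: right_diff_distrib)
    then show "cmod (of_real ((q a b)\<^sup>2) * (iexp (t * e a) - iexp (t * e' b)))
       \<le> (q a b)\<^sup>2 * (\<bar>t\<bar> * \<bar>e a - e' b\<bar>)"
      by (simp add: norm_mult norm_power mult_left_mono)
  qed
  \<comment> \<open>The weight is split as \<open>\<bar>q\<bar> * \<bar>q\<bar>\<close> for
    Cauchy-Schwarz: the first factor alone has square sum \<open>n\<close>, the second goes with the
    eigenvalue difference.\<close>
  also have "\<dots> = \<bar>t\<bar> * (\<Sum>x\<in>{..<n}\<times>{..<n}. \<bar>q (fst x) (snd x)\<bar> * (\<bar>q (fst x) (snd x)\<bar> * \<bar>e (fst x) - e' (snd x)\<bar>))"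
    unfolding sum_distrib_left by (intro sum.cong refl) (simp add: case_prod_unfold sq)
  also have "\<dots> \<le> \<bar>t\<bar> * sqrt ((\<Sum>x\<in>{..<n}\<times>{..<n}. \<bar>q (fst x) (snd x)\<bar>\<^sup>2) *
      (\<Sum>x\<in>{..<n}\<times>{..<n}. (\<bar>q (fst x) (snd x)\<bar> * \<bar>e (fst x) - e' (snd x)\<bar>)\<^sup>2))"
    by (intro mult_left_mono real_le_rsqrt Cauchy_Schwarz_ineq_sum) auto
  also have "(\<Sum>x\<in>{..<n}\<times>{..<n}. \<bar>q (fst x) (snd x)\<bar>\<^sup>2) = real n"
    using q1 by (simp add: sum.cartesian_product' )
  also have "(\<Sum>x\<in>{..<n}\<times>{..<n}. (\<bar>q (fst x) (snd x)\<bar> * \<bar>e (fst x) - e' (snd x)\<bar>)\<^sup>2) = (\<Sum>i<n. \<Sum>j<n. (f i j - g i j)\<^sup>2)"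
    unfolding frob[symmetric] by (simp add: sum.cartesian_product' power_mult_distrib mult.commute)
  finally show ?thesis by (simp add: e_def e'_def)
qed

lemma spec_char_perturb:
  assumes "sym_on n f" "sym_on n g"
  shows "cmod (spec_char n f t - spec_char n g t) \<le> \<bar>t\<bar> * sqrt ((\<Sum>i<n. \<Sum>j<n. (f i j - g i j)\<^sup>2) / real n)"
proof (cases "n = 0")
  case False
  define S where "S = (\<Sum>i<n. \<Sum>j<n. (f i j - g i j)\<^sup>2)"
  have "cmod (spec_char n f t - spec_char n g t)
    = cmod ((\<Sum>a<n. iexp (t * spec n f a)) - (\<Sum>a<n. iexp (t * spec n g a))) / real n"
    unfolding spec_char_def by (simp add: norm_divide flip: diff_divide_distrib)
  also have "\<dots> \<le> \<bar>t\<bar> * sqrt (real n * S) / real n"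
    unfolding S_def by (intro divide_right_mono spec_char_perturb_sum assms) auto
  also have "sqrt (real n * S) / real n = sqrt (S / real n)"
    using False by (simp add: real_sqrt_mult real_sqrt_divide field_simps)
  then have "\<bar>t\<bar> * sqrt (real n * S) / real n = \<bar>t\<bar> * sqrt (S / real n)" by (metis times_divide_eq_right)
  finally show ?thesis by (simp add: S_def)
qed (simp add: spec_char_def)

text \<open>Both sides have the same power series in \<open>t\<close>.\<close>

lemma spec_char_pad:
  assumes sym: "sym_on m f" and mn: "m \<le> n"
  defines "g \<equiv> \<lambda>i j. if i < m \<and> j < m then f i j else 0"
  shows "sym_on n g"
    and "(\<Sum>a<n. iexp (t * spec n g a)) = (\<Sum>a<m. iexp (t * spec m f a)) + of_nat (n - m)"
proof -
  show symg: "sym_on n g" using sym by (auto simp: sym_on_def g_def)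
  have pw: "(\<Sum>a<n. spec n g a ^ k) = (\<Sum>a<m. spec m f a ^ k)" if k: "k > 0" for k
  proof -
    have sub: "circuits k m \<subseteq> circuits k n"
      unfolding circuits_def using mn by (intro PiE_mono) auto
    have "(\<Sum>p\<in>circuits k n. \<Prod>i<k. g (p i) (p (Suc i mod k)))
       = (\<Sum>p\<in>circuits k m. \<Prod>i<k. g (p i) (p (Suc i mod k)))"
    proof (rule sum.mono_neutral_right[OF _ sub], goal_cases)
      case 1
      show ?case by (simp add: circuits_def finite_PiE)
    next
      case 2
      show ?case
      proof
        fix p assume p: "p \<in> circuits k n - circuits k m"
        then obtain i where "i < k" "\<not> p i < m" unfolding circuits_def by (auto simp: PiE_iff)
        then show "(\<Prod>i<k. g (p i) (p (Suc i mod k))) = 0"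
          by (intro prod_zero) (auto simp: g_def)
      qed
    qed
    also have "\<dots> = (\<Sum>p\<in>circuits k m. \<Prod>i<k. f (p i) (p (Suc i mod k)))"
      by (intro sum.cong prod.cong refl) (use k in \<open>auto simp: g_def circuits_def PiE_iff\<close>)
    finally show ?thesis using spec_power_sum[OF symg k] spec_power_sum[OF sym k] by simp
  qed
  have ser: "(\<lambda>k. (\<i> * t) ^ k / fact k * of_real (\<Sum>a<N. (s a) ^ k)) sums (\<Sum>a<N. iexp (t * s a))"
    for N :: nat and s :: "nat \<Rightarrow> real"
  proof -
    have "(\<lambda>k. \<Sum>a<N. (\<i> * complex_of_real (t * s a)) ^ k /\<^sub>R fact k) sums (\<Sum>a<N. iexp (t * s a))"
      by (intro sums_sum exp_converges)
    moreover have "(\<Sum>a<N. (\<i> * complex_of_real (t * s a)) ^ k /\<^sub>R fact k)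
       = (\<i> * t) ^ k / fact k * of_real (\<Sum>a<N. (s a) ^ k)" for k
      by (simp add: sum_distrib_left scaleR_conv_of_real field_simps power_mult_distrib)
    ultimately show ?thesis by simp
  qed
  \<comment> \<open>Padding adds \<open>n - m\<close> zero eigenvalues, which are invisible to
    positive power sums; only the coefficient at \<open>k = 0\<close> has to be corrected.\<close>
  have "(\<lambda>k. (\<i> * t) ^ k / fact k * of_real (\<Sum>a<m. (spec m f a) ^ k) + (if k = 0 then of_nat (n - m) else 0))
      sums ((\<Sum>a<m. iexp (t * spec m f a)) + of_nat (n - m))"
    by (intro sums_add ser) (use sums_single[of 0 "\<lambda>_. of_nat (n-m) :: complex"] in simp)
  moreover have "(\<lambda>k. (\<i> * t) ^ k / fact k * of_real (\<Sum>a<m. (spec m f a) ^ k) + (if k = 0 then of_nat (n - m) else 0))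
     = (\<lambda>k. (\<i> * t) ^ k / fact k * of_real (\<Sum>a<n. (spec n g a) ^ k))"
  proof
    fix k show "(\<i> * t) ^ k / fact k * of_real (\<Sum>a<m. (spec m f a) ^ k) + (if k = 0 then of_nat (n - m) else 0)
       = (\<i> * t) ^ k / fact k * of_real (\<Sum>a<n. (spec n g a) ^ k)"
      using pw[of k] mn by (cases "k = 0") (auto simp: of_nat_diff)
  qed
  ultimately show "(\<Sum>a<n. iexp (t * spec n g a)) = (\<Sum>a<m. iexp (t * spec m f a)) + of_nat (n - m)"
    using sums_unique2[OF ser[where N=n and s="spec n g"]] by simp
qed

section \<open>Circuits and their letters\<close>

text \<open>A canonical representative of all positions carrying the same letter. It turns the
  coincidences in a circuit into a self-map \<open>r\<close> of the positions with
  \<open>r i \<le> i\<close>, of which there are finitely many.\<close>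

definition first_occ :: "(nat \<Rightarrow> 'i) \<Rightarrow> nat \<Rightarrow> nat" where
  "first_occ l i = (LEAST j. l j = l i)"

lemma first_occ_letter [simp]: "l (first_occ l i) = l i"
  unfolding first_occ_def by (rule LeastI[of _ i]) simp

lemma first_occ_le: "first_occ l i \<le> i"
  unfolding first_occ_def by (rule Least_le) simp

lemma first_occ_least: "l j = l i \<Longrightarrow> first_occ l i \<le> j"
  unfolding first_occ_def by (rule Least_le)

lemma first_occ_cong: "l i = l j \<Longrightarrow> first_occ l i = first_occ l j"
  unfolding first_occ_def by simp

lemma card_first_occ_fixed: "card {i. i < N \<and> first_occ l i = i} = card (l ` {..<N})"
proof -
  have "inj_on l {i. i < N \<and> first_occ l i = i}"
  proof (rule inj_onI)
    fix i j assume "i \<in> {i. i < N \<and> first_occ l i = i}" "j \<in> {i. i < N \<and> first_occ l i = i}" "l i = l j"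
    then show "i = j" using first_occ_cong[of l i j] by simp
  qed
  moreover have "l ` {i. i < N \<and> first_occ l i = i} = l ` {..<N}"
  proof (intro equalityI subsetI)
    fix t assume "t \<in> l ` {..<N}"
    then obtain i where i: "i < N" "t = l i" by auto
    have "first_occ l i < N" using first_occ_le[of l i] i by simp
    moreover have "first_occ l (first_occ l i) = first_occ l i" by (rule first_occ_cong) simp
    ultimately show "t \<in> l ` {i. i < N \<and> first_occ l i = i}"
      using i by (intro image_eqI[of _ _ "first_occ l i"]) auto
  qed auto
  ultimately show ?thesis by (metis card_image)
qed

lemma sum_card_fibres:
  assumes "finite A"
  shows "(\<Sum>t\<in>l ` A. card {i\<in>A. l i = t}) = card A"
  using sum.image_gen[OF assms, of "\<lambda>_. 1::nat" l] by simp

text \<open>Positions are counted letter by letter. The strict version matters later: a letter used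
  three times leaves fewer than half as many letters as positions, which costs a power of
  \<open>n\<close> in counting circuits.\<close>

lemma card_image_matched:
  assumes A: "finite A" and 2: "\<And>i. i \<in> A \<Longrightarrow> card {j\<in>A. l j = l i} \<ge> 2"
  shows "2 * card (l ` A) \<le> card A"
    and "i0 \<in> A \<Longrightarrow> card {j\<in>A. l j = l i0} > 2 \<Longrightarrow> 2 * card (l ` A) < card A"
proof -
  have ge: "2 \<le> card {i\<in>A. l i = t}" if "t \<in> l ` A" for t using that 2 by auto
  have c: "2 * card (l ` A) = (\<Sum>t\<in>l ` A. 2)" by simp
  show "2 * card (l ` A) \<le> card A"
    unfolding c sum_card_fibres[OF A, symmetric, of l] by (rule sum_mono) (rule ge)
  assume "i0 \<in> A" "card {j\<in>A. l j = l i0} > 2"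
  then show "2 * card (l ` A) < card A"
    unfolding c sum_card_fibres[OF A, symmetric, of l] using A
    by (intro sum_strict_mono_ex1) (auto intro: ge)
qed

lemma card_ge_3I:
  assumes "finite A" "i \<in> A" "j \<in> A" "k \<in> A" "i \<noteq> j" "i \<noteq> k" "j \<noteq> k"
  shows "card A > 2"
  using card_mono[of A "{i,j,k}"] assms by simp

locale link =
  fixes L :: "nat \<Rightarrow> nat \<Rightarrow> 'i"
  assumes L_sym: "L i j = L j i" and L_inj: "L i j = L i j' \<Longrightarrow> j = j'"
begin

text \<open>The successor \<open>s\<close> is a parameter so that one counting argument serves
  single circuits (\<open>cyc\<close>) and two circuits side by side (\<open>cyc2\<close>).\<close>

definition letters :: "(nat \<Rightarrow> nat) \<Rightarrow> (nat \<Rightarrow> nat) \<Rightarrow> nat \<Rightarrow> 'i" where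
  "letters s p i = L (p i) (p (s i))"

text \<open>\<open>B\<close> holds the starting vertices. Any other vertex \<open>v\<close> is the
  end of step \<open>v - 1\<close> and is free when that step is the representative of its class
  under \<open>r\<close>, so that its letter is new; all remaining vertices are forced.\<close>

definition free_vertices :: "nat \<Rightarrow> nat set \<Rightarrow> (nat \<Rightarrow> nat) \<Rightarrow> nat set" where
  "free_vertices N B r = B \<union> {v. v < N \<and> v \<notin> B \<and> r (v - 1) = v - 1}"

text \<open>If \<open>v\<close> is not free, step \<open>v - 1\<close> repeats the letter of an
  earlier step whose two end points are already known, and so is the left end point
  \<open>v - 1\<close>; \<open>L_inj\<close> then yields the value at \<open>v\<close>.\<close>

lemma letters_determine:
  assumes s: "\<And>i. i < N \<Longrightarrow> s i \<le> Suc i"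
    and chain: "\<And>v. v < N \<Longrightarrow> v \<notin> B \<Longrightarrow> v > 0 \<and> s (v - 1) = v"
    and r: "\<And>i. i < N \<Longrightarrow> r i \<le> i"
    and p: "\<And>i. i < N \<Longrightarrow> letters s p (r i) = letters s p i"
    and p': "\<And>i. i < N \<Longrightarrow> letters s p' (r i) = letters s p' i"
    and agree: "\<And>v. v \<in> free_vertices N B r \<Longrightarrow> p v = p' v"
    and v: "v < N"
  shows "p v = p' v"
  using v
proof (induction v rule: less_induct)
  case (less v)
  show ?case
  proof (cases "v \<in> free_vertices N B r")
    case False
    then have vB: "v \<notin> B" and "r (v - 1) \<noteq> v - 1" using less.prems by (auto simp: free_vertices_def)
    have v: "v > 0" "s (v - 1) = v" using chain[OF less.prems vB] by auto
    have "r (v - 1) \<le> v - 1" using less.prems by (intro r) simp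
    with \<open>r (v - 1) \<noteq> v - 1\<close> have rv: "r (v - 1) < v - 1" by simp
    note v = v rv
    let ?j = "r (v - 1)"
    \<comment> \<open>The earlier step ends at most one position after \<open>?j < v - 1\<close>,
      hence strictly before \<open>v\<close>, and the induction hypothesis covers both of its
      ends.\<close>
    have sj: "s ?j \<le> v - 1" using s[of ?j] v less.prems by linarith
    have "L (p (v - 1)) (p v) = letters s p ?j" using p[of "v - 1"] v less.prems by (simp add: letters_def)
    also have "\<dots> = letters s p' ?j"
      unfolding letters_def using less.IH[of ?j] less.IH[of "s ?j"] v sj less.prems by simp
    also have "\<dots> = L (p' (v - 1)) (p' v)" using p'[of "v - 1"] v less.prems by (simp add: letters_def)
    also have "p' (v - 1) = p (v - 1)" using less.IH[of "v - 1"] v less.prems by simp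
    finally show ?thesis by (rule L_inj)
  qed (rule agree)
qed

text \<open>The coincidences prescribed by \<open>r\<close> must hold and further ones may occur.
  This makes the condition a system of equations, solved by propagating free values;
  \<open>exact\<close> excludes the further coincidences.\<close>

definition matching :: "nat \<Rightarrow> (nat \<Rightarrow> nat) \<Rightarrow> nat \<Rightarrow> (nat \<Rightarrow> nat) \<Rightarrow> (nat \<Rightarrow> nat) set" where
  "matching N s n r = {p \<in> circuits N n. \<forall>i<N. letters s p (r i) = letters s p i}"

lemma finite_circuits [simp]: "finite (circuits N n)"
  by (simp add: circuits_def finite_PiE)

lemma finite_matching [simp]: "finite (matching N s n r)"
  by (simp add: matching_def)

lemma finite_free_vertices: "B \<subseteq> {..<N} \<Longrightarrow> finite (free_vertices N B r)"
  by (rule finite_subset[of _ "{..<N}"]) (auto simp: free_vertices_def)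

lemma inj_on_restrict_matching:
  assumes s: "\<And>i. i < N \<Longrightarrow> s i \<le> Suc i"
    and chain: "\<And>v. v < N \<Longrightarrow> v \<notin> B \<Longrightarrow> v > 0 \<and> s (v - 1) = v"
    and r: "\<And>i. i < N \<Longrightarrow> r i \<le> i"
  shows "inj_on (\<lambda>p. restrict p (free_vertices N B r)) (matching N s n r)"
proof (rule inj_onI)
  fix p p' assume p: "p \<in> matching N s n r" "p' \<in> matching N s n r"
    and eq: "restrict p (free_vertices N B r) = restrict p' (free_vertices N B r)"
  have "p v = p' v" if "v < N" for v
  proof (rule letters_determine[OF s chain r _ _ _ that])
    fix v assume "v \<in> free_vertices N B r"
    then show "p v = p' v" using fun_cong[OF eq, of v] by simp
  qed (use p in \<open>auto simp: matching_def\<close>)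
  then show "p = p'"
    using p by (intro PiE_ext[of _ "{..<N}"]) (auto simp: matching_def circuits_def)
qed

lemma card_matching:
  assumes s: "\<And>i. i < N \<Longrightarrow> s i \<le> Suc i"
    and chain: "\<And>v. v < N \<Longrightarrow> v \<notin> B \<Longrightarrow> v > 0 \<and> s (v - 1) = v"
    and r: "\<And>i. i < N \<Longrightarrow> r i \<le> i" and B: "B \<subseteq> {..<N}"
  shows "card (matching N s n r) \<le> n ^ card (free_vertices N B r)"
proof -
  let ?F = "free_vertices N B r"
  have F: "?F \<subseteq> {..<N}" "finite ?F" using B finite_free_vertices[OF B] by (auto simp: free_vertices_def)
  have "(\<lambda>p. restrict p ?F) ` matching N s n r \<subseteq> PiE ?F (\<lambda>_. {..<n})"
    using F by (auto simp: matching_def circuits_def)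
  then have "card (matching N s n r) \<le> card (PiE ?F (\<lambda>_. {..<n}))"
    by (intro card_inj_on_le[OF inj_on_restrict_matching[OF s chain r]]) (auto intro: finite_PiE F)
  also have "\<dots> = n ^ card ?F" using F by (simp add: card_PiE)
  finally show ?thesis .
qed

lemma card_free_vertices:
  assumes B: "B \<subseteq> {..<N}" and chain: "\<And>v. v < N \<Longrightarrow> v \<notin> B \<Longrightarrow> v > 0"
  shows "card (free_vertices N B r) \<le> card B + card {i. Suc i < N \<and> Suc i \<notin> B \<and> r i = i}"
proof -
  have fin: "finite {i. Suc i < N \<and> Suc i \<notin> B \<and> r i = i}"
    by (rule finite_subset[of _ "{..<N}"]) auto
  have "{v. v < N \<and> v \<notin> B \<and> r (v - 1) = v - 1} \<subseteq> Suc ` {i. Suc i < N \<and> Suc i \<notin> B \<and> r i = i}"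
  proof
    fix v assume v: "v \<in> {v. v < N \<and> v \<notin> B \<and> r (v - 1) = v - 1}"
    with chain[of v] have "v > 0" by simp
    with v show "v \<in> Suc ` {i. Suc i < N \<and> Suc i \<notin> B \<and> r i = i}"
      by (intro image_eqI[of _ _ "v - 1"]) auto
  qed
  then have "card {v. v < N \<and> v \<notin> B \<and> r (v - 1) = v - 1} \<le> card {i. Suc i < N \<and> Suc i \<notin> B \<and> r i = i}"
    using fin by (meson card_image_le card_mono finite_imageI le_trans)
  then show ?thesis unfolding free_vertices_def using card_Un_le[of B] by (meson add_left_mono le_trans)
qed

text \<open>Every circuit matches its own pattern of first occurrences. There are at most
  \<open>N ^ N\<close> patterns, and each admits at most one factor \<open>n\<close> per free
  vertex.\<close>

lemma card_circuits_by_pattern: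
  assumes N: "N > 0" and s: "\<And>i. i < N \<Longrightarrow> s i \<le> Suc i"
    and chain: "\<And>v. v < N \<Longrightarrow> v \<notin> B \<Longrightarrow> v > 0 \<and> s (v - 1) = v" and B: "B \<subseteq> {..<N}"
    and P: "\<And>p. p \<in> circuits N n \<Longrightarrow> P p \<Longrightarrow>
       card B + card {i. Suc i < N \<and> Suc i \<notin> B \<and> first_occ (letters s p) i = i} \<le> m"
  shows "card {p \<in> circuits N n. P p} \<le> N ^ N * n ^ m"
proof (cases "n = 0")
  case True
  then have "circuits N n = {}" using N by (auto simp: circuits_def PiE_eq_empty_iff)
  then show ?thesis by simp
next
  case False
  define R where "R = {r \<in> PiE {..<N} (\<lambda>_. {..<N}). (\<forall>i<N. r i \<le> i) \<and> card (free_vertices N B r) \<le> m}"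
  have "R \<subseteq> PiE {..<N} (\<lambda>_. {..<N})" by (auto simp: R_def)
  then have R: "finite R" "card R \<le> N ^ N"
    using finite_subset[of R] card_mono[of "PiE {..<N} (\<lambda>_. {..<N})" R] by (auto simp: finite_PiE card_PiE)
  have "{p \<in> circuits N n. P p} \<subseteq> (\<Union>r\<in>R. matching N s n r)"
  proof
    fix p assume "p \<in> {p \<in> circuits N n. P p}"
    then have p: "p \<in> circuits N n" "P p" by auto
    define r where "r = restrict (first_occ (letters s p)) {..<N}"
    have "{i. Suc i < N \<and> Suc i \<notin> B \<and> r i = i} = {i. Suc i < N \<and> Suc i \<notin> B \<and> first_occ (letters s p) i = i}"
      by (auto simp: r_def)
    then have "card (free_vertices N B r) \<le> m"
      using card_free_vertices[OF B, of r] chain P[OF p] by force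
    moreover have "r \<in> PiE {..<N} (\<lambda>_. {..<N})"
      using first_occ_le[of "letters s p"] by (auto simp: r_def intro: le_less_trans)
    ultimately have "r \<in> R" by (auto simp: R_def r_def first_occ_le)
    moreover have "p \<in> matching N s n r" using p by (auto simp: matching_def r_def)
    ultimately show "p \<in> (\<Union>r\<in>R. matching N s n r)" by blast
  qed
  then have "card {p \<in> circuits N n. P p} \<le> card (\<Union>r\<in>R. matching N s n r)"
    using R by (intro card_mono) auto
  also have "\<dots> \<le> (\<Sum>r\<in>R. card (matching N s n r))" by (rule card_UN_le[OF R(1)])
  also have "\<dots> \<le> (\<Sum>r\<in>R. n ^ m)"
  proof (rule sum_mono)
    fix r assume r: "r \<in> R"
    then have "card (matching N s n r) \<le> n ^ card (free_vertices N B r)"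
      by (intro card_matching[OF s chain _ B]) (auto simp: R_def)
    also have "\<dots> \<le> n ^ m" using r False by (intro power_increasing) (auto simp: R_def)
    finally show "card (matching N s n r) \<le> n ^ m" .
  qed
  also have "\<dots> \<le> N ^ N * n ^ m" using R by simp
  finally show ?thesis .
qed

abbreviation cyc :: "nat \<Rightarrow> nat \<Rightarrow> nat" where "cyc k i \<equiv> Suc i mod k"

lemma cyc_chain: "v < k \<Longrightarrow> v \<notin> {0} \<Longrightarrow> v > 0 \<and> cyc k (v - 1) = v"
  by auto

lemma cyc_le: "cyc k i \<le> Suc i"
  by simp

text \<open>One factor \<open>n\<close> for the starting vertex and at most one for each distinct
  letter.\<close>

lemma card_circuits_few_letters:
  assumes k: "k > 0"
  shows "card {p \<in> circuits k n. card (letters (cyc k) p ` {..<k}) \<le> b} \<le> k ^ k * n ^ Suc b"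
proof (rule card_circuits_by_pattern[OF k cyc_le cyc_chain])
  fix p assume b: "card (letters (cyc k) p ` {..<k}) \<le> b"
  have "card {i. Suc i < k \<and> Suc i \<notin> {0} \<and> first_occ (letters (cyc k) p) i = i}
     \<le> card {i. i < k \<and> first_occ (letters (cyc k) p) i = i}"
    by (intro card_mono) auto
  also have "\<dots> \<le> b" using b by (simp only: card_first_occ_fixed)
  finally show "card {0::nat} + card {i. Suc i < k \<and> Suc i \<notin> {0} \<and> first_occ (letters (cyc k) p) i = i} \<le> Suc b"
    by simp
qed (use k in auto)

subsection \<open>Pairs of circuits with a common letter\<close>

text \<open>The positions below \<open>2*k\<close> are split into two cycles of length
  \<open>k\<close>, with starting vertices 0 and \<open>k\<close>.\<close>

definition cyc2 :: "nat \<Rightarrow> nat \<Rightarrow> nat" where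
  "cyc2 k i = (if i < k then cyc k i else k + cyc k (i - k))"

definition join :: "nat \<Rightarrow> (nat \<Rightarrow> nat) \<Rightarrow> (nat \<Rightarrow> nat) \<Rightarrow> nat \<Rightarrow> nat" where
  "join k p q = (\<lambda>i\<in>{..<2*k}. if i < k then p i else q (i - k))"

definition letters2 :: "nat \<Rightarrow> (nat \<Rightarrow> nat) \<Rightarrow> (nat \<Rightarrow> nat) \<Rightarrow> nat \<Rightarrow> 'i" where
  "letters2 k p q i = (if i < k then letters (cyc k) p i else letters (cyc k) q (i - k))"

lemma letters_join:
  assumes "k > 0" "i < 2 * k"
  shows "letters (cyc2 k) (join k p q) i = letters2 k p q i"
proof -
  have "cyc k j < k" "cyc k j < 2 * k" for j using assms by (auto intro: less_le_trans[of _ k])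
  then show ?thesis using assms
    by (auto simp: letters_def letters2_def cyc2_def join_def)
qed

definition all_matched :: "nat \<Rightarrow> (nat \<Rightarrow> 'i) \<Rightarrow> bool" where
  "all_matched N l \<longleftrightarrow> (\<forall>i<N. card {j\<in>{..<N}. l j = l i} \<ge> 2)"

text \<open>Two starting vertices and up to \<open>k\<close> letters would allow
  \<open>n ^ (k + 2)\<close>. The common letter saves one factor, and this is simplest to see when
  it sits on step \<open>k - 1\<close>, which closes the first circuit.\<close>

lemma card_linked_last:
  assumes k: "k > 0"
  shows "card {p \<in> circuits (2*k) n. all_matched (2*k) (letters (cyc2 k) p) \<and>
      (\<exists>j\<in>{k..<2*k}. letters (cyc2 k) p j = letters (cyc2 k) p (k - 1))} \<le> (2*k) ^ (2*k) * n ^ Suc k"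
proof (rule card_circuits_by_pattern[where B="{0,k}"])
  fix i assume "i < 2 * k"
  then show "cyc2 k i \<le> Suc i"
  proof (cases "i < k")
    case False
    then show ?thesis using mod_less_eq_dividend[of "Suc (i - k)" k] unfolding cyc2_def if_not_P[OF False] by linarith
  qed (simp add: cyc2_def)
next
  fix v assume v: "v < 2 * k" "v \<notin> {0,k}"
  then show "v > 0 \<and> cyc2 k (v - 1) = v"
    by (cases "v < k") (auto simp: cyc2_def Suc_diff_Suc)
next
  fix p assume "all_matched (2*k) (letters (cyc2 k) p) \<and>
      (\<exists>j\<in>{k..<2*k}. letters (cyc2 k) p j = letters (cyc2 k) p (k - 1))"
  then obtain j where m: "all_matched (2*k) (letters (cyc2 k) p)"
    and j: "k \<le> j" "j < 2*k" "letters (cyc2 k) p j = letters (cyc2 k) p (k - 1)" by auto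
  let ?l = "letters (cyc2 k) p"
  define F where "F = {i. i < 2*k \<and> first_occ ?l i = i}"
  have finF: "finite F" by (simp add: F_def)
  have cF: "card F = card (?l ` {..<2*k})" unfolding F_def by (rule card_first_occ_fixed)
  have m': "\<And>i. i \<in> {..<2*k} \<Longrightarrow> card {j\<in>{..<2*k}. ?l j = ?l i} \<ge> 2"
    using m by (auto simp: all_matched_def)
  have "{i. Suc i < 2 * k \<and> Suc i \<notin> {0, k} \<and> first_occ ?l i = i} \<subseteq> F - {k - 1}"
    using k by (auto simp: F_def)
  then have 1: "card {i. Suc i < 2 * k \<and> Suc i \<notin> {0, k} \<and> first_occ ?l i = i} \<le> card (F - {k - 1})"
    using finF by (intro card_mono) auto
  \<comment> \<open>If step \<open>k - 1\<close> is a first occurrence, its letter yields no free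
    vertex because the step leads back to a starting vertex. Otherwise its letter occurs at an
    earlier position, at \<open>k - 1\<close> and at \<open>j\<close>, so there are fewer than
    \<open>k\<close> letters.\<close>
  have 2: "card (F - {k - 1}) \<le> k - 1"
  proof (cases "k - 1 \<in> F")
    case True
    have "2 * card F \<le> 2 * k" using card_image_matched(1)[of "{..<2*k}" ?l] m' cF by simp
    then show ?thesis using True finF by simp
  next
    case False
    then have ne: "first_occ ?l (k - 1) \<noteq> k - 1" using k by (auto simp: F_def)
    with first_occ_le[of ?l "k - 1"] have lt: "first_occ ?l (k - 1) < k - 1" by simp
    have "card {i\<in>{..<2*k}. ?l i = ?l (k - 1)} > 2"
      by (rule card_ge_3I[of _ "first_occ ?l (k - 1)" "k - 1" j]) (use j lt k in auto)
    then have "2 * card F < 2 * k"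
      using card_image_matched(2)[of "{..<2*k}" ?l "k - 1"] m' cF k by simp
    then show ?thesis using finF card_Diff1_le[of F "k - 1"] by linarith
  qed
  have "card {0, k} = 2" using k by simp
  with 1 2 k show "card {0, k} + card {i. Suc i < 2 * k \<and> Suc i \<notin> {0, k} \<and> first_occ ?l i = i} \<le> Suc k"
    by linarith
qed (use k in auto)

definition rot :: "nat \<Rightarrow> nat \<Rightarrow> (nat \<Rightarrow> nat) \<Rightarrow> nat \<Rightarrow> nat" where
  "rot k c p = (\<lambda>v\<in>{..<k}. p ((v + c) mod k))"

lemma letters_rot:
  assumes "v < k"
  shows "letters (cyc k) (rot k c p) v = letters (cyc k) p ((v + c) mod k)"
  using assms by (auto simp: letters_def rot_def mod_simps)

definition linked :: "nat \<Rightarrow> nat \<Rightarrow> ((nat \<Rightarrow> nat) \<times> (nat \<Rightarrow> nat)) set" where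
  "linked k n = {(p,q). p \<in> circuits k n \<and> q \<in> circuits k n \<and> all_matched (2*k) (letters2 k p q) \<and>
      (\<exists>i<k. \<exists>j<k. letters (cyc k) p i = letters (cyc k) q j)}"

text \<open>Rotating the first circuit by \<open>Suc i\<close> moves its linking step
  \<open>i\<close> to position \<open>k - 1\<close>, the situation already counted. The choice of
  \<open>i\<close> gives the factor \<open>k\<close>.\<close>

lemma card_linked: "card (linked k n) \<le> k * ((2*k) ^ (2*k) * n ^ Suc k)"
proof (cases "k = 0")
  case True
  then show ?thesis by (simp add: linked_def)
next
  case False
  then have k: "k > 0" by simp
  define T where "T i = {(p,q). p \<in> circuits k n \<and> q \<in> circuits k n \<and> all_matched (2*k) (letters2 k p q) \<and>
      (\<exists>j<k. letters (cyc k) p i = letters (cyc k) q j)}" for i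
  define W where "W = {p \<in> circuits (2*k) n. all_matched (2*k) (letters (cyc2 k) p) \<and>
      (\<exists>j\<in>{k..<2*k}. letters (cyc2 k) p j = letters (cyc2 k) p (k - 1))}"
  have finT: "finite (T i)" for i
    by (rule finite_subset[of _ "circuits k n \<times> circuits k n"]) (auto simp: T_def)
  have cT: "card (T i) \<le> card W" if i: "i < k" for i
  proof (rule card_inj_on_le[where f="\<lambda>(p,q). join k (rot k (Suc i) p) q"])
    show "finite W" by (simp add: W_def)
    show "inj_on (\<lambda>(p,q). join k (rot k (Suc i) p) q) (T i)"
    proof (rule inj_onI, clarify)
      fix p q p' q' assume in1: "(p,q) \<in> T i" and in2: "(p',q') \<in> T i"
        and eq: "join k (rot k (Suc i) p) q = join k (rot k (Suc i) p') q'"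
      have "p x = p' x" if x: "x < k" for x
      proof -
        \<comment> \<open>The preimage of position \<open>x\<close> under the rotation
          \<open>v \<mapsto> (v + Suc i) mod k\<close>.\<close>
        define v where "v = (x + (k - Suc i)) mod k"
        have v: "v < k" using k by (simp add: v_def)
        have "(v + Suc i) mod k = (x + (k - Suc i) + Suc i) mod k" unfolding v_def by (simp only: mod_simps)
        also have "x + (k - Suc i) + Suc i = x + k" using i by simp
        finally have vx: "(v + Suc i) mod k = x" using x by simp
        have "rot k (Suc i) p v = rot k (Suc i) p' v" using fun_cong[OF eq, of v] v by (simp add: join_def)
        then show ?thesis using v vx by (simp add: rot_def)
      qed
      moreover have "q x = q' x" if "x < k" for x
        using fun_cong[OF eq, of "k + x"] that by (simp add: join_def)
      moreover have "p \<in> circuits k n" "p' \<in> circuits k n" "q \<in> circuits k n" "q' \<in> circuits k n"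
        using in1 in2 by (auto simp: T_def)
      ultimately show "p = p' \<and> q = q'" unfolding circuits_def by (metis PiE_ext lessThan_iff)
    qed
    show "(\<lambda>(p,q). join k (rot k (Suc i) p) q) ` T i \<subseteq> W"
    proof clarify
      fix p q assume pq: "(p,q) \<in> T i"
      then have c: "p \<in> circuits k n" "q \<in> circuits k n" by (auto simp: T_def)
      from pq obtain j where j: "j < k" "letters (cyc k) p i = letters (cyc k) q j" by (auto simp: T_def)
      let ?J = "join k (rot k (Suc i) p) q"
      \<comment> \<open>The permutation of the \<open>2*k\<close> positions induced by the rotation.
        It carries letter classes to letter classes of the same size, so being matched is
        preserved.\<close>
      define \<tau> where "\<tau> v = (if v < k then (v + Suc i) mod k else v)" for v
      have \<tau>: "\<tau> v < 2 * k" if "v < 2 * k" for v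
        using that k by (auto simp: \<tau>_def intro: less_trans[OF mod_less_divisor])
      have inj\<tau>: "\<exists>v<2*k. \<tau> v = x" if x: "x < 2 * k" for x
      proof (cases "x < k")
        case True
        define v where "v = (x + (k - Suc i)) mod k"
        have v: "v < k" using k by (simp add: v_def)
        have "(v + Suc i) mod k = (x + (k - Suc i) + Suc i) mod k" unfolding v_def by (simp only: mod_simps)
        also have "x + (k - Suc i) + Suc i = x + k" using i by simp
        finally have "(v + Suc i) mod k = x" using True by simp
        then show ?thesis using v by (intro exI[of _ v]) (auto simp: \<tau>_def)
      qed (use x in \<open>auto simp: \<tau>_def intro!: exI[of _ x]\<close>)
      then have "\<tau> ` {..<2*k} = {..<2*k}" using \<tau> by (fastforce simp: image_iff)
      then have bij: "bij_betw \<tau> {..<2*k} {..<2*k}"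
        by (metis bij_betw_def eq_card_imp_inj_on finite_lessThan)
      have l\<tau>: "letters (cyc2 k) ?J v = letters2 k p q (\<tau> v)" if "v < 2*k" for v
        unfolding letters_join[OF k that] using that k by (simp add: letters2_def \<tau>_def letters_rot)
      have "all_matched (2*k) (letters (cyc2 k) ?J)"
        unfolding all_matched_def
      proof (intro allI impI)
        fix v assume v: "v < 2*k"
        have "bij_betw \<tau> {u\<in>{..<2*k}. letters (cyc2 k) ?J u = letters (cyc2 k) ?J v}
          {u\<in>{..<2*k}. letters2 k p q u = letters2 k p q (\<tau> v)}"
          unfolding bij_betw_def
        proof
          show "inj_on \<tau> {u\<in>{..<2*k}. letters (cyc2 k) ?J u = letters (cyc2 k) ?J v}"
            using bij unfolding bij_betw_def by (rule inj_on_subset[OF conjunct1]) auto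
          show "\<tau> ` {u\<in>{..<2*k}. letters (cyc2 k) ?J u = letters (cyc2 k) ?J v} =
            {u\<in>{..<2*k}. letters2 k p q u = letters2 k p q (\<tau> v)}"
          proof (intro equalityI subsetI)
            fix x assume x: "x \<in> {u\<in>{..<2*k}. letters2 k p q u = letters2 k p q (\<tau> v)}"
            then obtain u where "u < 2*k" "\<tau> u = x" using inj\<tau>[of x] by auto
            then show "x \<in> \<tau> ` {u\<in>{..<2*k}. letters (cyc2 k) ?J u = letters (cyc2 k) ?J v}"
              using x v l\<tau> by (intro image_eqI[of _ _ u]) auto
          qed (use \<tau> v l\<tau> in auto)
        qed
        then have "card {u\<in>{..<2*k}. letters (cyc2 k) ?J u = letters (cyc2 k) ?J v} =
          card {u\<in>{..<2*k}. letters2 k p q u = letters2 k p q (\<tau> v)}" by (rule bij_betw_same_card)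
        then show "2 \<le> card {u\<in>{..<2*k}. letters (cyc2 k) ?J u = letters (cyc2 k) ?J v}"
          using pq \<tau>[OF v] by (auto simp: T_def all_matched_def)
      qed
      moreover have "letters (cyc2 k) ?J (k + j) = letters (cyc2 k) ?J (k - 1)"
        using j i k by (simp add: l\<tau> letters2_def \<tau>_def)
      moreover have "?J \<in> circuits (2*k) n"
        using c k by (auto simp: join_def rot_def circuits_def PiE_iff extensional_def)
      ultimately show "?J \<in> W" using j by (auto simp: W_def intro!: bexI[of _ "k + j"])
    qed
  qed
  have "linked k n \<subseteq> (\<Union>i<k. T i)" by (auto simp: linked_def T_def)
  then have "card (linked k n) \<le> card (\<Union>i<k. T i)" using finT by (intro card_mono) auto
  also have "\<dots> \<le> (\<Sum>i<k. card (T i))" by (rule card_UN_le) simp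
  also have "\<dots> \<le> (\<Sum>i<k. card W)" by (intro sum_mono) (use cT in auto)
  also have "\<dots> \<le> k * ((2*k) ^ (2*k) * n ^ Suc k)"
    using card_linked_last[OF k, of n] by (simp add: W_def)
  finally show ?thesis .
qed

end

section \<open>Pair-matched circuits and their patterns\<close>

context link
begin

definition pairing_circuits :: "nat \<Rightarrow> nat \<Rightarrow> (nat \<Rightarrow> nat) set" where
  "pairing_circuits k n =
     {p \<in> circuits k n. \<forall>i<k. card {j\<in>{..<k}. letters (cyc k) p j = letters (cyc k) p i} = 2}"

text \<open>Pairings of the \<open>k\<close> positions, each encoded by the map that sends a
  position to the first member of its pair; such a map is decreasing, idempotent and has fibres of
  size two.\<close>

definition pair_patterns :: "nat \<Rightarrow> (nat \<Rightarrow> nat) set" where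
  "pair_patterns k = {r \<in> PiE {..<k} (\<lambda>_. {..<k}).
     \<forall>i<k. r i \<le> i \<and> r (r i) = r i \<and> card {j\<in>{..<k}. r j = r i} = 2}"

lemma finite_pair_patterns: "finite (pair_patterns k)"
  by (rule finite_subset[of _ "PiE {..<k} (\<lambda>_. {..<k})"]) (auto simp: pair_patterns_def finite_PiE)

lemma pair_pattern_fixed:
  assumes r: "r \<in> pair_patterns k"
  shows "2 * card {i. i < k \<and> r i = i} = k"
proof -
  have "r ` {..<k} = {i. i < k \<and> r i = i}"
    using r by (force simp: pair_patterns_def PiE_iff image_iff)
  moreover have "(\<Sum>t\<in>r ` {..<k}. card {i\<in>{..<k}. r i = t}) = (\<Sum>t\<in>r ` {..<k}. 2)"
    using r by (intro sum.cong refl) (auto simp: pair_patterns_def)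
  ultimately show ?thesis using sum_card_fibres[of "{..<k}" r] by simp
qed

text \<open>A pair pattern is encoded by the set of its first occurrences and an arbitrary map on
  the remaining positions.\<close>

lemma card_pair_patterns: "card (pair_patterns (2*h)) \<le> 4 ^ h * (2*h) ^ h"
proof -
  define G where "G F = {r \<in> pair_patterns (2*h). {i. i < 2*h \<and> r i = i} = F}" for F
  let ?P = "Pow {..<2*h}"
  have "card (G F) \<le> (2*h) ^ h" if F: "F \<in> ?P" for F
  proof (cases "G F = {}")
    case False
    then obtain r0 where "r0 \<in> G F" by auto
    then have "2 * card F = 2 * h" using pair_pattern_fixed[of r0 "2*h"] by (auto simp: G_def)
    then have cF: "card ({..<2*h} - F) = h" using F by (subst card_Diff_subset) (auto dest: finite_subset)
    have "card (G F) \<le> card (PiE ({..<2*h} - F) (\<lambda>_. {..<2*h}))"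
    proof (rule card_inj_on_le[where f="\<lambda>r. restrict r ({..<2*h} - F)"])
      show "inj_on (\<lambda>r. restrict r ({..<2*h} - F)) (G F)"
      proof (rule inj_onI)
        fix r r' assume r: "r \<in> G F" "r' \<in> G F" and eq: "restrict r ({..<2*h} - F) = restrict r' ({..<2*h} - F)"
        have "r i = r' i" if "i < 2*h" for i
        proof (cases "i \<in> F")
          case True
          have "{i. i < 2*h \<and> r i = i} = F" "{i. i < 2*h \<and> r' i = i} = F"
            using r unfolding G_def by blast+
          with True show ?thesis by (metis (mono_tags, lifting) mem_Collect_eq)
        next
          case False
          then show ?thesis using fun_cong[OF eq, of i] that by simp
        qed
        moreover have "r \<in> PiE {..<2*h} (\<lambda>_. {..<2*h})" "r' \<in> PiE {..<2*h} (\<lambda>_. {..<2*h})"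
          using r by (auto simp: G_def pair_patterns_def)
        ultimately show "r = r'" by (metis PiE_ext lessThan_iff)
      qed
    qed (auto simp: G_def pair_patterns_def PiE_iff finite_PiE)
    also have "\<dots> = (2*h) ^ h" by (simp add: card_PiE cF)
    finally show ?thesis .
  qed simp
  then have "(\<Sum>F\<in>?P. card (G F)) \<le> (\<Sum>F\<in>?P. (2*h) ^ h)" by (intro sum_mono) auto
  also have "\<dots> = 4 ^ h * (2*h) ^ h" by (simp add: card_Pow power_mult)
  finally have "(\<Sum>F\<in>?P. card (G F)) \<le> 4 ^ h * (2*h) ^ h" .
  moreover have "pair_patterns (2*h) = (\<Union>F\<in>?P. G F)"
  proof (intro equalityI subsetI)
    fix r assume "r \<in> pair_patterns (2*h)"
    then have "r \<in> G {i. i < 2*h \<and> r i = i}" by (simp add: G_def)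
    moreover have "{i. i < 2*h \<and> r i = i} \<in> ?P" by auto
    ultimately show "r \<in> (\<Union>F\<in>?P. G F)" by (rule UN_I[rotated])
  next
    fix r assume "r \<in> (\<Union>F\<in>?P. G F)"
    then obtain F where "r \<in> G F" by (rule UN_E)
    then show "r \<in> pair_patterns (2*h)" by (simp add: G_def)
  qed
  moreover have "card (\<Union>F\<in>?P. G F) \<le> (\<Sum>F\<in>?P. card (G F))" by (rule card_UN_le) simp
  ultimately show ?thesis by simp
qed

definition exact :: "nat \<Rightarrow> nat \<Rightarrow> (nat \<Rightarrow> nat) \<Rightarrow> (nat \<Rightarrow> nat) set" where
  "exact k n r = {p \<in> circuits k n. restrict (first_occ (letters (cyc k) p)) {..<k} = r}"

lemma exact_pairing:
  assumes "p \<in> pairing_circuits k n"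
  shows "restrict (first_occ (letters (cyc k) p)) {..<k} \<in> pair_patterns k"
proof -
  let ?l = "letters (cyc k) p"
  have eq: "first_occ ?l j = first_occ ?l i \<longleftrightarrow> ?l j = ?l i" for i j
    by (metis first_occ_cong first_occ_letter)
  have lt: "first_occ ?l i < k" if "i < k" for i using first_occ_le[of ?l i] that by simp
  have "{j. j < k \<and> restrict (first_occ ?l) {..<k} j = first_occ ?l i} = {j. j < k \<and> ?l j = ?l i}" for i
    by (auto simp: eq)
  then show ?thesis using assms lt
    by (auto simp: pair_patterns_def pairing_circuits_def first_occ_le eq)
qed

lemma pairing_exact:
  assumes "r \<in> pair_patterns k" "p \<in> exact k n r"
  shows "p \<in> pairing_circuits k n"
proof -
  let ?l = "letters (cyc k) p"
  have r: "r j = first_occ ?l j" if "j < k" for j using assms that by (auto simp: exact_def)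
  have eq: "first_occ ?l j = first_occ ?l i \<longleftrightarrow> ?l j = ?l i" for i j
    by (metis first_occ_cong first_occ_letter)
  have "{j\<in>{..<k}. ?l j = ?l i} = {j\<in>{..<k}. r j = r i}" if "i < k" for i
    using that by (auto simp: r eq)
  then show ?thesis using assms by (auto simp: pairing_circuits_def exact_def pair_patterns_def)
qed

text \<open>Every letter class contains a pair of \<open>r\<close>; if the pattern is not exactly
  \<open>r\<close>, two pairs have merged, and a class of more than two positions leaves fewer than
  \<open>k / 2\<close> letters.\<close>

lemma matching_not_exact:
  assumes r: "r \<in> pair_patterns k" and p: "p \<in> matching k (cyc k) n r" "p \<notin> exact k n r" and k: "k > 0"
  shows "2 * card (letters (cyc k) p ` {..<k}) < k"
proof -
  let ?l = "letters (cyc k) p"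
  have l: "?l (r i) = ?l i" if "i < k" for i using p that by (auto simp: matching_def)
  have sub: "{j\<in>{..<k}. r j = r i} \<subseteq> {j\<in>{..<k}. ?l j = ?l i}" if "i < k" for i
    using that by auto (metis l)
  have 2: "card {j\<in>{..<k}. r j = r i} = 2" if "i < k" for i using r that by (auto simp: pair_patterns_def)
  have ge: "card {j\<in>{..<k}. ?l j = ?l i} \<ge> 2" if "i < k" for i
    using card_mono[OF _ sub[OF that]] 2[OF that] by simp
  \<comment> \<open>If all letter classes had two elements they would coincide with the pairs of
    \<open>r\<close>, and their first members would give back \<open>r\<close> itself.\<close>
  have "\<exists>i<k. card {j\<in>{..<k}. ?l j = ?l i} > 2"
  proof (rule ccontr)
    assume no: "\<not> ?thesis"
    have eq: "{j\<in>{..<k}. r j = r i} = {j\<in>{..<k}. ?l j = ?l i}" if "i < k" for i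
    proof (rule card_subset_eq[OF _ sub[OF that]])
      have "card {j\<in>{..<k}. ?l j = ?l i} \<le> 2" using no that leI by blast
      then show "card {j\<in>{..<k}. r j = r i} = card {j\<in>{..<k}. ?l j = ?l i}"
        using ge[OF that] 2[OF that] by simp
    qed simp
    have "first_occ ?l i = r i" if i: "i < k" for i
    proof (rule antisym)
      show "first_occ ?l i \<le> r i" by (rule first_occ_least) (rule l[OF i])
      have f: "first_occ ?l i < k" using first_occ_le[of ?l i] i by simp
      then have "first_occ ?l i \<in> {j\<in>{..<k}. ?l j = ?l i}" by simp
      then have "r (first_occ ?l i) = r i" unfolding eq[OF i, symmetric] by simp
      moreover have "r (first_occ ?l i) \<le> first_occ ?l i" using r f by (auto simp: pair_patterns_def)
      ultimately show "r i \<le> first_occ ?l i" by simp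
    qed
    then have "restrict (first_occ ?l) {..<k} = r"
    proof (intro extensionalityI[of _ "{..<k}"])
      show "r \<in> extensional {..<k}" using r by (simp add: pair_patterns_def PiE_def)
    qed auto
    then show False using p by (auto simp: exact_def matching_def)
  qed
  then obtain i where "i < k" "card {j\<in>{..<k}. ?l j = ?l i} > 2" by auto
  then show ?thesis using card_image_matched(2)[of "{..<k}" ?l i] ge by simp
qed

lemma exact_sub_matching: "exact k n r \<subseteq> matching k (cyc k) n r"
  by (auto simp: exact_def matching_def)

lemma card_pairing_circuits:
  "card (pairing_circuits k n) = (\<Sum>r\<in>pair_patterns k. card (exact k n r))"
proof -
  have "pairing_circuits k n = (\<Union>r\<in>pair_patterns k. exact k n r)"
    using exact_pairing pairing_exact by (auto simp: exact_def pairing_circuits_def)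
  moreover have "card (\<Union>r\<in>pair_patterns k. exact k n r) = (\<Sum>r\<in>pair_patterns k. card (exact k n r))"
    by (rule card_UN_disjoint) (auto simp: finite_pair_patterns exact_def)
  ultimately show ?thesis by simp
qed

text \<open>\<open>(k - 1) div 2\<close> is the largest number of letters below
  \<open>k / 2\<close>. For \<open>k = 2*h\<close> the error has order \<open>n ^ h\<close>, one
  power below the order of the main term, so the limits of the simpler \<open>matching\<close>
  counts suffice.\<close>

lemma card_matching_exact:
  assumes r: "r \<in> pair_patterns k" and k: "k > 0"
  shows "card (exact k n r) \<le> card (matching k (cyc k) n r)"
    and "card (matching k (cyc k) n r) \<le> card (exact k n r) + k ^ k * n ^ Suc ((k - 1) div 2)"
proof -
  show "card (exact k n r) \<le> card (matching k (cyc k) n r)"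
    by (intro card_mono exact_sub_matching finite_matching)
  have "matching k (cyc k) n r - exact k n r \<subseteq>
      {p \<in> circuits k n. card (letters (cyc k) p ` {..<k}) \<le> (k - 1) div 2}"
  proof
    fix p assume p: "p \<in> matching k (cyc k) n r - exact k n r"
    then have "2 * card (letters (cyc k) p ` {..<k}) < k" by (intro matching_not_exact[OF r _ _ k]) auto
    then have "card (letters (cyc k) p ` {..<k}) \<le> (k - 1) div 2" by linarith
    then show "p \<in> {p \<in> circuits k n. card (letters (cyc k) p ` {..<k}) \<le> (k - 1) div 2}"
      using p by (auto simp: matching_def)
  qed
  then have "card (matching k (cyc k) n r - exact k n r) \<le> k ^ k * n ^ Suc ((k - 1) div 2)"
    by (intro order_trans[OF card_mono card_circuits_few_letters[OF k]]) auto
  moreover have "card (matching k (cyc k) n r) \<le> card (exact k n r) + card (matching k (cyc k) n r - exact k n r)"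
    using card_Diff_subset[OF _ exact_sub_matching, of k n r] finite_subset[OF exact_sub_matching finite_matching] by simp
  ultimately show "card (matching k (cyc k) n r) \<le> card (exact k n r) + k ^ k * n ^ Suc ((k - 1) div 2)"
    by simp
qed

text \<open>At most \<open>4 ^ h * (2*h) ^ h\<close> patterns, each with at most
  \<open>Suc h\<close> free vertices. The factor in front of \<open>n ^ Suc h\<close> will bound the
  limit moments.\<close>

lemma card_pairing_circuits_le:
  assumes h: "h > 0"
  shows "card (pairing_circuits (2*h) n) \<le> 4 ^ h * (2*h) ^ h * n ^ Suc h"
proof (cases "n = 0")
  case True
  then have "circuits (2*h) n = {}" using h by (auto simp: circuits_def PiE_eq_empty_iff intro!: exI[of _ 0])
  then show ?thesis by (simp add: pairing_circuits_def)
next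
  case False
  have "card (exact (2*h) n r) \<le> n ^ Suc h" if r: "r \<in> pair_patterns (2*h)" for r
  proof -
    let ?F = "free_vertices (2*h) {0} r"
    have "card ?F \<le> card {0::nat} + card {i. Suc i < 2*h \<and> Suc i \<notin> {0} \<and> r i = i}"
      by (rule card_free_vertices) (use h in auto)
    also have "card {i. Suc i < 2*h \<and> Suc i \<notin> {0} \<and> r i = i} \<le> card {i. i < 2*h \<and> r i = i}"
      by (intro card_mono) auto
    also have "\<dots> = h" using pair_pattern_fixed[OF r] by simp
    finally have F: "card ?F \<le> Suc h" by simp
    have "card (exact (2*h) n r) \<le> card (matching (2*h) (cyc (2*h)) n r)"
      by (intro card_mono exact_sub_matching finite_matching)
    also have "\<dots> \<le> n ^ card ?F"
      by (rule card_matching[OF cyc_le cyc_chain]) (use r h in \<open>auto simp: pair_patterns_def\<close>)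
    also have "\<dots> \<le> n ^ Suc h" using F False by (intro power_increasing) auto
    finally show ?thesis .
  qed
  then have "card (pairing_circuits (2*h) n) \<le> (\<Sum>r\<in>pair_patterns (2*h). n ^ Suc h)"
    unfolding card_pairing_circuits by (rule sum_mono)
  also have "\<dots> \<le> 4 ^ h * (2*h) ^ h * n ^ Suc h" using card_pair_patterns[of h] by simp
  finally show ?thesis .
qed

lemma pairing_circuits_odd: "odd k \<Longrightarrow> pairing_circuits k n = {}"
proof (rule ccontr)
  assume "odd k" "pairing_circuits k n \<noteq> {}"
  then obtain p where "p \<in> pairing_circuits k n" by auto
  then have "2 * card {i. i < k \<and> restrict (first_occ (letters (cyc k) p)) {..<k} i = i} = k"
    by (intro pair_pattern_fixed exact_pairing)
  with \<open>odd k\<close> show False by (metis dvd_triv_left)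
qed

end

subsection \<open>Trace moments of arrays with independent bounded entries\<close>

locale bounded_array = link L + prob_space M
  for L :: "nat \<Rightarrow> nat \<Rightarrow> 'i" and M :: "'a measure" +
  fixes I :: "'i set" and a :: "'i \<Rightarrow> 'a \<Rightarrow> real" and C :: real
  assumes L_in: "L i j \<in> I"
    and indep: "indep_vars (\<lambda>_. borel) a I"
    and bound: "t \<in> I \<Longrightarrow> \<bar>a t \<omega>\<bar> \<le> C" and C1: "C \<ge> 1"
    and mean0: "t \<in> I \<Longrightarrow> expectation (a t) = 0"
    and var1: "t \<in> I \<Longrightarrow> expectation (\<lambda>\<omega>. (a t \<omega>)\<^sup>2) = 1"
begin

lemma a_measurable: "t \<in> I \<Longrightarrow> a t \<in> borel_measurable M"
  using indep by (auto simp: indep_vars_def)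

definition word :: "nat \<Rightarrow> (nat \<Rightarrow> 'i) \<Rightarrow> 'a \<Rightarrow> real" where
  "word N l \<omega> = (\<Prod>i<N. a (l i) \<omega>)"

lemma word_bound:
  assumes "\<And>i. l i \<in> I"
  shows "\<bar>word N l \<omega>\<bar> \<le> C ^ N"
proof -
  have "\<bar>word N l \<omega>\<bar> = (\<Prod>i<N. \<bar>a (l i) \<omega>\<bar>)" by (simp add: word_def abs_prod)
  also have "\<dots> \<le> (\<Prod>i<N. C)" using bound assms by (intro prod_mono) auto
  finally show ?thesis by simp
qed

lemma word_measurable [measurable]:
  assumes "\<And>i. l i \<in> I"
  shows "word N l \<in> borel_measurable M"
  unfolding word_def using a_measurable[OF assms] by measurable

lemma word_integrable:
  assumes "\<And>i. l i \<in> I"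
  shows "integrable M (word N l)"
  using word_bound[OF assms] word_measurable[OF assms]
  by (intro integrable_const_bound[of _ "C ^ N"]) auto

lemma expectation_word_bound:
  assumes "\<And>i. l i \<in> I"
  shows "\<bar>expectation (word N l)\<bar> \<le> C ^ N"
proof -
  have "\<bar>expectation (word N l)\<bar> \<le> expectation (\<lambda>\<omega>. \<bar>word N l \<omega>\<bar>)"
    using integral_norm_bound[of M "word N l"] by simp
  also have "\<dots> \<le> expectation (\<lambda>\<omega>. C ^ N)"
    using word_bound[OF assms] word_integrable[OF assms] by (intro integral_mono integrable_abs) auto
  finally show ?thesis by (simp add: prob_space)
qed

definition mom :: "nat \<Rightarrow> (nat \<Rightarrow> 'i) \<Rightarrow> 'i \<Rightarrow> real" where
  "mom N l t = expectation (\<lambda>\<omega>. a t \<omega> ^ card {i\<in>{..<N}. l i = t})"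

text \<open>Equal letters are collected into powers of one variable; powers belonging to distinct
  letters are independent.\<close>

lemma expectation_word:
  assumes l: "\<And>i. l i \<in> I"
  shows "expectation (word N l) = (\<Prod>t\<in>l ` {..<N}. mom N l t)"
proof -
  let ?m = "\<lambda>t. card {i\<in>{..<N}. l i = t}"
  have "word N l \<omega> = (\<Prod>t\<in>l ` {..<N}. a t \<omega> ^ ?m t)" for \<omega>
  proof -
    have "word N l \<omega> = (\<Prod>t\<in>l ` {..<N}. \<Prod>i\<in>{i\<in>{..<N}. l i = t}. a (l i) \<omega>)"
      unfolding word_def by (rule prod.image_gen) simp
    also have "\<dots> = (\<Prod>t\<in>l ` {..<N}. \<Prod>i\<in>{i\<in>{..<N}. l i = t}. a t \<omega>)"
      by (intro prod.cong refl) auto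
    finally show ?thesis by simp
  qed
  then have "expectation (word N l) = expectation (\<lambda>\<omega>. \<Prod>t\<in>l ` {..<N}. a t \<omega> ^ ?m t)"
    by (intro Bochner_Integration.integral_cong refl) auto
  also have "\<dots> = (\<Prod>t\<in>l ` {..<N}. expectation (\<lambda>\<omega>. a t \<omega> ^ ?m t))"
  proof (rule indep_vars_lebesgue_integral)
    have "indep_vars (\<lambda>_. borel) a (l ` {..<N})" using l by (intro indep_vars_subset[OF indep]) auto
    then show "indep_vars (\<lambda>_. borel) (\<lambda>t \<omega>. a t \<omega> ^ ?m t) (l ` {..<N})"
      by (rule indep_vars_compose2) measurable
    fix t assume "t \<in> l ` {..<N}"
    then have t: "t \<in> I" using l by auto
    show "integrable M (\<lambda>\<omega>. a t \<omega> ^ ?m t)"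
    proof (rule integrable_const_bound[of _ "C ^ ?m t"])
      show "AE \<omega> in M. norm (a t \<omega> ^ ?m t) \<le> C ^ ?m t"
        using bound[OF t] by (auto simp: power_abs intro!: power_mono)
      show "(\<lambda>\<omega>. a t \<omega> ^ ?m t) \<in> borel_measurable M" using a_measurable[OF t] by measurable
    qed
  qed simp
  finally show ?thesis by (simp add: mom_def)
qed

lemma expectation_word_single:
  assumes l: "\<And>i. l i \<in> I" and i: "i < N" "card {j\<in>{..<N}. l j = l i} < 2"
  shows "expectation (word N l) = 0"
proof -
  have "card {j\<in>{..<N}. l j = l i} > 0" using i(1) by (subst card_gt_0_iff) auto
  then have "card {j\<in>{..<N}. l j = l i} = 1" using i(2) by simp
  then have "mom N l (l i) = 0" using mean0[OF l[of i]] by (simp add: mom_def)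
  then show ?thesis unfolding expectation_word[OF l] using i(1) by (intro prod_zero) auto
qed

lemma expectation_word_pairs:
  assumes l: "\<And>i. l i \<in> I" and p: "\<And>i. i < N \<Longrightarrow> card {j\<in>{..<N}. l j = l i} = 2"
  shows "expectation (word N l) = 1"
  unfolding expectation_word[OF l]
proof (rule prod.neutral, clarify)
  fix i assume "i < N"
  then show "mom N l (l i) = 1" using p var1[OF l] by (simp add: mom_def)
qed

lemma letters_in: "letters s p i \<in> I"
  by (simp add: letters_def L_in)

definition trace_sum :: "nat \<Rightarrow> nat \<Rightarrow> 'a \<Rightarrow> real" where
  "trace_sum k n \<omega> = (\<Sum>p\<in>circuits k n. word k (letters (cyc k) p) \<omega>)"

lemma trace_sum_measurable [measurable]: "trace_sum k n \<in> borel_measurable M"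
  unfolding trace_sum_def using word_measurable[OF letters_in] by measurable

lemma trace_sum_bounded: "\<exists>K. \<forall>\<omega>. \<bar>trace_sum k n \<omega>\<bar> \<le> K"
proof (intro exI allI)
  fix \<omega>
  have "\<bar>trace_sum k n \<omega>\<bar> \<le> (\<Sum>p\<in>circuits k n. \<bar>word k (letters (cyc k) p) \<omega>\<bar>)"
    unfolding trace_sum_def by (rule sum_abs)
  also have "\<dots> \<le> (\<Sum>p\<in>circuits k n. C ^ k)" by (intro sum_mono word_bound letters_in)
  finally show "\<bar>trace_sum k n \<omega>\<bar> \<le> (\<Sum>p\<in>circuits k n. C ^ k)" .
qed

text \<open>A letter occurring once makes the expectation 0. If no letter is single and there are at
  least \<open>k / 2\<close> letters, each occurs exactly twice and the expectation is 1. The other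
  circuits have at most \<open>(k - 1) div 2\<close> letters, hence are few, and contribute at most
  \<open>C ^ k\<close> each.\<close>

lemma expectation_trace_sum:
  assumes k: "k > 0"
  shows "\<bar>expectation (trace_sum k n) - card (pairing_circuits k n)\<bar>
     \<le> C ^ k * k ^ k * n ^ Suc ((k - 1) div 2)"
proof -
  let ?E = "\<lambda>p. expectation (word k (letters (cyc k) p))"
  let ?F = "{p \<in> circuits k n. card (letters (cyc k) p ` {..<k}) \<le> (k - 1) div 2}"
  have E: "expectation (trace_sum k n) = (\<Sum>p\<in>circuits k n. ?E p)"
    unfolding trace_sum_def by (intro Bochner_Integration.integral_sum word_integrable letters_in)
  have "(\<Sum>p\<in>circuits k n. ?E p) - card (pairing_circuits k n)
     = (\<Sum>p\<in>circuits k n. ?E p - of_bool (p \<in> pairing_circuits k n))"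
  proof -
    have "circuits k n \<inter> pairing_circuits k n = pairing_circuits k n" by (auto simp: pairing_circuits_def)
    then show ?thesis by (simp add: sum_subtractf of_bool_def sum.If_cases Int_def)
  qed
  also have "\<dots> = (\<Sum>p\<in>?F. ?E p - of_bool (p \<in> pairing_circuits k n))"
  proof (rule sum.mono_neutral_right)
    show "\<forall>p\<in>circuits k n - ?F. ?E p - of_bool (p \<in> pairing_circuits k n) = 0"
    proof
      fix p assume p: "p \<in> circuits k n - ?F"
      let ?l = "letters (cyc k) p"
      show "?E p - of_bool (p \<in> pairing_circuits k n) = 0"
      proof (cases "\<exists>i<k. card {j\<in>{..<k}. ?l j = ?l i} < 2")
        case True
        then obtain i where i: "i < k" "card {j\<in>{..<k}. ?l j = ?l i} < 2" by auto
        then have "p \<notin> pairing_circuits k n" by (force simp: pairing_circuits_def)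
        then show ?thesis using expectation_word_single[OF letters_in i] by simp
      next
        case False
        then have ge: "card {j\<in>{..<k}. ?l j = ?l i} \<ge> 2" if "i < k" for i using that leI by blast
        have "\<not> 2 * card (?l ` {..<k}) < k" using p by auto
        \<comment> \<open>A class larger than two would push the number of letters below
          \<open>k / 2\<close>.\<close>
        then have "card {j\<in>{..<k}. ?l j = ?l i} = 2" if "i < k" for i
          using card_image_matched(2)[of "{..<k}" ?l i] ge that by (force simp: not_less le_antisym)
        then have pairs: "\<And>i. i < k \<Longrightarrow> card {j\<in>{..<k}. ?l j = ?l i} = 2" .
        have "?E p = 1" by (rule expectation_word_pairs[OF letters_in pairs])
        moreover have "p \<in> pairing_circuits k n" using p pairs by (auto simp: pairing_circuits_def)
        ultimately show ?thesis by simp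
      qed
    qed
  qed auto
  finally have eq: "(\<Sum>p\<in>circuits k n. ?E p) - card (pairing_circuits k n)
      = (\<Sum>p\<in>?F. ?E p - of_bool (p \<in> pairing_circuits k n))" .
  have "p \<notin> pairing_circuits k n" if "p \<in> ?F" for p
  proof
    assume pp: "p \<in> pairing_circuits k n"
    let ?l = "letters (cyc k) p"
    have "(\<Sum>t\<in>?l ` {..<k}. card {i\<in>{..<k}. ?l i = t}) = (\<Sum>t\<in>?l ` {..<k}. 2)"
      using pp by (intro sum.cong refl) (auto simp: pairing_circuits_def)
    then have "2 * card (?l ` {..<k}) = k" using sum_card_fibres[of "{..<k}" ?l] by simp
    moreover have "2 * ((k - 1) div 2) \<le> k - 1" by simp
    ultimately show False using that k by auto
  qed
  then have "\<bar>\<Sum>p\<in>?F. ?E p - of_bool (p \<in> pairing_circuits k n)\<bar> \<le> (\<Sum>p\<in>?F. C ^ k)"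
    by (intro order_trans[OF sum_abs] sum_mono) (use expectation_word_bound[OF letters_in] in auto)
  also have "\<dots> = C ^ k * card ?F" by simp
  also have "\<dots> \<le> C ^ k * (k ^ k * n ^ Suc ((k - 1) div 2))"
    using card_circuits_few_letters[OF k, of n "(k - 1) div 2"] C1
    by (intro mult_left_mono) (auto simp flip: of_nat_power of_nat_mult)
  finally show ?thesis by (simp add: E eq mult.assoc)
qed

text \<open>Being unlinked has two causes. Either some letter occurs only once in the two circuits
  together, and both sides are 0; or all letters are matched but none is shared, and the product
  over letters splits into the two circuits.\<close>

lemma covariance_word_unlinked:
  assumes pq: "p \<in> circuits k n" "q \<in> circuits k n" "(p,q) \<notin> linked k n"
  shows "expectation (\<lambda>\<omega>. word k (letters (cyc k) p) \<omega> * word k (letters (cyc k) q) \<omega>)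
    = expectation (word k (letters (cyc k) p)) * expectation (word k (letters (cyc k) q))"
proof -
  let ?lp = "letters (cyc k) p" and ?lq = "letters (cyc k) q" and ?l = "letters2 k p q"
  have l: "?l i \<in> I" for i by (simp add: letters2_def letters_in)
  have prod: "word k ?lp \<omega> * word k ?lq \<omega> = word (2*k) ?l \<omega>" for \<omega>
  proof -
    have "word (2*k) ?l \<omega> = (\<Prod>i<k. a (?l i) \<omega>) * (\<Prod>i\<in>{k..<k+k}. a (?l i) \<omega>)"
      unfolding word_def mult_2 by (metis lessThan_atLeast0 le_add1 prod.atLeastLessThan_concat zero_le)
    also have "(\<Prod>i\<in>{k..<k+k}. a (?l i) \<omega>) = (\<Prod>i\<in>{0..<k}. a (?l (i + k)) \<omega>)"
      using prod.shift_bounds_nat_ivl[of "\<lambda>i. a (?l i) \<omega>" 0 k k] by simp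
    also have "\<dots> = word k ?lq \<omega>" unfolding word_def lessThan_atLeast0 by (simp add: letters2_def)
    also have "(\<Prod>i<k. a (?l i) \<omega>) = word k ?lp \<omega>" unfolding word_def by (simp add: letters2_def)
    finally show ?thesis by simp
  qed
  have split: "card {j\<in>{..<2*k}. ?l j = t} = card {j\<in>{..<k}. ?lp j = t} + card {j\<in>{..<k}. ?lq j = t}" for t
  proof -
    have "{j\<in>{..<2*k}. ?l j = t} = {j\<in>{..<k}. ?lp j = t} \<union> (\<lambda>j. j + k) ` {j\<in>{..<k}. ?lq j = t}"
    proof (intro equalityI subsetI)
      fix j assume j: "j \<in> {j\<in>{..<2*k}. ?l j = t}"
      show "j \<in> {j\<in>{..<k}. ?lp j = t} \<union> (\<lambda>j. j + k) ` {j\<in>{..<k}. ?lq j = t}"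
        using j by (cases "j < k") (auto simp: letters2_def intro!: image_eqI[of _ _ "j - k"])
    qed (auto simp: letters2_def)
    moreover have "card ((\<lambda>j. j + k) ` {j\<in>{..<k}. ?lq j = t}) = card {j\<in>{..<k}. ?lq j = t}"
      by (rule card_image) simp
    moreover have "card ({j\<in>{..<k}. ?lp j = t} \<union> (\<lambda>j. j + k) ` {j\<in>{..<k}. ?lq j = t})
       = card {j\<in>{..<k}. ?lp j = t} + card ((\<lambda>j. j + k) ` {j\<in>{..<k}. ?lq j = t})"
      by (rule card_Un_disjoint) auto
    ultimately show ?thesis by simp
  qed
  show ?thesis
  proof (cases "all_matched (2*k) ?l")
    case False
    then obtain i where i: "i < 2*k" "card {j\<in>{..<2*k}. ?l j = ?l i} < 2" by (auto simp: all_matched_def not_le)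
    have "expectation (word k ?lp) * expectation (word k ?lq) = 0"
    proof (cases "i < k")
      case True
      then have "card {j\<in>{..<k}. ?lp j = ?lp i} < 2" using i split[of "?l i"] by (simp add: letters2_def)
      then show ?thesis using expectation_word_single[OF letters_in True] by simp
    next
      case False
      then have "card {j\<in>{..<k}. ?lq j = ?lq (i - k)} < 2" "i - k < k" using i split[of "?l i"] by (auto simp: letters2_def)
      then have "expectation (word k ?lq) = 0" by (intro expectation_word_single[OF letters_in])
      then show ?thesis by simp
    qed
    then show ?thesis unfolding prod using expectation_word_single[OF l i] by simp
  next
    case True
    then have ne: "?lp i \<noteq> ?lq j" if "i < k" "j < k" for i j using pq that by (auto simp: linked_def)
    have img: "?l ` {..<2*k} = ?lp ` {..<k} \<union> ?lq ` {..<k}"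
    proof (intro equalityI subsetI)
      fix t assume "t \<in> ?l ` {..<2*k}"
      then obtain j where j: "j < 2*k" "t = ?l j" by auto
      then show "t \<in> ?lp ` {..<k} \<union> ?lq ` {..<k}"
        by (cases "j < k") (auto simp: letters2_def)
    next
      fix t assume "t \<in> ?lp ` {..<k} \<union> ?lq ` {..<k}"
      then obtain j where "j < k" "t = ?lp j \<or> t = ?lq j" by auto
      then have "t = ?l j \<or> t = ?l (j + k)" "j < 2*k" "j + k < 2*k" by (auto simp: letters2_def)
      then show "t \<in> ?l ` {..<2*k}" by auto
    qed
    have mp: "mom (2*k) ?l t = mom k ?lp t" if "t \<in> ?lp ` {..<k}" for t
    proof -
      have "{j\<in>{..<k}. ?lq j = t} = {}" using that ne by force
      then have z: "card {j\<in>{..<k}. ?lq j = t} = 0" by (simp only: card.empty)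
      show ?thesis unfolding mom_def split z by simp
    qed
    have mq: "mom (2*k) ?l t = mom k ?lq t" if "t \<in> ?lq ` {..<k}" for t
    proof -
      have "{j\<in>{..<k}. ?lp j = t} = {}" using that ne by force
      then have z: "card {j\<in>{..<k}. ?lp j = t} = 0" by (simp only: card.empty)
      show ?thesis unfolding mom_def split z by simp
    qed
    have "expectation (word (2*k) ?l) = (\<Prod>t\<in>?lp ` {..<k}. mom (2*k) ?l t) * (\<Prod>t\<in>?lq ` {..<k}. mom (2*k) ?l t)"
      unfolding expectation_word[OF l] img by (rule prod.union_disjoint) (use ne in auto)
    also have "\<dots> = (\<Prod>t\<in>?lp ` {..<k}. mom k ?lp t) * (\<Prod>t\<in>?lq ` {..<k}. mom k ?lq t)"
      by (intro arg_cong2[where f="(*)"] prod.cong refl mp mq)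
    finally show ?thesis unfolding prod expectation_word[OF letters_in] by simp
  qed
qed

text \<open>Only linked pairs have nonzero covariance, and each covariance is at most
  \<open>2 * C ^ (2*k)\<close>. Their number has order \<open>n ^ (k + 1)\<close>, against
  \<open>n ^ (k + 2)\<close> for the square of the normalization, so the normalized variance is
  O(\<open>1 / n\<close>).\<close>

lemma variance_trace_sum:
  "expectation (\<lambda>\<omega>. (trace_sum k n \<omega> - expectation (trace_sum k n))\<^sup>2)
     \<le> 2 * C ^ (2*k) * (k * ((2*k) ^ (2*k) * n ^ Suc k))"
proof -
  let ?w = "\<lambda>p. word k (letters (cyc k) p)"
  let ?S = "circuits k n"
  define cov where "cov p q = expectation (\<lambda>\<omega>. ?w p \<omega> * ?w q \<omega>) - expectation (?w p) * expectation (?w q)" for p q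
  have b: "\<bar>?w p \<omega> * ?w q \<omega>\<bar> \<le> C ^ (2*k)" for p q \<omega>
    unfolding mult_2 power_add abs_mult using C1
    by (intro mult_mono word_bound letters_in) auto
  have m: "?w p \<in> borel_measurable M" for p by (intro word_measurable letters_in)
  have int2: "integrable M (\<lambda>\<omega>. ?w p \<omega> * ?w q \<omega>)" for p q
    using b m by (intro integrable_const_bound[of _ "C ^ (2*k)"] borel_measurable_times) auto
  have E: "expectation (trace_sum k n) = (\<Sum>p\<in>?S. expectation (?w p))"
    unfolding trace_sum_def by (intro Bochner_Integration.integral_sum word_integrable letters_in)
  have int: "integrable M (trace_sum k n)"
    unfolding trace_sum_def by (intro Bochner_Integration.integrable_sum word_integrable letters_in)
  have sq: "(trace_sum k n \<omega>)\<^sup>2 = (\<Sum>p\<in>?S. \<Sum>q\<in>?S. ?w p \<omega> * ?w q \<omega>)" for \<omega>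
    by (simp add: trace_sum_def power2_eq_square sum_product)
  have intsq: "integrable M (\<lambda>\<omega>. (trace_sum k n \<omega>)\<^sup>2)"
    unfolding sq by (intro Bochner_Integration.integrable_sum int2)
  have "expectation (\<lambda>\<omega>. (trace_sum k n \<omega> - expectation (trace_sum k n))\<^sup>2)
      = expectation (\<lambda>\<omega>. (trace_sum k n \<omega>)\<^sup>2) - (expectation (trace_sum k n))\<^sup>2"
    by (rule variance_eq[OF int intsq])
  also have "\<dots> = (\<Sum>p\<in>?S. \<Sum>q\<in>?S. cov p q)"
  proof -
    have "expectation (\<lambda>\<omega>. (trace_sum k n \<omega>)\<^sup>2) = (\<Sum>p\<in>?S. \<Sum>q\<in>?S. expectation (\<lambda>\<omega>. ?w p \<omega> * ?w q \<omega>))"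
      unfolding sq by (simp add: Bochner_Integration.integral_sum int2 Bochner_Integration.integrable_sum)
    then show ?thesis by (simp add: E cov_def power2_eq_square sum_product sum_subtractf)
  qed
  also have "\<dots> = (\<Sum>(p,q)\<in>?S \<times> ?S. cov p q)" by (simp add: sum.cartesian_product)
  also have "\<dots> = (\<Sum>(p,q)\<in>linked k n. cov p q)"
  proof (rule sum.mono_neutral_right)
    show "\<forall>x\<in>?S \<times> ?S - linked k n. (case x of (p,q) \<Rightarrow> cov p q) = 0"
      using covariance_word_unlinked by (auto simp: cov_def)
  qed (auto simp: linked_def)
  also have "\<dots> \<le> (\<Sum>x\<in>linked k n. 2 * C ^ (2*k))"
  proof (rule sum_mono, clarify)
    fix p q
    have "\<bar>expectation (\<lambda>\<omega>. ?w p \<omega> * ?w q \<omega>)\<bar> \<le> C ^ (2*k)"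
    proof -
      have "\<bar>expectation (\<lambda>\<omega>. ?w p \<omega> * ?w q \<omega>)\<bar> \<le> expectation (\<lambda>\<omega>. \<bar>?w p \<omega> * ?w q \<omega>\<bar>)"
        using integral_norm_bound[of M "\<lambda>\<omega>. ?w p \<omega> * ?w q \<omega>"] by simp
      also have "\<dots> \<le> expectation (\<lambda>\<omega>. C ^ (2*k))"
        using b int2 by (intro integral_mono integrable_abs) auto
      finally show ?thesis by (simp add: prob_space)
    qed
    moreover have "\<bar>expectation (?w p) * expectation (?w q)\<bar> \<le> C ^ (2*k)"
      unfolding mult_2 power_add abs_mult using C1
      by (intro mult_mono expectation_word_bound letters_in) auto
    ultimately show "cov p q \<le> 2 * C ^ (2*k)" unfolding cov_def by linarith
  qed
  also have "\<dots> = 2 * C ^ (2*k) * card (linked k n)" by simp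
  also have "\<dots> \<le> 2 * C ^ (2*k) * (k * ((2*k) ^ (2*k) * n ^ Suc k))"
    using card_linked[of k n] C1 by (intro mult_left_mono) (auto simp flip: of_nat_power of_nat_mult simp del: of_nat_power)
  finally show ?thesis .
qed

end

section \<open>Existence of the limits of the pairing counts\<close>

subsection \<open>Counting lattice points by dominated convergence\<close>

definition unif :: "real measure" where
  "unif = uniform_measure lborel {0..<1}"

lemma prob_space_unif: "prob_space unif"
  unfolding unif_def by (rule prob_space_uniform_measure) auto

lemma sets_unif [measurable_cong, simp]: "sets unif = sets borel"
  by (simp add: unif_def)

lemma space_unif [simp]: "space unif = UNIV"
  by (simp add: unif_def)

lemma emeasure_unif_singleton: "emeasure unif {x} = 0"
proof -
  have "emeasure lborel ({0..<1} \<inter> {x}) \<le> emeasure lborel {x}" by (intro emeasure_mono) auto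
  then show ?thesis by (simp add: unif_def)
qed

lemma measure_unif_interval:
  assumes "0 \<le> a" "a \<le> b" "b \<le> 1"
  shows "measure unif {a..<b} = b - a"
proof -
  have "{0..<1} \<inter> {a..<b} = {a..<b}" using assms by auto
  then show ?thesis using assms by (simp add: unif_def measure_uniform_measure)
qed

locale unit_cube =
  fixes S :: "nat set"
  assumes finS: "finite S"
begin

abbreviation cube :: "(nat \<Rightarrow> real) measure" where "cube \<equiv> PiM S (\<lambda>_. unif)"

sublocale PP: finite_product_prob_space "\<lambda>_. unif" S
proof -
  interpret product_prob_space "\<lambda>_. unif" by (intro product_prob_spaceI prob_space_unif)
  show "finite_product_prob_space (\<lambda>_. unif) S" by unfold_locales (rule finS)
qed

lemma AE_cube_unit: "AE u in cube. \<forall>s\<in>S. 0 \<le> u s \<and> u s < 1"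
proof (rule AE_finite_allI[OF finS])
  fix s assume s: "s \<in> S"
  have "AE x in unif. 0 \<le> x \<and> x < 1"
    unfolding unif_def by (rule AE_uniform_measureI) auto
  then have "AE x in distr cube unif (\<lambda>u. u s). 0 \<le> x \<and> x < 1"
    unfolding PP.PiM_component[OF s] .
  then show "AE u in cube. 0 \<le> u s \<and> u s < 1"
    by (subst (asm) AE_distr_iff) (use s in auto)
qed

text \<open>With the other coordinates fixed, the equation admits a single value of
  \<open>u s0\<close> because \<open>\<alpha> s0\<close> is nonzero; Fubini integrates the measure
  of a point.\<close>

lemma AE_cube_hyperplane:
  assumes s0: "s0 \<in> S" and \<alpha>: "\<alpha> s0 \<noteq> (0::real)"
  shows "AE u in cube. (\<Sum>s\<in>S. \<alpha> s * u s) \<noteq> c"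
proof -
  let ?T = "S - {s0}"
  have S: "S = insert s0 ?T" using s0 by auto
  define A where "A = {u\<in>space cube. (\<Sum>s\<in>S. \<alpha> s * u s) = c}"
  have A: "A \<in> sets cube" unfolding A_def by measurable
  have ind: "indicator A (x(s0 := y)) \<le> (indicator {(c - (\<Sum>s\<in>?T. \<alpha> s * x s)) / \<alpha> s0} y :: ennreal)" for x y
  proof (cases "x(s0 := y) \<in> A")
    case True
    then have "(\<Sum>s\<in>S. \<alpha> s * (x(s0 := y)) s) = c" by (simp add: A_def)
    also have "(\<Sum>s\<in>S. \<alpha> s * (x(s0 := y)) s) = \<alpha> s0 * y + (\<Sum>s\<in>?T. \<alpha> s * (x(s0 := y)) s)"
      using finS s0 by (subst sum.remove[of S s0]) auto
    also have "(\<Sum>s\<in>?T. \<alpha> s * (x(s0 := y)) s) = (\<Sum>s\<in>?T. \<alpha> s * x s)" by (intro sum.cong) auto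
    finally have "y = (c - (\<Sum>s\<in>?T. \<alpha> s * x s)) / \<alpha> s0" using \<alpha> by (simp add: field_simps)
    then show ?thesis by (simp add: indicator_def)
  qed simp
  have "emeasure cube A = (\<integral>\<^sup>+u. indicator A u \<partial>PiM (insert s0 ?T) (\<lambda>_. unif))"
    using A S by simp
  also have "\<dots> = (\<integral>\<^sup>+x. (\<integral>\<^sup>+y. indicator A (x(s0 := y)) \<partial>unif) \<partial>PiM ?T (\<lambda>_. unif))"
    by (rule PP.product_nn_integral_insert) (use A S finS in auto)
  also have "\<dots> \<le> (\<integral>\<^sup>+x. (\<integral>\<^sup>+y. indicator {(c - (\<Sum>s\<in>?T. \<alpha> s * x s)) / \<alpha> s0} y \<partial>unif) \<partial>PiM ?T (\<lambda>_. unif))"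
    by (intro nn_integral_mono ind)
  also have "\<dots> = 0" by (simp add: emeasure_unif_singleton)
  finally have "A \<in> null_sets cube" using A by auto
  then have "AE u in cube. u \<notin> A" by (rule AE_not_in)
  with AE_space[of cube] show ?thesis by eventually_elim (simp add: A_def)
qed

definition floor_pt :: "nat \<Rightarrow> (nat \<Rightarrow> real) \<Rightarrow> nat \<Rightarrow> nat" where
  "floor_pt n u = (\<lambda>s\<in>S. nat \<lfloor>n * u s\<rfloor>)"

text \<open>The cell of side \<open>1 / n\<close> with lower corner \<open>v / n\<close>; within the
  unit cube it is the fibre of \<open>floor_pt n\<close> over \<open>v\<close>.\<close>

definition box :: "nat \<Rightarrow> (nat \<Rightarrow> nat) \<Rightarrow> (nat \<Rightarrow> real) set" where
  "box n v = PiE S (\<lambda>s. {real (v s) / n..<(real (v s) + 1) / n})"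

lemma mem_box_iff:
  assumes n: "n > 0" and u: "\<And>s. s \<in> S \<Longrightarrow> 0 \<le> u s" "u \<in> space cube" and v: "v \<in> extensional S"
  shows "u \<in> box n v \<longleftrightarrow> floor_pt n u = v"
proof -
  have ext: "u \<in> extensional S" using u by (simp add: space_PiM PiE_def)
  have "u s \<in> {real (v s) / n..<(real (v s) + 1) / n} \<longleftrightarrow> nat \<lfloor>n * u s\<rfloor> = v s" if "s \<in> S" for s
  proof -
    have "u s \<in> {real (v s) / n..<(real (v s) + 1) / n} \<longleftrightarrow> real (v s) \<le> n * u s \<and> n * u s < real (v s) + 1"
      using n by (auto simp: field_simps)
    also have "\<dots> \<longleftrightarrow> \<lfloor>n * u s\<rfloor> = int (v s)" by linarith
    also have "\<dots> \<longleftrightarrow> nat \<lfloor>n * u s\<rfloor> = v s"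
    proof -
      have "0 \<le> \<lfloor>n * u s\<rfloor>" using u(1)[OF that] by simp
      then show ?thesis by linarith
    qed
    finally show ?thesis .
  qed
  then have "u \<in> box n v \<longleftrightarrow> (\<forall>s\<in>S. nat \<lfloor>n * u s\<rfloor> = v s)" using ext by (auto simp: box_def PiE_iff)
  also have "\<dots> \<longleftrightarrow> floor_pt n u = v"
  proof
    assume "\<forall>s\<in>S. nat \<lfloor>n * u s\<rfloor> = v s"
    then show "floor_pt n u = v"
      unfolding floor_pt_def by (intro extensionalityI[OF restrict_extensional v]) simp
  next
    assume "floor_pt n u = v"
    then show "\<forall>s\<in>S. nat \<lfloor>n * u s\<rfloor> = v s" unfolding floor_pt_def by (metis restrict_apply')
  qed
  finally show ?thesis .
qed

text \<open>The normalized count is the volume of the cells with corners in \<open>G n\<close>, that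
  is, the integral of the indicator of \<open>floor_pt n u \<in> G n\<close>. Convergence at almost
  every \<open>u\<close> passes to the integral by domination with the constant 1, and the limit
  need not be known.\<close>

lemma card_convergent:
  fixes G :: "nat \<Rightarrow> (nat \<Rightarrow> nat) set"
  assumes G: "\<And>n. G n \<subseteq> PiE S (\<lambda>_. {..<n})"
    and conv: "AE u in cube. convergent (\<lambda>n. of_bool (floor_pt n u \<in> G n) :: real)"
  shows "convergent (\<lambda>n. card (G n) / real n ^ card S)"
proof -
  have finG: "finite (G n)" for n by (rule finite_subset[OF G]) (simp add: finite_PiE finS)
  define E where "E n = (\<Union>v\<in>G n. box n v)" for n
  have box: "box n v \<in> sets cube" for n v unfolding box_def by (rule sets_PiM_I_finite) (auto simp: finS)
  have E: "E n \<in> sets cube" for n unfolding E_def using box finG by (intro sets.finite_UN) auto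
  have mbox: "measure cube (box n v) = 1 / real n ^ card S" if v: "v \<in> G n" and n: "n > 0" for n v
  proof -
    have "measure cube (box n v) = (\<Prod>s\<in>S. measure unif {real (v s) / n..<(real (v s) + 1) / n})"
      unfolding box_def by (rule PP.prob_times) auto
    also have "\<dots> = (\<Prod>s\<in>S. 1 / real n)"
    proof (intro prod.cong refl)
      fix s assume "s \<in> S"
      then have "v s < n" using v G[of n] by auto
      then have "(real (v s) + 1) / n \<le> 1" using n by (simp add: field_simps flip: of_nat_Suc)
      then have "measure unif {real (v s) / n..<(real (v s) + 1) / n} = (real (v s) + 1) / n - real (v s) / n"
        using n by (intro measure_unif_interval) (auto simp: field_simps)
      then show "measure unif {real (v s) / n..<(real (v s) + 1) / n} = 1 / real n"
        by (simp add: add_divide_distrib)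
    qed
    finally show ?thesis by (simp add: power_one_over)
  qed
  have indic: "AE u in cube. \<forall>n>0. indicator (E n) u = (of_bool (floor_pt n u \<in> G n) :: real)"
  proof -
    have "AE u in cube. u \<in> space cube" by (rule AE_space)
    with AE_cube_unit show ?thesis
    proof eventually_elim
      case (elim u)
      show ?case
      proof (intro allI impI)
        fix n :: nat assume n: "n > 0"
        have "u \<in> E n \<longleftrightarrow> (\<exists>v\<in>G n. floor_pt n u = v)"
          unfolding E_def using mem_box_iff[OF n _ elim(2)] elim(1) G[of n] by (auto simp: PiE_def subset_iff)
        then show "indicator (E n) u = (of_bool (floor_pt n u \<in> G n) :: real)" by (auto simp: indicator_def)
      qed
    qed
  qed
  have mE: "measure cube (E n) = card (G n) / real n ^ card S" if n: "n > 0" for n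
  proof -
    have "disjoint_family_on (box n) (G n)"
      unfolding disjoint_family_on_def
    proof (intro ballI impI)
      fix v w assume vw: "v \<in> G n" "w \<in> G n" "v \<noteq> w"
      show "box n v \<inter> box n w = {}"
      proof (rule ccontr)
        assume "box n v \<inter> box n w \<noteq> {}"
        then obtain u where u: "u \<in> box n v" "u \<in> box n w" by auto
        have "0 \<le> u s" if "s \<in> S" for s
          using u(1) that by (auto simp: box_def PiE_iff intro: order_trans[of 0 "real (v s) / n"])
        moreover have "u \<in> space cube" using u(1) by (auto simp: box_def space_PiM PiE_iff)
        moreover have "v \<in> extensional S" "w \<in> extensional S" using vw G[of n] by (auto simp: PiE_def)
        ultimately show False using u vw(3) mem_box_iff[OF n, of u v] mem_box_iff[OF n, of u w] by auto
      qed
    qed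
    then have "measure cube (E n) = (\<Sum>v\<in>G n. measure cube (box n v))"
      unfolding E_def using box finG by (intro PP.finite_measure_finite_Union) auto
    then show ?thesis using mbox n by simp
  qed
  have "AE u in cube. (\<lambda>n. indicator (E n) u) \<longlonglongrightarrow> lim (\<lambda>n. indicator (E n) u :: real)"
    using conv indic
  proof eventually_elim
    case (elim u)
    have ev: "eventually (\<lambda>n. of_bool (floor_pt n u \<in> G n) = (indicator (E n) u :: real)) sequentially"
      using elim(2) by (intro eventually_sequentiallyI[of 1]) auto
    obtain l where "(\<lambda>n. of_bool (floor_pt n u \<in> G n) :: real) \<longlonglongrightarrow> l"
      using elim(1) by (auto simp: convergent_def)
    then have "(\<lambda>n. indicator (E n) u :: real) \<longlonglongrightarrow> l" by (rule Lim_transform_eventually) (rule ev)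
    then show ?case by (simp add: convergent_LIMSEQ_iff[symmetric] convergentI)
  qed
  then have "(\<lambda>n. \<integral>u. indicator (E n) u \<partial>cube) \<longlonglongrightarrow> (\<integral>u. lim (\<lambda>n. indicator (E n) u :: real) \<partial>cube)"
    using E by (intro integral_dominated_convergence[where w="\<lambda>_. 1"])
      (auto intro!: borel_measurable_lim_metric borel_measurable_indicator simp: indicator_def)
  then have "(\<lambda>n. measure cube (E n)) \<longlonglongrightarrow> (\<integral>u. lim (\<lambda>n. indicator (E n) u :: real) \<partial>cube)"
    using E sets.sets_into_space[OF E] by (simp add: Int_absorb2)
  then have "(\<lambda>n. card (G n) / real n ^ card S) \<longlonglongrightarrow> (\<integral>u. lim (\<lambda>n. indicator (E n) u :: real) \<partial>cube)"
    by (rule Lim_transform_eventually) (use mE in \<open>auto intro!: eventually_sequentiallyI[of 1]\<close>)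
  then show ?thesis by (rule convergentI)
qed

lemma floor_pt_tendsto:
  assumes s: "s \<in> S" and u: "0 \<le> u s"
  shows "(\<lambda>n. real (floor_pt n u s) / n) \<longlonglongrightarrow> u s"
proof (rule tendsto_sandwich)
  show "(\<lambda>n. u s - 1 / real n) \<longlonglongrightarrow> u s" by real_asymp
  show "(\<lambda>n. u s) \<longlonglongrightarrow> u s" by simp
  have b: "real n * u s - 1 \<le> real (floor_pt n u s)" "real (floor_pt n u s) \<le> real n * u s" for n :: nat
  proof -
    have "real (floor_pt n u s) = of_int \<lfloor>n * u s\<rfloor>" using s u by (simp add: floor_pt_def)
    then show "real n * u s - 1 \<le> real (floor_pt n u s)" "real (floor_pt n u s) \<le> real n * u s" by linarith+
  qed
  show "eventually (\<lambda>n. u s - 1 / real n \<le> real (floor_pt n u s) / n) sequentially"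
  proof (intro eventually_sequentiallyI[of 1])
    fix n :: nat assume "1 \<le> n"
    then have "u s - 1 / real n = (real n * u s - 1) / n" by (simp add: field_simps)
    also have "\<dots> \<le> real (floor_pt n u s) / n" by (intro divide_right_mono b) simp
    finally show "u s - 1 / real n \<le> real (floor_pt n u s) / n" .
  qed
  show "eventually (\<lambda>n. real (floor_pt n u s) / n \<le> u s) sequentially"
    using b(2) by (intro eventually_sequentiallyI[of 1]) (simp add: field_simps)
qed

end

subsection \<open>Limits of matching counts\<close>

context link
begin

text \<open>The last position has an earlier partner, so it is never the first member of its pair.
  Hence each of the \<open>h\<close> first members \<open>i\<close> yields a genuine free vertex
  \<open>Suc i\<close>, and vertex 0 is one more.\<close>

lemma card_free_vertices_pattern:
  assumes r: "r \<in> pair_patterns (2*h)" and h: "h > 0"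
  shows "card (free_vertices (2*h) {0} r) = Suc h" and "r (2*h - 1) < 2*h - 1"
proof -
  let ?k = "2*h"
  have rk: "r i \<le> i" "card {j\<in>{..<?k}. r j = r i} = 2" if "i < ?k" for i
    using r that by (auto simp: pair_patterns_def)
  show last: "r (?k - 1) < ?k - 1"
  proof -
    obtain j where j: "j < ?k" "r j = r (?k - 1)" "j \<noteq> ?k - 1"
    proof -
      have "\<not> {j\<in>{..<?k}. r j = r (?k - 1)} \<subseteq> {?k - 1}"
      proof
        assume "{j\<in>{..<?k}. r j = r (?k - 1)} \<subseteq> {?k - 1}"
        then have "card {j\<in>{..<?k}. r j = r (?k - 1)} \<le> card {?k - 1}" by (intro card_mono) auto
        then show False using rk(2)[of "?k - 1"] h by simp
      qed
      then show ?thesis using that by blast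
    qed
    then show ?thesis using rk(1)[of j] by linarith
  qed
  have "{v. v < ?k \<and> v \<notin> {0} \<and> r (v - 1) = v - 1} = Suc ` {i. i < ?k \<and> r i = i}"
  proof (intro equalityI subsetI)
    fix v assume "v \<in> Suc ` {i. i < ?k \<and> r i = i}"
    then obtain i where i: "i < ?k" "r i = i" "v = Suc i" by auto
    then have "i \<noteq> ?k - 1" using last by auto
    then show "v \<in> {v. v < ?k \<and> v \<notin> {0} \<and> r (v - 1) = v - 1}" using i by auto
  next
    fix v assume "v \<in> {v. v < ?k \<and> v \<notin> {0} \<and> r (v - 1) = v - 1}"
    then show "v \<in> Suc ` {i. i < ?k \<and> r i = i}" by (intro image_eqI[of _ _ "v - 1"]) auto
  qed
  then have "card {v. v < ?k \<and> v \<notin> {0} \<and> r (v - 1) = v - 1} = h"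
    using pair_pattern_fixed[OF r] by (simp add: card_image)
  moreover have "free_vertices ?k {0} r = insert 0 {v. v < ?k \<and> v \<notin> {0} \<and> r (v - 1) = v - 1}"
    by (auto simp: free_vertices_def)
  ultimately show "card (free_vertices ?k {0} r) = Suc h" by simp
qed

text \<open>A matching circuit is determined by its free values, so these sets have the same size as
  \<open>matching\<close> but live on coordinates without forced values, where random points of a
  cube can be compared with them.\<close>

definition free_values :: "nat \<Rightarrow> nat \<Rightarrow> (nat \<Rightarrow> nat) \<Rightarrow> (nat \<Rightarrow> nat) set" where
  "free_values k n r = (\<lambda>p. restrict p (free_vertices k {0} r)) ` matching k (cyc k) n r"

lemma free_values_subset:
  assumes "k > 0"
  shows "free_values k n r \<subseteq> PiE (free_vertices k {0} r) (\<lambda>_. {..<n})"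
  unfolding free_values_def
proof (rule image_subsetI)
  fix p assume "p \<in> matching k (cyc k) n r"
  then have p: "p \<in> PiE {..<k} (\<lambda>_. {..<n})" by (simp add: matching_def circuits_def)
  have "free_vertices k {0} r \<subseteq> {..<k}" using assms by (auto simp: free_vertices_def)
  then show "restrict p (free_vertices k {0} r) \<in> PiE (free_vertices k {0} r) (\<lambda>_. {..<n})"
    unfolding restrict_PiE_iff using PiE_mem[OF p] by blast
qed

lemma card_free_values:
  assumes r: "r \<in> pair_patterns k"
  shows "card (free_values k n r) = card (matching k (cyc k) n r)"
  unfolding free_values_def
  by (rule card_image, rule inj_on_restrict_matching[OF cyc_le cyc_chain])
     (use r in \<open>auto simp: pair_patterns_def\<close>)

lemma matching_convergentI:
  assumes r: "r \<in> pair_patterns (2*h)" and h: "h > 0"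
    and conv: "AE u in PiM (free_vertices (2*h) {0} r) (\<lambda>_. unif).
      convergent (\<lambda>n. of_bool (unit_cube.floor_pt (free_vertices (2*h) {0} r) n u \<in> free_values (2*h) n r) :: real)"
  shows "convergent (\<lambda>n. card (matching (2*h) (cyc (2*h)) n r) / real n ^ Suc h)"
proof -
  interpret unit_cube "free_vertices (2*h) {0} r"
    by unfold_locales (rule finite_free_vertices, use h in auto)
  show ?thesis
    using card_convergent[OF free_values_subset conv] h r
    by (simp add: card_free_vertices_pattern card_free_values)
qed

end

subsection \<open>The Wigner link\<close>

definition wigner_link :: "nat \<Rightarrow> nat \<Rightarrow> nat \<times> nat" where
  "wigner_link i j = (min (Suc i) (Suc j), max (Suc i) (Suc j))"

interpretation wigner: link wigner_link
  by unfold_locales (auto simp: wigner_link_def min_def max_def split: if_splits)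

lemma wigner_link_eq_iff:
  "wigner_link a b = wigner_link c d \<longleftrightarrow> (a = c \<and> b = d) \<or> (a = d \<and> b = c)"
  by (auto simp: wigner_link_def min_def max_def)

text \<open>Equal Wigner letters are equal unordered pairs, so a forced vertex copies the value of
  an earlier one.\<close>

lemma wigner_matching_range:
  assumes r: "\<And>i. i < k \<Longrightarrow> r i \<le> i"
    and p: "p \<in> wigner.matching k (wigner.cyc k) n r" and v: "v < k"
  shows "p v \<in> p ` wigner.free_vertices k {0} r"
  using v
proof (induction v rule: less_induct)
  case (less v)
  show ?case
  proof (cases "v \<in> wigner.free_vertices k {0} r")
    case False
    then have "v \<noteq> 0" "r (v - 1) \<noteq> v - 1" using less.prems by (auto simp: wigner.free_vertices_def)
    moreover have "r (v - 1) \<le> v - 1" using less.prems by (intro r) simp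
    ultimately have v: "v > 0" "r (v - 1) < v - 1" by simp_all
    let ?j = "r (v - 1)"
    have "wigner.letters (wigner.cyc k) p ?j = wigner.letters (wigner.cyc k) p (v - 1)"
      using p less.prems by (auto simp: wigner.matching_def)
    then have "p v = p ?j \<or> p v = p (Suc ?j)"
      using v less.prems by (auto simp: wigner.letters_def wigner_link_eq_iff)
    moreover have "?j < v" "Suc ?j < v" using v by auto
    ultimately show ?thesis using less.IH[of ?j] less.IH[of "Suc ?j"] less.prems by auto
  qed simp
qed

text \<open>Coincidences of Wigner letters are equalities between vertices, hence survive any
  relabelling of values. If the free values of one matching circuit are distinct, they can be
  relabelled to arbitrary free values, whatever the size.\<close>

lemma wigner_free_values_transfer:
  assumes k: "k > 0" and r: "\<And>i. i < k \<Longrightarrow> r i \<le> i"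
    and v: "v \<in> wigner.free_values k n r" "inj_on v (wigner.free_vertices k {0} r)"
    and v': "v' \<in> PiE (wigner.free_vertices k {0} r) (\<lambda>_. {..<n'})"
  shows "v' \<in> wigner.free_values k n' r"
proof -
  let ?F = "wigner.free_vertices k {0} r"
  have F: "?F \<subseteq> {..<k}" using k by (auto simp: wigner.free_vertices_def)
  obtain p where p: "p \<in> wigner.matching k (wigner.cyc k) n r" "v = restrict p ?F"
    using v by (auto simp: wigner.free_values_def)
  have inj: "inj_on p ?F" using v(2) unfolding p(2) by (simp add: inj_on_restrict_eq)
  \<comment> \<open>Well defined on the free values by injectivity, and by
    \<open>wigner_matching_range\<close> the circuit takes no other values.\<close>
  define \<tau> where "\<tau> x = v' (inv_into ?F p x)" for x
  have \<tau>: "\<tau> (p s) = v' s" if "s \<in> ?F" for s using inj that by (simp add: \<tau>_def)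
  define p' where "p' = restrict (\<lambda>i. \<tau> (p i)) {..<k}"
  have "p' i < n'" if i: "i < k" for i
  proof -
    obtain s where "s \<in> ?F" "p i = p s" using wigner_matching_range[OF r p(1) i] by auto
    then show ?thesis using \<tau>[of s] v' i by (auto simp: p'_def PiE_iff)
  qed
  then have "p' \<in> circuits k n'" by (auto simp: circuits_def p'_def)
  moreover have "wigner.letters (wigner.cyc k) p' (r i) = wigner.letters (wigner.cyc k) p' i" if i: "i < k" for i
  proof -
    have "wigner.letters (wigner.cyc k) p (r i) = wigner.letters (wigner.cyc k) p i"
      using p(1) i by (simp add: wigner.matching_def)
    moreover have "r i < k" using r[OF i] i by simp
    ultimately show ?thesis using i k by (auto simp: wigner.letters_def wigner_link_eq_iff p'_def)
  qed
  ultimately have "p' \<in> wigner.matching k (wigner.cyc k) n' r" by (simp add: wigner.matching_def)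
  moreover have "restrict p' ?F = v'"
  proof (rule extensionalityI[OF restrict_extensional])
    show "v' \<in> extensional ?F" using v' by (simp add: PiE_def)
    fix s assume "s \<in> ?F"
    then show "restrict p' ?F s = v' s" using F by (auto simp: p'_def \<tau>)
  qed
  ultimately show ?thesis unfolding wigner.free_values_def by (metis imageI)
qed

text \<open>Almost every \<open>u\<close> has distinct coordinates, so the lattice points
  \<open>floor_pt n u\<close> eventually have distinct coordinates too. By transfer, membership is
  then the same for all large \<open>n\<close>: the indicator is eventually constant.\<close>

lemma wigner_matching_convergent:
  assumes r: "r \<in> wigner.pair_patterns (2*h)" and h: "h > 0"
  shows "convergent (\<lambda>n. card (wigner.matching (2*h) (wigner.cyc (2*h)) n r) / real n ^ Suc h)"
proof (rule wigner.matching_convergentI[OF r h])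
  let ?F = "wigner.free_vertices (2*h) {0} r" and ?G = "\<lambda>n. wigner.free_values (2*h) n r"
  interpret unit_cube ?F
    by unfold_locales (rule wigner.finite_free_vertices, use h in auto)
  have rle: "\<And>i. i < 2*h \<Longrightarrow> r i \<le> i" using r by (auto simp: wigner.pair_patterns_def)
  have "AE u in cube. u s \<noteq> u t" if st: "s \<in> ?F" "t \<in> ?F" "s \<noteq> t" for s t
  proof -
    have "AE u in cube. (\<Sum>x\<in>?F. (of_bool (x = s) - of_bool (x = t)) * u x) \<noteq> 0"
      by (rule AE_cube_hyperplane[of s]) (use st in auto)
    moreover have "(\<Sum>x\<in>?F. (of_bool (x = s) - of_bool (x = t)) * u x) = u s - u t" for u :: "nat \<Rightarrow> real"
    proof -
      have "(\<Sum>x\<in>?F. (of_bool (x = s) - of_bool (x = t)) * u x)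
         = (\<Sum>x\<in>?F. (if x = s then u s else 0) - (if x = t then u t else 0))"
        by (intro sum.cong refl) auto
      then show ?thesis using st finS by (simp add: sum_subtractf)
    qed
    ultimately show ?thesis by simp
  qed
  then have "AE u in cube. s \<noteq> t \<longrightarrow> u s \<noteq> u t" if "s \<in> ?F" "t \<in> ?F" for s t
    using that by (cases "s = t") auto
  then have dist: "AE u in cube. \<forall>s\<in>?F. \<forall>t\<in>?F. s \<noteq> t \<longrightarrow> u s \<noteq> u t"
    by (intro AE_finite_allI finS)
  show "AE u in cube. convergent (\<lambda>n. of_bool (floor_pt n u \<in> ?G n) :: real)"
    using dist AE_cube_unit
  proof eventually_elim
    case (elim u)
    have "eventually (\<lambda>n. floor_pt n u s \<noteq> floor_pt n u t) sequentially"
      if st: "s \<in> ?F" "t \<in> ?F" "s \<noteq> t" for s t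
    proof -
      have "(\<lambda>n. real (floor_pt n u s) / n - real (floor_pt n u t) / n) \<longlonglongrightarrow> u s - u t"
        using elim(2) st by (intro tendsto_diff floor_pt_tendsto) auto
      then have "eventually (\<lambda>n. real (floor_pt n u s) / n - real (floor_pt n u t) / n \<noteq> 0) sequentially"
        using elim(1) st by (intro tendsto_imp_eventually_ne) auto
      then show ?thesis by eventually_elim auto
    qed
    then have "eventually (\<lambda>n. s \<noteq> t \<longrightarrow> floor_pt n u s \<noteq> floor_pt n u t) sequentially"
      if "s \<in> ?F" "t \<in> ?F" for s t using that by (cases "s = t") auto
    then have "eventually (\<lambda>n. \<forall>s\<in>?F. \<forall>t\<in>?F. s \<noteq> t \<longrightarrow> floor_pt n u s \<noteq> floor_pt n u t) sequentially"
      by (intro eventually_ball_finite finS ballI)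
    then obtain N where N: "\<And>n. n \<ge> N \<Longrightarrow> inj_on (floor_pt n u) ?F"
      unfolding eventually_sequentially inj_on_def by metis
    have mem: "floor_pt n u \<in> PiE ?F (\<lambda>_. {..<n})" if "n > 0" for n
    proof -
      have "nat \<lfloor>real n * u s\<rfloor> < n" if "s \<in> ?F" for s
      proof -
        have "real n * u s < real n" using elim(2) that \<open>n > 0\<close> by simp
        then show ?thesis using \<open>n > 0\<close> by linarith
      qed
      then show ?thesis by (auto simp: floor_pt_def)
    qed
    have imp: "floor_pt m u \<in> ?G m" if "floor_pt n u \<in> ?G n" "n \<ge> Suc N" "m \<ge> Suc N" for n m
      by (rule wigner_free_values_transfer[OF _ rle that(1) N mem]) (use that h in auto)
    then have iff: "floor_pt n u \<in> ?G n \<longleftrightarrow> floor_pt m u \<in> ?G m" if "n \<ge> Suc N" "m \<ge> Suc N" for n m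
      using that by blast
    have "(\<lambda>n. of_bool (floor_pt n u \<in> ?G n) :: real) \<longlonglongrightarrow> of_bool (floor_pt (Suc N) u \<in> ?G (Suc N))"
    proof (rule tendsto_eventually, rule eventually_sequentiallyI)
      fix n assume "n \<ge> Suc N"
      then show "of_bool (floor_pt n u \<in> ?G n) = (of_bool (floor_pt (Suc N) u \<in> ?G (Suc N)) :: real)"
        using iff[OF _ order_refl, of n] by simp
    qed
    then show ?case by (rule convergentI)
  qed
qed

subsection \<open>The Hankel link\<close>

definition hankel_link :: "nat \<Rightarrow> nat \<Rightarrow> nat" where
  "hankel_link i j = Suc i + Suc j"

interpretation hankel: link hankel_link
  by unfold_locales (auto simp: hankel_link_def)

text \<open>The circuit determined by its free values, as a linear function of these.\<close>

fun walk :: "(nat \<Rightarrow> nat) \<Rightarrow> (nat \<Rightarrow> real) \<Rightarrow> nat \<Rightarrow> real" where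
  "walk r v 0 = v 0"
| "walk r v (Suc i) = (if r i < i then walk r v (r i) + walk r v (Suc (r i)) - walk r v i else v (Suc i))"

declare walk.simps(2) [simp del]

lemma walk_Suc_determined: "r i < i \<Longrightarrow> walk r v (Suc i) = walk r v (r i) + walk r v (Suc (r i)) - walk r v i"
  by (simp add: walk.simps(2))

lemma walk_Suc_free: "\<not> r i < i \<Longrightarrow> walk r v (Suc i) = v (Suc i)"
  by (simp add: walk.simps(2))

text \<open>The range includes \<open>i = k\<close>, the value reached after the last step;
  comparing it with the starting value expresses that the circuit closes.\<close>

lemma walk_linear:
  assumes F: "finite F" "0 \<in> F" and s: "\<And>i. i < k \<Longrightarrow> \<not> r i < i \<Longrightarrow> Suc i \<in> F" and i: "i \<le> k"
  shows "\<exists>\<alpha>. \<forall>v. walk r v i = (\<Sum>s\<in>F. \<alpha> s * v s)"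
  using i
proof (induction i rule: less_induct)
  case (less i)
  have coord: "\<exists>\<alpha>::nat \<Rightarrow> real. \<forall>v. v x = (\<Sum>s\<in>F. \<alpha> s * v s)" if "x \<in> F" for x :: nat
  proof (intro exI allI)
    fix v :: "nat \<Rightarrow> real"
    have "(\<Sum>s\<in>F. of_bool (s = x) * v s) = (\<Sum>s\<in>F. if s = x then v x else 0)"
      by (intro sum.cong refl) auto
    then show "v x = (\<Sum>s\<in>F. of_bool (s = x) * v s)" using F that by simp
  qed
  show ?case
  proof (cases i)
    case 0
    then show ?thesis using coord[OF F(2)] by simp
  next
    case (Suc j)
    show ?thesis
    proof (cases "r j < j")
      case True
      obtain \<alpha> \<beta> \<gamma> where
        "\<And>v. walk r v (r j) = (\<Sum>s\<in>F. \<alpha> s * v s)"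
        "\<And>v. walk r v (Suc (r j)) = (\<Sum>s\<in>F. \<beta> s * v s)"
        "\<And>v. walk r v j = (\<Sum>s\<in>F. \<gamma> s * v s)"
        using less.IH[of "r j"] less.IH[of "Suc (r j)"] less.IH[of j] less.prems True Suc by auto
      then have "walk r v i = (\<Sum>s\<in>F. (\<alpha> s + \<beta> s - \<gamma> s) * v s)" for v
        using True Suc by (simp add: walk_Suc_determined algebra_simps sum.distrib sum_subtractf)
      then show ?thesis by (intro exI[of _ "\<lambda>s. \<alpha> s + \<beta> s - \<gamma> s"]) blast
    next
      case False
      then have "Suc j \<in> F" using s[of j] less.prems Suc by simp
      then show ?thesis using coord[of "Suc j"] False Suc by (simp add: walk_Suc_free)
    qed
  qed
qed

text \<open>Says that the coefficients of each linear form \<open>walk r _ i\<close> sum to 1. So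
  none of these forms vanishes identically, and each avoids a given constant almost surely.\<close>

lemma walk_const: "walk r (\<lambda>_. 1) i = 1"
proof (induction i rule: less_induct)
  case (less i)
  show ?case
  proof (cases i)
    case (Suc j)
    show ?thesis
    proof (cases "r j < j")
      case True
      have "walk r (\<lambda>_. 1) (r j) = 1" "walk r (\<lambda>_. 1) (Suc (r j)) = 1" "walk r (\<lambda>_. 1) j = 1"
        by (rule less.IH, use Suc True in linarith)+
      then show ?thesis using True Suc by (simp add: walk_Suc_determined)
    qed (simp add: Suc walk_Suc_free)
  qed simp
qed

lemma walk_Ints: "walk r (\<lambda>s. real (v s)) i \<in> \<int>"
proof (induction i rule: less_induct)
  case (less i)
  show ?case
  proof (cases i)
    case (Suc j)
    show ?thesis
    proof (cases "r j < j")
      case True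
      have "walk r (\<lambda>s. real (v s)) (r j) \<in> \<int>" "walk r (\<lambda>s. real (v s)) (Suc (r j)) \<in> \<int>"
        "walk r (\<lambda>s. real (v s)) j \<in> \<int>"
        by (rule less.IH, use Suc True in linarith)+
      then show ?thesis using True Suc by (simp add: walk_Suc_determined)
    qed (simp add: Suc walk_Suc_free)
  qed simp
qed

text \<open>Equal Hankel letters are equal sums, so forced vertices follow the recursion of
  \<open>walk\<close>. Free values extend to a circuit exactly when all vertices stay in the range
  and the vertex forced by the last step is the starting one.\<close>

lemma hankel_free_values_iff:
  assumes r: "r \<in> hankel.pair_patterns (2*h)" and h: "h > 0"
    and v: "v \<in> extensional (hankel.free_vertices (2*h) {0} r)"
  defines "W \<equiv> walk r (\<lambda>s. real (v s))"
  shows "v \<in> hankel.free_values (2*h) n r \<longleftrightarrow>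
     (\<forall>i<2*h. 0 \<le> W i \<and> W i < n) \<and> W (2*h) = W 0"
proof -
  let ?k = "2*h"
  let ?F = "hankel.free_vertices ?k {0} r"
  have k: "?k > 0" using h by simp
  have rle: "\<And>i. i < ?k \<Longrightarrow> r i \<le> i" using r by (auto simp: hankel.pair_patterns_def)
  note last = hankel.card_free_vertices_pattern(2)[OF r h]
  have Fin: "s \<in> ?F \<longleftrightarrow> s = 0 \<or> (s < ?k \<and> \<not> r (s - 1) < s - 1)" for s
    using rle[of "s - 1"] by (auto simp: hankel.free_vertices_def)
  have F: "?F \<subseteq> {..<?k}" using k by (auto simp: hankel.free_vertices_def)
  show ?thesis
  proof
    assume "v \<in> hankel.free_values ?k n r"
    then obtain p where p: "p \<in> hankel.matching ?k (hankel.cyc ?k) n r" and v: "v = restrict p ?F"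
      by (auto simp: hankel.free_values_def)
    have W: "W i = real (p (i mod ?k))" if "i \<le> ?k" for i
      using that
    proof (induction i rule: less_induct)
      case (less i)
      show ?case
      proof (cases i)
        case 0
        then show ?thesis using Fin[of 0] by (simp add: W_def v)
      next
        case (Suc j)
        show ?thesis
        proof (cases "r j < j")
          case True
          have j: "j < ?k" using less.prems Suc by simp
          have "hankel.letters (hankel.cyc ?k) p (r j) = hankel.letters (hankel.cyc ?k) p j"
            using p j by (auto simp: hankel.matching_def)
          moreover have "Suc (r j) < ?k" using True j by linarith
          ultimately have "p (r j) + p (Suc (r j)) = p j + p (Suc j mod ?k)"
            by (simp add: hankel.letters_def hankel_link_def)
          moreover have "W (r j) = p (r j)" "W (Suc (r j)) = p (Suc (r j))" "W j = p j"
            using less.IH[of "r j"] less.IH[of "Suc (r j)"] less.IH[of j] True Suc less.prems by auto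
          moreover have "W i = W (r j) + W (Suc (r j)) - W j" using True Suc by (simp add: W_def walk_Suc_determined)
          ultimately show ?thesis unfolding Suc by linarith
        next
          case False
          then have "j \<noteq> ?k - 1" using last by auto
          then have i: "i < ?k" using less.prems Suc by simp
          then have "i \<in> ?F" using False Suc Fin[of i] by simp
          then show ?thesis using False Suc i by (simp add: W_def v walk_Suc_free)
        qed
      qed
    qed
    have "p i < n" if "i < ?k" for i using p that by (auto simp: hankel.matching_def circuits_def)
    then show "(\<forall>i<?k. 0 \<le> W i \<and> W i < n) \<and> W ?k = W 0" using W by simp
  next
    assume *: "(\<forall>i<?k. 0 \<le> W i \<and> W i < n) \<and> W ?k = W 0"
    \<comment> \<open>The floor loses nothing: the walk has integer values at integer
      arguments.\<close>
    define p where "p = restrict (\<lambda>i. nat \<lfloor>W i\<rfloor>) {..<?k}"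
    have pW: "real (p i) = W i" if "i < ?k" for i
    proof -
      have "of_int \<lfloor>W i\<rfloor> = W i" using walk_Ints[of r v i] by (simp add: W_def)
      moreover have "0 \<le> W i" using * that by simp
      ultimately show ?thesis using that by (simp add: p_def)
    qed
    have pS: "real (p (Suc i mod ?k)) = W (Suc i)" if "i < ?k" for i
    proof (cases "Suc i = ?k")
      case True
      then show ?thesis using * pW[of 0] k by simp
    next
      case False
      then show ?thesis using that pW[of "Suc i"] by simp
    qed
    have "p i < n" if "i < ?k" for i using pW[OF that] * that by (metis of_nat_less_iff)
    then have "p \<in> circuits ?k n" by (auto simp: circuits_def p_def)
    moreover have "hankel.letters (hankel.cyc ?k) p (r i) = hankel.letters (hankel.cyc ?k) p i" if i: "i < ?k" for i
    proof (cases "r i < i")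
      case True
      then have "r i < ?k" using i by simp
      have "real (p (r i)) + real (p (Suc (r i) mod ?k)) = real (p i) + real (p (Suc i mod ?k))"
        unfolding pW[OF \<open>r i < ?k\<close>] pS[OF \<open>r i < ?k\<close>] pW[OF i] pS[OF i] using True by (simp add: W_def walk_Suc_determined)
      then have "p (r i) + p (Suc (r i) mod ?k) = p i + p (Suc i mod ?k)" by linarith
      then show ?thesis by (simp add: hankel.letters_def hankel_link_def)
    next
      case False
      then have "r i = i" using rle[OF i] by simp
      then show ?thesis by simp
    qed
    ultimately have "p \<in> hankel.matching ?k (hankel.cyc ?k) n r" by (simp add: hankel.matching_def)
    moreover have "restrict p ?F = v"
    proof (rule extensionalityI[OF restrict_extensional v])
      fix s assume s: "s \<in> ?F"
      have "W s = v s"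
      proof (cases s)
        case (Suc j)
        then show ?thesis using s Fin[of s] by (simp add: W_def walk_Suc_free)
      qed (simp add: W_def)
      then have "real (p s) = real (v s)" using pW[of s] s F by auto
      then show "restrict p ?F s = v s" using s by simp
    qed
    ultimately show "v \<in> hankel.free_values ?k n r" unfolding hankel.free_values_def by (metis imageI)
  qed
qed

text \<open>After division by \<open>n\<close> membership means \<open>0 \<le> walk < 1\<close> at
  each vertex together with the closing equation, evaluated at points converging to
  \<open>u\<close>. Almost surely no walk coordinate of \<open>u\<close> is 0 or 1, so the
  inequalities stabilize.\<close>

lemma hankel_matching_convergent:
  assumes r: "r \<in> hankel.pair_patterns (2*h)" and h: "h > 0"
  shows "convergent (\<lambda>n. card (hankel.matching (2*h) (hankel.cyc (2*h)) n r) / real n ^ Suc h)"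
proof (rule hankel.matching_convergentI[OF r h])
  let ?k = "2*h"
  let ?F = "hankel.free_vertices ?k {0} r" and ?G = "\<lambda>n. hankel.free_values ?k n r"
  interpret unit_cube ?F
    by unfold_locales (rule hankel.finite_free_vertices, use h in auto)
  have rle: "\<And>i. i < ?k \<Longrightarrow> r i \<le> i" using r by (auto simp: hankel.pair_patterns_def)
  note last = hankel.card_free_vertices_pattern(2)[OF r h]
  have F0: "0 \<in> ?F" by (auto simp: hankel.free_vertices_def)
  have FS: "Suc i \<in> ?F" if "i < ?k" "\<not> r i < i" for i
  proof -
    have "i \<noteq> ?k - 1" using last that by auto
    then show ?thesis using that rle[of i] by (auto simp: hankel.free_vertices_def)
  qed
  have "\<forall>i\<in>{..?k}. \<exists>\<alpha>. \<forall>v. walk r v i = (\<Sum>s\<in>?F. \<alpha> s * v s)"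
    using walk_linear[OF finS F0 FS] by auto
  then obtain \<alpha> where \<alpha>: "\<And>i v. i \<le> ?k \<Longrightarrow> walk r v i = (\<Sum>s\<in>?F. \<alpha> i s * v s)"
    by (auto dest!: bchoice)
  have "AE u in cube. walk r u i \<noteq> c" if i: "i < ?k" for i c
  proof -
    have "(\<Sum>s\<in>?F. \<alpha> i s) = 1" using \<alpha>[of i "\<lambda>_. 1"] walk_const[of r i] i by simp
    then obtain s where "s \<in> ?F" "\<alpha> i s \<noteq> 0" by (metis sum.neutral zero_neq_one)
    then show ?thesis using AE_cube_hyperplane[of s "\<alpha> i" c] \<alpha>[of i] i by simp
  qed
  then have "AE u in cube. \<forall>i\<in>{..<?k}. walk r u i \<noteq> 0 \<and> walk r u i \<noteq> 1"
    by (intro AE_finite_allI AE_conjI) auto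
  \<comment> \<open>The closing equation either holds identically in \<open>v\<close> or defines a
    hyperplane of measure zero; in the second case it also fails for all large
    \<open>n\<close>.\<close>
  moreover have "AE u in cube. (\<forall>v. walk r v ?k = walk r v 0) \<or> walk r u ?k \<noteq> walk r u 0"
  proof (cases "\<exists>s\<in>?F. \<alpha> ?k s - \<alpha> 0 s \<noteq> 0")
    case True
    then obtain s where "s \<in> ?F" "\<alpha> ?k s - \<alpha> 0 s \<noteq> 0" by blast
    then have "AE u in cube. (\<Sum>s\<in>?F. (\<alpha> ?k s - \<alpha> 0 s) * u s) \<noteq> 0" by (rule AE_cube_hyperplane)
    then show ?thesis
      by eventually_elim (simp add: \<alpha>[of ?k] \<alpha>[of 0] left_diff_distrib sum_subtractf del: walk.simps)
  next
    case False
    then have "walk r v ?k = walk r v 0" for v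
      unfolding \<alpha>[OF order_refl] \<alpha>[OF le0] by (intro sum.cong) auto
    then show ?thesis by simp
  qed
  ultimately show "AE u in cube. convergent (\<lambda>n. of_bool (floor_pt n u \<in> ?G n) :: real)"
    using AE_cube_unit
  proof eventually_elim
    case (elim u)
    define w where "w n s = real (floor_pt n u s) / n" for n s
    have wlim: "(\<lambda>n. walk r (w n) i) \<longlonglongrightarrow> walk r u i" if "i \<le> ?k" for i
      unfolding \<alpha>[OF that] w_def using elim(3) by (intro tendsto_sum tendsto_mult tendsto_const floor_pt_tendsto) auto
    have scale: "walk r (\<lambda>s. real (floor_pt n u s)) i = n * walk r (w n) i" if "i \<le> ?k" "n > 0" for i n
      unfolding \<alpha>[OF that(1)] w_def using that(2) by (simp add: sum_distrib_left)
    have iff: "floor_pt n u \<in> ?G n \<longleftrightarrow> (\<forall>i\<in>{..<?k}. 0 \<le> walk r (w n) i \<and> walk r (w n) i < 1) \<and> walk r (w n) ?k = walk r (w n) 0"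
      if n: "n > 0" for n
    proof -
      have "floor_pt n u \<in> extensional ?F" by (simp add: floor_pt_def)
      from hankel_free_values_iff[OF r h this, of n] show ?thesis
        using n scale[of _ n] by (auto simp: zero_le_mult_iff simp del: walk.simps)
    qed
    have ev1: "eventually (\<lambda>n. (0 \<le> walk r (w n) i \<and> walk r (w n) i < 1) \<longleftrightarrow> (0 < walk r u i \<and> walk r u i < 1)) sequentially"
      if i: "i \<in> {..<?k}" for i
    proof -
      have ne: "walk r u i \<noteq> 0" "walk r u i \<noteq> 1" using elim(1) i by auto
      have "eventually (\<lambda>n. (0 \<le> walk r (w n) i) \<longleftrightarrow> 0 < walk r u i) sequentially"
      proof (cases "0 < walk r u i")
        case True
        then have "eventually (\<lambda>n. 0 < walk r (w n) i) sequentially"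
          using wlim[of i] i by (intro order_tendstoD(1)) auto
        then show ?thesis by eventually_elim (use True in auto)
      next
        case False
        then have "eventually (\<lambda>n. walk r (w n) i < 0) sequentially"
          using wlim[of i] i ne by (intro order_tendstoD(2)) auto
        then show ?thesis by eventually_elim (use False in auto)
      qed
      moreover have "eventually (\<lambda>n. (walk r (w n) i < 1) \<longleftrightarrow> walk r u i < 1) sequentially"
      proof (cases "walk r u i < 1")
        case True
        then have "eventually (\<lambda>n. walk r (w n) i < 1) sequentially"
          using wlim[of i] i by (intro order_tendstoD(2)) auto
        then show ?thesis by eventually_elim (use True in auto)
      next
        case False
        then have "eventually (\<lambda>n. 1 < walk r (w n) i) sequentially"
          using wlim[of i] i ne by (intro order_tendstoD(1)) auto
        then show ?thesis by eventually_elim (use False in auto)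
      qed
      ultimately show ?thesis by eventually_elim auto
    qed
    have ev2: "eventually (\<lambda>n. walk r (w n) ?k = walk r (w n) 0 \<longleftrightarrow> walk r u ?k = walk r u 0) sequentially"
    proof (cases "\<forall>v. walk r v ?k = walk r v 0")
      case True
      then show ?thesis by simp
    next
      case False
      then have "walk r u ?k \<noteq> walk r u 0" using elim(2) by blast
      then have ne: "walk r u ?k - walk r u 0 \<noteq> 0" unfolding right_minus_eq .
      have "(\<lambda>n. walk r (w n) ?k - walk r (w n) 0) \<longlonglongrightarrow> walk r u ?k - walk r u 0"
        using wlim by (intro tendsto_diff) (auto simp del: walk.simps)
      then have "eventually (\<lambda>n. walk r (w n) ?k - walk r (w n) 0 \<noteq> 0) sequentially"
        using ne by (rule tendsto_imp_eventually_ne)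
      then show ?thesis by eventually_elim (use ne in \<open>simp only: right_minus_eq simp_thms\<close>)
    qed
    have "eventually (\<lambda>n. \<forall>i\<in>{..<?k}. (0 \<le> walk r (w n) i \<and> walk r (w n) i < 1) \<longleftrightarrow> (0 < walk r u i \<and> walk r u i < 1)) sequentially"
      using ev1 by (intro eventually_ball_finite) auto
    moreover note ev2 eventually_gt_at_top[of "0::nat"]
    ultimately have "eventually (\<lambda>n. of_bool (floor_pt n u \<in> ?G n) =
       (of_bool ((\<forall>i\<in>{..<?k}. 0 < walk r u i \<and> walk r u i < 1) \<and> walk r u ?k = walk r u 0) :: real)) sequentially"
    proof eventually_elim
      case (elim n)
      have "(\<forall>i\<in>{..<?k}. 0 \<le> walk r (w n) i \<and> walk r (w n) i < 1) \<longleftrightarrow> (\<forall>i\<in>{..<?k}. 0 < walk r u i \<and> walk r u i < 1)"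
        using elim(1) by (intro ball_cong refl) (rule bspec)
      then show ?case unfolding iff[OF elim(3)] by (simp only: elim(2))
    qed
    then show ?case by (intro convergentI tendsto_eventually)
  qed
qed

section \<open>The moment method\<close>

definition emp_char :: "nat \<Rightarrow> (nat \<Rightarrow> real) \<Rightarrow> real \<Rightarrow> complex" where
  "emp_char N s t = (\<Sum>a<N. iexp (t * s a)) / of_nat N"

definition emp_moment :: "nat \<Rightarrow> (nat \<Rightarrow> real) \<Rightarrow> nat \<Rightarrow> real" where
  "emp_moment N s k = (\<Sum>a<N. s a ^ k) / real N"

definition emp_measure :: "nat \<Rightarrow> (nat \<Rightarrow> real) \<Rightarrow> real measure" where
  "emp_measure N s = distr (measure_pmf (pmf_of_set {..<N})) borel s"

lemma real_distribution_emp_measure: "real_distribution (emp_measure N s)"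
  unfolding emp_measure_def
  by (intro prob_space.real_distribution_distr measure_pmf.prob_space_axioms) simp

lemma measure_emp_measure:
  assumes N: "N > 0" and A: "A \<in> sets borel"
  shows "measure (emp_measure N s) A = card {a\<in>{..<N}. s a \<in> A} / N"
proof -
  have "measure (emp_measure N s) A = measure (measure_pmf (pmf_of_set {..<N})) (s -` A)"
    unfolding emp_measure_def using A by (simp add: measure_distr)
  also have "\<dots> = card ({..<N} \<inter> s -` A) / card {..<N}"
    by (rule measure_pmf_of_set) (use N in auto)
  also have "{..<N} \<inter> s -` A = {a\<in>{..<N}. s a \<in> A}" by auto
  finally show ?thesis by simp
qed

lemma cdf_emp_measure: "N > 0 \<Longrightarrow> cdf (emp_measure N s) x = card {a\<in>{..<N}. s a \<le> x} / N"
  by (simp add: cdf_def measure_emp_measure)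

lemma char_emp_measure:
  assumes N: "N > 0"
  shows "char (emp_measure N s) t = emp_char N s t"
proof -
  have "char (emp_measure N s) t = (\<integral>a. iexp (t * s a) \<partial>measure_pmf (pmf_of_set {..<N}))"
    unfolding char_def emp_measure_def by (rule integral_distr) auto
  also have "\<dots> = (\<Sum>a<N. (1 / real N) *\<^sub>R iexp (t * s a))"
  proof (subst integral_measure_pmf[where A="{..<N}"])
    have ne: "{..<N} \<noteq> {}" using N by auto
    show "a \<in> {..<N}" if "a \<in> set_pmf (pmf_of_set {..<N})" for a
      using that ne by (simp add: set_pmf_of_set)
    show "(\<Sum>a<N. pmf (pmf_of_set {..<N}) a *\<^sub>R iexp (t * s a)) = (\<Sum>a<N. (1 / real N) *\<^sub>R iexp (t * s a))"
      using ne by (intro sum.cong refl) (simp add: pmf_of_set)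
  qed simp
  also have "\<dots> = emp_char N s t"
    by (simp add: emp_char_def sum_divide_distrib scaleR_conv_of_real)
  finally show ?thesis .
qed

text \<open>The even order makes the absolute remainder \<open>\<bar>t * s a\<bar> ^ (2*h)\<close> a
  plain power, so that it sums to an ordinary moment.\<close>

lemma emp_char_Taylor:
  assumes N: "N > 0" and h: "h > 0"
  shows "cmod (emp_char N s t - (\<Sum>k<2*h. (\<i> * t) ^ k / fact k * of_real (emp_moment N s k)))
     \<le> \<bar>t\<bar> ^ (2*h) / fact (2*h) * emp_moment N s (2*h)"
proof -
  have ind: "{..<2*h} = {..2*h-1}" and S: "Suc (2*h-1) = 2*h" using h by auto
  have eq: "(\<Sum>k<2*h. (\<i> * t) ^ k / fact k * of_real (emp_moment N s k))
     = (\<Sum>a<N. \<Sum>k<2*h. (\<i> * (t * s a)) ^ k / fact k) / of_nat N"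
  proof -
    have "(\<Sum>a<N. \<Sum>k<2*h. (\<i> * (t * s a)) ^ k / fact k) = (\<Sum>k<2*h. \<Sum>a<N. (\<i> * (t * s a)) ^ k / fact k)"
      by (rule sum.swap)
    also have "\<dots> = (\<Sum>k<2*h. (\<i> * t) ^ k / fact k * of_real (\<Sum>a<N. s a ^ k))"
      by (intro sum.cong refl) (simp add: sum_distrib_left power_mult_distrib mult.assoc)
    finally show ?thesis by (simp add: emp_moment_def sum_divide_distrib[where A="{..<2*h}"])
  qed
  have "cmod (emp_char N s t - (\<Sum>k<2*h. (\<i> * t) ^ k / fact k * of_real (emp_moment N s k)))
     = cmod (\<Sum>a<N. iexp (t * s a) - (\<Sum>k<2*h. (\<i> * (t * s a)) ^ k / fact k)) / N"
    unfolding eq emp_char_def by (simp add: sum_subtractf norm_divide flip: diff_divide_distrib)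
  also have "\<dots> \<le> (\<Sum>a<N. \<bar>t * s a\<bar> ^ (2*h) / fact (2*h)) / N"
  proof (intro divide_right_mono sum_norm_le)
    fix a
    show "cmod (iexp (t * s a) - (\<Sum>k<2*h. (\<i> * (t * s a)) ^ k / fact k)) \<le> \<bar>t * s a\<bar> ^ (2*h) / fact (2*h)"
      using iexp_approx1[of "t * s a" "2*h-1", unfolded S] unfolding ind by simp
  qed simp
  also have "\<dots> = \<bar>t\<bar> ^ (2*h) / fact (2*h) * emp_moment N s (2*h)"
    by (simp add: emp_moment_def abs_mult power_mult_distrib sum_distrib_left sum_divide_distrib power_even_abs)
  finally show ?thesis .
qed

lemma fact_add_ge: "fact h * h ^ m \<le> (fact (h + m) :: nat)"
proof (induction m)
  case (Suc m)
  have "fact h * h ^ Suc m = h * (fact h * h ^ m)" by simp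
  also have "\<dots> \<le> Suc (h + m) * fact (h + m)" by (intro mult_mono Suc) auto
  finally show ?case by simp
qed simp

text \<open>\<open>(2*h)! \<ge> h! * h ^ h\<close> cancels the factor \<open>h ^ h\<close> in
  \<open>4 ^ h * (2*h) ^ h = 8 ^ h * h ^ h\<close> and leaves the terms of the series of
  \<open>exp (8 * t\<^sup>2)\<close>.\<close>

lemma Taylor_bound_tendsto_0:
  "(\<lambda>h. \<bar>t\<bar> ^ (2*h) / fact (2*h) * (4 ^ h * real (2*h) ^ h)) \<longlonglongrightarrow> 0"
proof (rule tendsto_sandwich[where f="\<lambda>_. 0" and h="\<lambda>h. (8 * t\<^sup>2) ^ h /\<^sub>R fact h"])
  show "(\<lambda>h. (8 * t\<^sup>2) ^ h /\<^sub>R fact h) \<longlonglongrightarrow> 0"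
    by (rule summable_LIMSEQ_zero[OF summable_exp_generic])
  show "eventually (\<lambda>h. \<bar>t\<bar> ^ (2*h) / fact (2*h) * (4 ^ h * real (2*h) ^ h) \<le> (8 * t\<^sup>2) ^ h /\<^sub>R fact h) sequentially"
  proof (intro always_eventually allI)
    fix h
    show "\<bar>t\<bar> ^ (2*h) / fact (2*h) * (4 ^ h * real (2*h) ^ h) \<le> (8 * t\<^sup>2) ^ h /\<^sub>R fact h"
    proof (cases "h = 0")
      case False
      have "real (fact h * h ^ h) \<le> real (fact (h + h))" by (rule of_nat_mono, rule fact_add_ge)
      then have f: "fact h * real h ^ h \<le> (fact (2*h) :: real)" by (simp add: mult_2)
      have "\<bar>t\<bar> ^ (2*h) / fact (2*h) * (4 ^ h * real (2*h) ^ h) \<le> \<bar>t\<bar> ^ (2*h) / (fact h * real h ^ h) * (4 ^ h * real (2*h) ^ h)"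
        using False f by (intro mult_right_mono divide_left_mono mult_pos_pos) auto
      also have "\<dots> = (8 * t\<^sup>2) ^ h /\<^sub>R fact h"
      proof -
        have cancel: "X / (F * H) * (E * H) = E * X / F" if "H \<noteq> 0" for X F E H :: real using that by simp
        have 1: "\<bar>t\<bar> ^ (2*h) = (t\<^sup>2) ^ h" by (simp add: power_mult)
        have "(4::real) ^ h * real (2*h) ^ h = (4 * real (2*h)) ^ h" by (rule power_mult_distrib[symmetric])
        also have "4 * real (2*h) = 8 * real h" by simp
        finally have 2: "4 ^ h * real (2*h) ^ h = 8 ^ h * real h ^ h" by (simp only: power_mult_distrib)
        have "real h ^ h \<noteq> 0" using False by simp
        from cancel[OF this] show ?thesis unfolding 1 2
          by (simp only: power_mult_distrib real_scaleR_def divide_inverse) (rule mult.commute)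
      qed
      finally show ?thesis .
    qed simp
  qed
qed auto

definition moments_tendsto :: "(nat \<Rightarrow> nat) \<Rightarrow> (nat \<Rightarrow> nat \<Rightarrow> real) \<Rightarrow> (nat \<Rightarrow> real) \<Rightarrow> bool" where
  "moments_tendsto N s m \<longleftrightarrow> (\<forall>k>0. (\<lambda>n. emp_moment (N n) (s n) k) \<longlonglongrightarrow> m k) \<and> (\<forall>n. N n > 0)"

text \<open>The order \<open>2*h\<close> is fixed first, making the limit of each Taylor remainder
  smaller than \<open>e / 4\<close>. For that order the two Taylor polynomials have the same limit
  coefficients, so their difference vanishes as \<open>n\<close> grows.\<close>

lemma emp_char_diff_tendsto_0:
  assumes 1: "moments_tendsto N s m" and 2: "moments_tendsto N' s' m"
    and m: "\<And>h. h > 0 \<Longrightarrow> m (2*h) \<le> 4 ^ h * real (2*h) ^ h"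
  shows "(\<lambda>n. emp_char (N n) (s n) t - emp_char (N' n) (s' n) t) \<longlonglongrightarrow> 0"
proof (rule LIMSEQ_I)
  fix e :: real assume e: "e > 0"
  have "eventually (\<lambda>h. \<bar>t\<bar> ^ (2*h) / fact (2*h) * (4 ^ h * real (2*h) ^ h) < e / 4) sequentially"
    using Taylor_bound_tendsto_0[of t] e by (intro order_tendstoD(2)) auto
  moreover have "eventually (\<lambda>h::nat. h > 0) sequentially" by (rule eventually_gt_at_top)
  ultimately obtain h where h: "h > 0" "\<bar>t\<bar> ^ (2*h) / fact (2*h) * (4 ^ h * real (2*h) ^ h) < e / 4"
    by (metis (mono_tags, lifting) eventually_conj eventually_sequentially order_refl)
  define c where "c = \<bar>t\<bar> ^ (2*h) / fact (2*h)"
  define P where "P N s = (\<Sum>k<2*h. (\<i> * t) ^ k / fact k * complex_of_real (emp_moment N s k))" for N s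
  \<comment> \<open>\<open>moments_tendsto\<close> leaves \<open>m 0\<close> unconstrained, but the
    zeroth empirical moment is 1.\<close>
  define m' where "m' k = (if k = 0 then 1 else m k)" for k
  have lim: "(\<lambda>n. emp_moment (N n) (s n) k) \<longlonglongrightarrow> m' k" if "moments_tendsto N s m" for N s k
  proof (cases "k = 0")
    case True
    then have "emp_moment (N n) (s n) k = 1" for n
      using that by (simp add: moments_tendsto_def emp_moment_def)
    then show ?thesis using True by (simp add: m'_def)
  qed (use that in \<open>simp add: moments_tendsto_def m'_def\<close>)
  have "(\<lambda>n. P (N n) (s n) - P (N' n) (s' n)) \<longlonglongrightarrow>
      (\<Sum>k<2*h. (\<i> * t) ^ k / fact k * complex_of_real (m' k)) - (\<Sum>k<2*h. (\<i> * t) ^ k / fact k * complex_of_real (m' k))"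
    unfolding P_def by (intro tendsto_diff tendsto_sum tendsto_mult tendsto_const tendsto_of_real lim 1 2)
  then have "(\<lambda>n. cmod (P (N n) (s n) - P (N' n) (s' n))) \<longlonglongrightarrow> 0" by (simp add: tendsto_norm_zero)
  moreover have "(\<lambda>n. c * emp_moment (N n) (s n) (2*h)) \<longlonglongrightarrow> c * m (2*h)"
    "(\<lambda>n. c * emp_moment (N' n) (s' n) (2*h)) \<longlonglongrightarrow> c * m (2*h)"
    using lim[OF 1, of "2*h"] lim[OF 2, of "2*h"] h(1) by (auto intro!: tendsto_mult simp: m'_def)
  ultimately have "(\<lambda>n. cmod (P (N n) (s n) - P (N' n) (s' n)) + c * emp_moment (N n) (s n) (2*h)
      + c * emp_moment (N' n) (s' n) (2*h)) \<longlonglongrightarrow> 0 + c * m (2*h) + c * m (2*h)"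
    by (intro tendsto_add)
  moreover have "0 + c * m (2*h) + c * m (2*h) < e"
  proof -
    have "c * m (2*h) \<le> c * (4 ^ h * real (2*h) ^ h)" by (intro mult_left_mono m h) (simp add: c_def)
    then show ?thesis using h(2) e unfolding c_def by linarith
  qed
  ultimately have "eventually (\<lambda>n. cmod (P (N n) (s n) - P (N' n) (s' n)) + c * emp_moment (N n) (s n) (2*h)
      + c * emp_moment (N' n) (s' n) (2*h) < e) sequentially" by (rule order_tendstoD(2))
  then have "eventually (\<lambda>n. cmod (emp_char (N n) (s n) t - emp_char (N' n) (s' n) t) < e) sequentially"
  proof eventually_elim
    case (elim n)
    have pos: "N n > 0" "N' n > 0" using 1 2 by (auto simp: moments_tendsto_def)
    have "emp_char (N n) (s n) t - emp_char (N' n) (s' n) t = (emp_char (N n) (s n) t - P (N n) (s n))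
       + ((P (N n) (s n) - P (N' n) (s' n)) - (emp_char (N' n) (s' n) t - P (N' n) (s' n)))" by simp
    then have "cmod (emp_char (N n) (s n) t - emp_char (N' n) (s' n) t) \<le> cmod (emp_char (N n) (s n) t - P (N n) (s n))
       + (cmod (P (N n) (s n) - P (N' n) (s' n)) + cmod (emp_char (N' n) (s' n) t - P (N' n) (s' n)))"
      by (simp only:) (intro order_trans[OF norm_triangle_ineq] add_left_mono norm_triangle_ineq4)
    also have "cmod (emp_char (N n) (s n) t - P (N n) (s n)) \<le> c * emp_moment (N n) (s n) (2*h)"
      unfolding P_def c_def by (rule emp_char_Taylor[OF pos(1) h(1)])
    also have "cmod (emp_char (N' n) (s' n) t - P (N' n) (s' n)) \<le> c * emp_moment (N' n) (s' n) (2*h)"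
      unfolding P_def c_def by (rule emp_char_Taylor[OF pos(2) h(1)])
    finally show ?case using elim by simp
  qed
  then show "\<exists>n0. \<forall>n\<ge>n0. cmod (emp_char (N n) (s n) t - emp_char (N' n) (s' n) t - 0) < e"
    by (simp add: eventually_sequentially)
qed

lemma tight_emp_measure:
  assumes "moments_tendsto N s m"
  shows "tight (\<lambda>n. emp_measure (N n) (s n))"
  unfolding tight_def
proof (intro conjI allI impI real_distribution_emp_measure)
  fix e :: real assume e: "e > 0"
  have N: "N n > 0" for n using assms by (simp add: moments_tendsto_def)
  have "Bseq (\<lambda>n. emp_moment (N n) (s n) 2)"
    using assms by (intro convergent_imp_Bseq convergentI[where L="m 2"]) (auto simp: moments_tendsto_def)
  then obtain K where K: "K > 0" "\<And>n. \<bar>emp_moment (N n) (s n) 2\<bar> \<le> K" by (auto simp: Bseq_def)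
  \<comment> \<open>Chebyshev with second moments bounded by \<open>K\<close>: at most the fraction
    \<open>K / R\<^sup>2 = e / 2\<close> lies outside, which leaves room for the strict
    inequality.\<close>
  define R where "R = sqrt (2 * K / e)"
  have R: "R > 0" "R\<^sup>2 = 2 * K / e" using K e by (auto simp: R_def)
  have "measure (emp_measure (N n) (s n)) {-R<..R} > 1 - e" for n
  proof -
    let ?B = "{a\<in>{..<N n}. s n a \<notin> {-R<..R}}" and ?A = "{a\<in>{..<N n}. s n a \<in> {-R<..R}}"
    have "R\<^sup>2 * card ?B = (\<Sum>a\<in>?B. R\<^sup>2)" by simp
    also have "\<dots> \<le> (\<Sum>a\<in>?B. (s n a)\<^sup>2)"
    proof (rule sum_mono)
      fix a assume "a \<in> ?B"
      then have "\<bar>R\<bar> \<le> \<bar>s n a\<bar>" using R by auto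
      then show "R\<^sup>2 \<le> (s n a)\<^sup>2" by (simp add: abs_le_square_iff)
    qed
    also have "\<dots> \<le> (\<Sum>a<N n. (s n a)\<^sup>2)" by (rule sum_mono2) auto
    also have "\<dots> \<le> K * N n"
      using K(2)[of n] N[of n] by (auto simp: emp_moment_def field_simps)
    finally have "card ?B * (2 * K / e) \<le> K * N n" using R by (simp add: mult.commute)
    then have B: "real (card ?B) \<le> e / 2 * N n" using K e by (simp add: field_simps)
    have "card ?A + card ?B = card (?A \<union> ?B)" by (rule card_Un_disjoint[symmetric]) auto
    also have "?A \<union> ?B = {..<N n}" by auto
    finally have "real (card ?A) + real (card ?B) = real (N n)" by (simp flip: of_nat_add)
    then have "real (card ?A) \<ge> (1 - e / 2) * N n" using B by (simp add: algebra_simps)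
    then have "card ?A / N n \<ge> 1 - e / 2" using N[of n] by (simp add: field_simps)
    then show ?thesis using e N[of n] by (subst measure_emp_measure) auto
  qed
  then show "\<exists>a b. a < b \<and> (\<forall>n. 1 - e < measure (emp_measure (N n) (s n)) {a<..b})"
    using R by (intro exI[of _ "-R"] exI[of _ R]) auto
qed

text \<open>A subsequential limit exists by tightness; every other sequence with the same moment
  limits has asymptotically the same characteristic functions.\<close>

lemma moment_limit_distribution:
  assumes mt: "moments_tendsto N s m" and m: "\<And>h. h > 0 \<Longrightarrow> m (2*h) \<le> 4 ^ h * real (2*h) ^ h"
  obtains \<mu> where "real_distribution \<mu>"
    "\<And>N' s' t. moments_tendsto N' s' m \<Longrightarrow> (\<lambda>n. emp_char (N' n) (s' n) t) \<longlonglongrightarrow> char \<mu> t"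
proof -
  have "strict_mono (id :: nat \<Rightarrow> nat)" by (simp add: strict_mono_def)
  from tight_imp_convergent_subsubsequence[OF tight_emp_measure[OF mt] this]
  obtain r \<mu> where r: "strict_mono (r :: nat \<Rightarrow> nat)" "real_distribution \<mu>"
    "weak_conv_m (\<lambda>n. emp_measure (N (r n)) (s (r n))) \<mu>" by (auto simp: comp_def)
  have N: "N n > 0" for n using mt by (simp add: moments_tendsto_def)
  have mr: "moments_tendsto (\<lambda>n. N (r n)) (\<lambda>n. s (r n)) m"
    using mt LIMSEQ_subseq_LIMSEQ[OF _ r(1)] by (auto simp: moments_tendsto_def comp_def)
  have c: "(\<lambda>n. emp_char (N (r n)) (s (r n)) t) \<longlonglongrightarrow> char \<mu> t" for t
    using levy_continuity1[OF real_distribution_emp_measure r(2,3), of t] N by (simp add: char_emp_measure)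
  have "(\<lambda>n. emp_char (N' n) (s' n) t) \<longlonglongrightarrow> char \<mu> t" if "moments_tendsto N' s' m" for N' s' t
    using tendsto_add[OF emp_char_diff_tendsto_0[OF that mr m, of t] c[of t]] by simp
  with r(2) show ?thesis by (rule that)
qed

text \<open>Levy continuity is applied to the sequence shifted by one, because a uniform
  distribution needs at least one point.\<close>

lemma weak_conv_of_char:
  assumes \<mu>: "real_distribution \<mu>" and c: "\<And>t. (\<lambda>n. emp_char n (s n) t) \<longlonglongrightarrow> char \<mu> t"
  shows "weak_conv (\<lambda>n x. card {a\<in>{..<n}. s n a \<le> x} / n) (cdf \<mu>)"
proof -
  have "weak_conv_m (\<lambda>n. emp_measure (Suc n) (s (Suc n))) \<mu>"
    using LIMSEQ_Suc[OF c]
    by (intro levy_continuity real_distribution_emp_measure \<mu>) (simp add: char_emp_measure)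
  then have "weak_conv (\<lambda>n x. card {a\<in>{..<Suc n}. s (Suc n) a \<le> x} / Suc n) (cdf \<mu>)"
    by (simp only: weak_conv_m_def weak_conv_def cdf_emp_measure[OF zero_less_Suc])
  then have *: "(\<lambda>n. card {a\<in>{..<Suc n}. s (Suc n) a \<le> x} / Suc n) \<longlonglongrightarrow> cdf \<mu> x" if "isCont (cdf \<mu>) x" for x
    using that unfolding weak_conv_def by blast
  show ?thesis unfolding weak_conv_def
  proof (intro allI impI)
    fix x assume "isCont (cdf \<mu>) x"
    from *[OF this] show "(\<lambda>n. card {a\<in>{..<n}. s n a \<le> x} / n) \<longlonglongrightarrow> cdf \<mu> x"
      by (rule LIMSEQ_imp_Suc[where f="\<lambda>n. card {a\<in>{..<n}. s n a \<le> x} / n"])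
  qed
qed

section \<open>Strong laws and truncation\<close>

context prob_space
begin

text \<open>The sum of the squares has finite expectation, hence converges almost surely, and its
  terms tend to 0.\<close>

lemma AE_tendsto_0_of_summable:
  fixes Z :: "nat \<Rightarrow> 'a \<Rightarrow> real"
  assumes int: "\<And>n. integrable M (\<lambda>\<omega>. (Z n \<omega>)\<^sup>2)"
    and sum: "summable (\<lambda>n. expectation (\<lambda>\<omega>. (Z n \<omega>)\<^sup>2))"
  shows "AE \<omega> in M. (\<lambda>n. Z n \<omega>) \<longlonglongrightarrow> 0"
proof -
  define H where "H n \<omega> = ennreal ((Z n \<omega>)\<^sup>2)" for n \<omega>
  have H [measurable]: "H n \<in> borel_measurable M" for n
    unfolding H_def by (rule measurable_compose[OF borel_measurable_integrable[OF int] measurable_ennreal])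
  have "(\<integral>\<^sup>+\<omega>. (\<Sum>n. H n \<omega>) \<partial>M) = (\<Sum>n. \<integral>\<^sup>+\<omega>. H n \<omega> \<partial>M)"
    by (rule nn_integral_suminf) measurable
  also have "\<dots> = (\<Sum>n. ennreal (expectation (\<lambda>\<omega>. (Z n \<omega>)\<^sup>2)))"
    unfolding H_def by (intro suminf_cong nn_integral_eq_integral int) auto
  also have "\<dots> = ennreal (\<Sum>n. expectation (\<lambda>\<omega>. (Z n \<omega>)\<^sup>2))"
    by (rule suminf_ennreal2[OF _ sum]) simp
  finally have "(\<integral>\<^sup>+\<omega>. (\<Sum>n. H n \<omega>) \<partial>M) \<noteq> \<infinity>" by simp
  then have "AE \<omega> in M. (\<Sum>n. H n \<omega>) \<noteq> \<infinity>"
    by (rule nn_integral_PInf_AE[rotated]) measurable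
  then show ?thesis
  proof eventually_elim
    case (elim \<omega>)
    then have "summable (\<lambda>n. (Z n \<omega>)\<^sup>2)"
      by (intro summable_suminf_not_top) (auto simp: H_def)
    then have "(\<lambda>n. (Z n \<omega>)\<^sup>2) \<longlonglongrightarrow> 0" by (rule summable_LIMSEQ_zero)
    then have "(\<lambda>n. sqrt ((Z n \<omega>)\<^sup>2)) \<longlonglongrightarrow> sqrt 0" by (rule tendsto_real_sqrt)
    then show ?case by (simp add: tendsto_rabs_zero_iff)
  qed
qed

section \<open>A strong law bound for independent variables with uniform tails\<close>

lemma variance_indep_sum_le:
  fixes X :: "'i \<Rightarrow> 'a \<Rightarrow> real"
  assumes "finite J" "indep_vars (\<lambda>_. borel) X J"
    and "\<And>t. t \<in> J \<Longrightarrow> integrable M (X t)" "\<And>t. t \<in> J \<Longrightarrow> integrable M (\<lambda>\<omega>. (X t \<omega>)\<^sup>2)"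
  shows "integrable M (\<lambda>\<omega>. (\<Sum>t\<in>J. X t \<omega> - expectation (X t))\<^sup>2) \<and>
     expectation (\<lambda>\<omega>. (\<Sum>t\<in>J. X t \<omega> - expectation (X t))\<^sup>2) \<le> (\<Sum>t\<in>J. expectation (\<lambda>\<omega>. (X t \<omega>)\<^sup>2))"
  using assms
proof (induction J)
  case (insert s J)
  define c where "c \<omega> = X s \<omega> - expectation (X s)" for \<omega>
  define S where "S \<omega> = (\<Sum>t\<in>J. X t \<omega> - expectation (X t))" for \<omega>
  have indJ: "indep_vars (\<lambda>_. borel) X J" using insert.prems(1) by (rule indep_vars_subset) auto
  have IH: "integrable M (\<lambda>\<omega>. (S \<omega>)\<^sup>2)" "expectation (\<lambda>\<omega>. (S \<omega>)\<^sup>2) \<le> (\<Sum>t\<in>J. expectation (\<lambda>\<omega>. (X t \<omega>)\<^sup>2))"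
    using insert.IH[OF indJ] insert.prems by (auto simp: S_def)
  have Xs: "integrable M (X s)" "integrable M (\<lambda>\<omega>. (X s \<omega>)\<^sup>2)" using insert.prems by auto
  have intc: "integrable M c" using Xs by (simp add: c_def[abs_def])
  have intc2: "integrable M (\<lambda>\<omega>. (c \<omega>)\<^sup>2)"
    unfolding c_def power2_diff using Xs by (intro Bochner_Integration.integrable_add Bochner_Integration.integrable_diff) auto
  have intS: "integrable M S" using insert.prems by (auto simp: S_def[abs_def])
  have Ec: "expectation c = 0" using Xs by (simp add: c_def[abs_def] prob_space)
  have Ec2: "expectation (\<lambda>\<omega>. (c \<omega>)\<^sup>2) \<le> expectation (\<lambda>\<omega>. (X s \<omega>)\<^sup>2)"
    using variance_eq[OF Xs] by (simp add: c_def)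
  have "indep_vars (\<lambda>_. borel) (\<lambda>t \<omega>. X t \<omega> - expectation (X t)) (insert s J)"
    by (rule indep_vars_compose2[OF insert.prems(1)]) measurable
  then have ind: "indep_var borel c borel S"
    using indep_vars_sum[OF insert.hyps, of "\<lambda>t \<omega>. X t \<omega> - expectation (X t)"]
    by (simp add: c_def[abs_def] S_def[abs_def])
  have cS: "expectation (\<lambda>\<omega>. c \<omega> * S \<omega>) = 0" "integrable M (\<lambda>\<omega>. c \<omega> * S \<omega>)"
    using indep_var_lebesgue_integral[OF ind intc intS] indep_var_integrable[OF ind intc intS] Ec by auto
  have sq: "(\<Sum>t\<in>insert s J. X t \<omega> - expectation (X t))\<^sup>2 = (c \<omega>)\<^sup>2 + 2 * (c \<omega> * S \<omega>) + (S \<omega>)\<^sup>2" for \<omega>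
    using insert.hyps by (simp add: c_def S_def power2_sum)
  have "expectation (\<lambda>\<omega>. (c \<omega>)\<^sup>2 + 2 * (c \<omega> * S \<omega>) + (S \<omega>)\<^sup>2)
     = expectation (\<lambda>\<omega>. (c \<omega>)\<^sup>2) + expectation (\<lambda>\<omega>. (S \<omega>)\<^sup>2)"
    using intc2 cS IH(1) by simp
  also have "\<dots> \<le> (\<Sum>t\<in>insert s J. expectation (\<lambda>\<omega>. (X t \<omega>)\<^sup>2))"
    using insert.hyps Ec2 IH(2) by simp
  finally show ?case unfolding sq using intc2 cS(2) IH(1) by simp
qed simp

text \<open>For a single nonnegative variable the sum of \<open>2 ^ m * prob {Y > 2 ^ m}\<close> is
  at most twice its expectation. One summable majorant for all \<open>t\<close> takes the place of
  identical distribution.\<close>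

definition dyadic_tails :: "'i set \<Rightarrow> ('i \<Rightarrow> 'a \<Rightarrow> real) \<Rightarrow> bool" where
  "dyadic_tails I Y \<longleftrightarrow> (\<exists>g. summable g \<and> (\<forall>t\<in>I. \<forall>m. 2 ^ m * prob {\<omega>\<in>space M. Y t \<omega> > 2 ^ m} \<le> g m))"

text \<open>For \<open>2 ^ j < y \<le> 2 ^ (j + 1)\<close> the square is at most
  \<open>4 ^ (j + 1)\<close>. After taking expectations this bounds truncated second moments by
  dyadic tails.\<close>

lemma truncated_square_bound:
  assumes "y \<ge> (0::real)"
  shows "y\<^sup>2 * of_bool (y \<le> 2 ^ m) \<le> 1 + (\<Sum>j<m. 4 ^ Suc j * of_bool (y > 2 ^ j))"
proof (induction m)
  case 0
  show ?case using assms by (auto simp: power_le_one)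
next
  case (Suc m)
  show ?case
  proof (cases "y \<le> 2 ^ m")
    case True
    then have "y \<le> 2 ^ Suc m" using assms by simp
    then show ?thesis using Suc True by simp
  next
    case False
    have "y\<^sup>2 * of_bool (y \<le> 2 ^ Suc m) \<le> (2 ^ Suc m)\<^sup>2"
    proof (cases "y \<le> 2 ^ Suc m")
      case True
      then have "y\<^sup>2 \<le> (2 ^ Suc m)\<^sup>2" using assms by (intro power_mono)
      then show ?thesis using True by simp
    qed simp
    also have "(2 ^ Suc m)\<^sup>2 = (4::real) ^ Suc m" by (simp add: power2_eq_square flip: power_mult_distrib)
    also have "\<dots> \<le> 1 + (\<Sum>j<Suc m. 4 ^ Suc j * of_bool (y > 2 ^ j))"
      using False by (simp add: sum_nonneg)
    finally show ?thesis .
  qed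
qed

text \<open>The variables are truncated at \<open>2 ^ (r * m)\<close>, the order of their number.
  The means contribute at most \<open>2 * e * 2 ^ (r * m)\<close>; the centred truncated sums,
  divided by \<open>2 ^ (r * m)\<close>, have summable variances and are eventually below
  \<open>2 * e\<close>; by Borel-Cantelli no variable is affected by the truncation for large
  \<open>m\<close>. This explains the factor 4.\<close>

lemma dyadic_sum_bound:
  fixes Y :: "'i \<Rightarrow> 'a \<Rightarrow> real" and J :: "nat \<Rightarrow> 'i set"
  assumes ind: "indep_vars (\<lambda>_. borel) Y I" and Y0: "\<And>t \<omega>. Y t \<omega> \<ge> 0"
    and int: "\<And>t. t \<in> I \<Longrightarrow> integrable M (Y t)" and E: "\<And>t. t \<in> I \<Longrightarrow> expectation (Y t) \<le> e"
    and tails: "dyadic_tails I Y" and J: "\<And>m. J m \<subseteq> I" "\<And>m. finite (J m)" "\<And>m. card (J m) \<le> 2 * 2 ^ (r * m)"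
    and r: "r > 0" and e: "e > 0"
  shows "AE \<omega> in M. eventually (\<lambda>m. (\<Sum>t\<in>J m. Y t \<omega>) \<le> 4 * e * 2 ^ (r * m)) sequentially"
proof -
  obtain g where g: "summable g" "\<And>t m. t \<in> I \<Longrightarrow> 2 ^ m * prob {\<omega>\<in>space M. Y t \<omega> > 2 ^ m} \<le> g m"
    using tails by (auto simp: dyadic_tails_def)
  show ?thesis
  proof (cases "I = {}")
    case True
    then have "J m = {}" for m using J by auto
    then show ?thesis using e by simp
  next
    case False
    then obtain t0 where t0: "t0 \<in> I" by auto
    have g0: "g m \<ge> 0" for m by (rule order_trans[OF _ g(2)[OF t0]]) simp
    have mY: "Y t \<in> borel_measurable M" if "t \<in> I" for t using int[OF that] by (rule borel_measurable_integrable)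
    define T where "T m t \<omega> = Y t \<omega> * of_bool (Y t \<omega> \<le> 2 ^ m)" for m t \<omega>
    have mT: "T m t \<in> borel_measurable M" if "t \<in> I" for t m
      unfolding T_def using mY[OF that] by measurable
    have T: "0 \<le> T m t \<omega>" "T m t \<omega> \<le> 2 ^ m" "T m t \<omega> \<le> Y t \<omega>" for m t \<omega>
      using Y0[of t \<omega>] by (auto simp: T_def)
    have intT: "integrable M (T m t)" if "t \<in> I" for t m
      using T mT[OF that] by (intro integrable_const_bound[of _ "2 ^ m"]) auto
    have intT2: "integrable M (\<lambda>\<omega>. (T m t \<omega>)\<^sup>2)" if "t \<in> I" for t m
      using T mT[OF that] by (intro integrable_const_bound[of _ "(2 ^ m)\<^sup>2"]) (auto intro!: power_mono)
    define b where "b m = 1 + 4 * (\<Sum>j<m. 2 ^ j * g j)" for m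
    have ET2: "expectation (\<lambda>\<omega>. (T m t \<omega>)\<^sup>2) \<le> b m" if t: "t \<in> I" for t m
    proof -
      have meas: "{\<omega>\<in>space M. Y t \<omega> > 2 ^ j} \<in> sets M" for j using mY[OF t] by measurable
      define B :: "nat \<Rightarrow> 'a \<Rightarrow> real" where "B j = indicator {\<omega>\<in>space M. Y t \<omega> > 2 ^ j}" for j
      have B: "integrable M (B j)" "expectation (B j) = prob {\<omega>\<in>space M. Y t \<omega> > 2 ^ j}" for j
        using meas[of j] by (simp_all add: B_def emeasure_eq_measure)
      have "expectation (\<lambda>\<omega>. (T m t \<omega>)\<^sup>2) \<le> expectation (\<lambda>\<omega>. 1 + (\<Sum>j<m. 4 ^ Suc j * B j \<omega>))"
      proof (rule integral_mono[OF intT2[OF t]])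
        show "integrable M (\<lambda>\<omega>. 1 + (\<Sum>j<m. 4 ^ Suc j * B j \<omega>))" using B(1) by simp
        fix \<omega> assume "\<omega> \<in> space M"
        then have ind: "B j \<omega> = of_bool (Y t \<omega> > 2 ^ j)" for j
          by (simp add: B_def indicator_def)
        have "(T m t \<omega>)\<^sup>2 = (Y t \<omega>)\<^sup>2 * of_bool (Y t \<omega> \<le> 2 ^ m)" by (simp add: T_def power_mult_distrib)
        then show "(T m t \<omega>)\<^sup>2 \<le> 1 + (\<Sum>j<m. 4 ^ Suc j * B j \<omega>)"
          using truncated_square_bound[OF Y0, of t \<omega> m] unfolding ind by simp
      qed
      also have "\<dots> = 1 + (\<Sum>j<m. 4 ^ Suc j * prob {\<omega>\<in>space M. Y t \<omega> > 2 ^ j})"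
        using B by (simp add: prob_space)
      also have "(\<Sum>j<m. 4 ^ Suc j * prob {\<omega>\<in>space M. Y t \<omega> > 2 ^ j})
         = (\<Sum>j<m. 4 * 2 ^ j * (2 ^ j * prob {\<omega>\<in>space M. Y t \<omega> > 2 ^ j}))"
        by (intro sum.cong refl) (simp flip: power_mult_distrib)
      also have "\<dots> \<le> (\<Sum>j<m. 4 * 2 ^ j * g j)" by (intro sum_mono mult_left_mono g t) auto
      finally show ?thesis by (simp add: b_def sum_distrib_left mult.assoc)
    qed
    \<comment> \<open>Up to a geometric series this is the Cauchy product of \<open>g\<close> with
      the powers of \<open>1/2\<close>. The term \<open>k = 0\<close> of the latter is removed
      because the sum in \<open>b\<close> stops before \<open>m\<close>.\<close>
    have sumb: "summable (\<lambda>m. b m / 2 ^ m)"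
    proof -
      have geo: "summable (\<lambda>k. (1/2) ^ k :: real)" by (rule summable_geometric) simp
      have geo': "summable (\<lambda>k. (if k = 0 then 0 else (1/2) ^ k) :: real)"
        by (rule summable_comparison_test'[OF geo, of 0]) auto
      have "summable (\<lambda>m. \<Sum>j\<le>m. g j * (if m - j = 0 then 0 else (1/2) ^ (m - j)))"
        by (rule summable_Cauchy_product) (use g(1) g0 geo' in auto)
      moreover have "(\<Sum>j\<le>m. g j * (if m - j = 0 then 0 else (1/2) ^ (m - j))) = (\<Sum>j<m. 2 ^ j * g j) / 2 ^ m" for m
      proof -
        have "(\<Sum>j\<le>m. g j * (if m - j = 0 then 0 else (1/2) ^ (m - j))) = (\<Sum>j<m. g j * (1/2) ^ (m - j))"
          by (simp add: lessThan_Suc_atMost[symmetric])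
        also have "\<dots> = (\<Sum>j<m. 2 ^ j * g j / 2 ^ m)"
          by (intro sum.cong refl) (simp add: power_diff field_simps)
        finally show ?thesis by (simp add: sum_divide_distrib)
      qed
      ultimately have "summable (\<lambda>m. (1/2) ^ m + 4 * ((\<Sum>j<m. 2 ^ j * g j) / 2 ^ m))"
        by (intro summable_add geo summable_mult) simp
      then show ?thesis by (simp add: b_def add_divide_distrib power_one_over)
    qed
    have cJ: "real (card (J m)) \<le> 2 * 2 ^ (r * m)" for m
      using of_nat_mono[OF J(3)[of m], where 'a=real] by simp
    have injr: "inj (\<lambda>m. r * m)" using r by (simp add: inj_on_def)
    have sumbr: "summable (\<lambda>m. b (r * m) / 2 ^ (r * m))"
      using summable_reindex[OF sumb injr] g0 by (simp add: comp_def b_def sum_nonneg)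
    have sumgr: "summable (\<lambda>m. g (r * m))"
      using summable_reindex[OF g(1) injr] g0 by (simp add: comp_def)
    define D where "D m \<omega> = (\<Sum>t\<in>J m. T (r * m) t \<omega> - expectation (T (r * m) t)) / 2 ^ (r * m)" for m \<omega>
    have D2: "integrable M (\<lambda>\<omega>. (D m \<omega>)\<^sup>2) \<and> expectation (\<lambda>\<omega>. (D m \<omega>)\<^sup>2) \<le> 2 * (b (r * m) / 2 ^ (r * m))" for m
    proof -
      let ?X = "T (r * m)"
      have "indep_vars (\<lambda>_. borel) Y (J m)" using ind J(1) by (rule indep_vars_subset)
      then have "indep_vars (\<lambda>_. borel) ?X (J m)"
        unfolding T_def[abs_def] by (rule indep_vars_compose2[where Y="\<lambda>t y. y * of_bool (y \<le> 2 ^ (r * m))"]) measurable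
      then have v: "integrable M (\<lambda>\<omega>. (\<Sum>t\<in>J m. ?X t \<omega> - expectation (?X t))\<^sup>2)"
        "expectation (\<lambda>\<omega>. (\<Sum>t\<in>J m. ?X t \<omega> - expectation (?X t))\<^sup>2) \<le> (\<Sum>t\<in>J m. expectation (\<lambda>\<omega>. (?X t \<omega>)\<^sup>2))"
        using variance_indep_sum_le[OF J(2), of ?X m] intT intT2 J(1) by blast+
      have "(\<Sum>t\<in>J m. expectation (\<lambda>\<omega>. (?X t \<omega>)\<^sup>2)) \<le> (\<Sum>t\<in>J m. b (r * m))"
        by (intro sum_mono ET2) (use J in auto)
      also have "\<dots> \<le> (2 * 2 ^ (r * m)) * b (r * m)"
      proof -
        have "real (card (J m)) \<le> 2 * 2 ^ (r * m)" by (rule cJ)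
        then show ?thesis using g0 by (simp add: b_def sum_nonneg mult_right_mono)
      qed
      finally have v2: "expectation (\<lambda>\<omega>. (\<Sum>t\<in>J m. ?X t \<omega> - expectation (?X t))\<^sup>2) \<le> (2 * 2 ^ (r * m)) * b (r * m)"
        using v(2) by simp
      have "expectation (\<lambda>\<omega>. (D m \<omega>)\<^sup>2) = expectation (\<lambda>\<omega>. (\<Sum>t\<in>J m. ?X t \<omega> - expectation (?X t))\<^sup>2) / (2 ^ (r * m))\<^sup>2"
        by (simp add: D_def power_divide)
      also have "\<dots> \<le> (2 * 2 ^ (r * m)) * b (r * m) / (2 ^ (r * m))\<^sup>2"
        by (intro divide_right_mono v2) simp
      also have "\<dots> = 2 * (b (r * m) / 2 ^ (r * m))" by (simp add: power2_eq_square)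
      finally show ?thesis using v(1) by (simp add: D_def power_divide)
    qed
    have "summable (\<lambda>m. expectation (\<lambda>\<omega>. (D m \<omega>)\<^sup>2))"
      by (rule summable_comparison_test'[OF summable_mult[OF sumbr, of 2], of 0]) (use D2 in auto)
    then have AED: "AE \<omega> in M. (\<lambda>m. D m \<omega>) \<longlonglongrightarrow> 0"
      using D2 by (intro AE_tendsto_0_of_summable) auto
    \<comment> \<open>The event that some variable of the block exceeds the truncation level;
      outside it the sum equals its truncated version.\<close>
    define B where "B m = (\<Union>t\<in>J m. {\<omega>\<in>space M. Y t \<omega> > 2 ^ (r * m)})" for m
    have measB: "{\<omega>\<in>space M. Y t \<omega> > 2 ^ (r * m)} \<in> sets M" if "t \<in> J m" for t m
      using mY[OF subsetD[OF J(1) that]] by measurable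
    have BM: "B m \<in> sets M" for m unfolding B_def using J(2) measB by (intro sets.finite_UN) auto
    have PB: "prob (B m) \<le> 2 * g (r * m)" for m
    proof -
      have "prob (B m) \<le> (\<Sum>t\<in>J m. prob {\<omega>\<in>space M. Y t \<omega> > 2 ^ (r * m)})"
        unfolding B_def using J(2) measB by (intro finite_measure_subadditive_finite) auto
      also have "\<dots> \<le> (\<Sum>t\<in>J m. g (r * m) / 2 ^ (r * m))"
        using g(2)[of _ "r * m"] J(1)[of m] by (intro sum_mono) (auto simp: field_simps)
      also have "\<dots> = card (J m) * (g (r * m) / 2 ^ (r * m))" by simp
      also have "\<dots> \<le> (2 * 2 ^ (r * m)) * (g (r * m) / 2 ^ (r * m))"
      proof -
        have "real (card (J m)) \<le> 2 * 2 ^ (r * m)" by (rule cJ)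
        then show ?thesis using g0 by (intro mult_right_mono) auto
      qed
      finally show ?thesis by simp
    qed
    have "summable (\<lambda>m. prob (B m))"
      by (rule summable_comparison_test'[OF summable_mult[OF sumgr, of 2], of 0]) (use PB in auto)
    then have AEB: "AE \<omega> in M. eventually (\<lambda>m. \<omega> \<in> space M - B m) sequentially"
      using BM by (intro borel_cantelli_AE1) (auto simp: emeasure_eq_measure)
    show ?thesis using AED AEB
    proof eventually_elim
      case (elim \<omega>)
      have "eventually (\<lambda>m. D m \<omega> < 2 * e) sequentially"
        using elim(1) e by (intro order_tendstoD(2)) auto
      then show ?case using elim(2)
      proof eventually_elim
        case (elim m)
        have "(\<Sum>t\<in>J m. Y t \<omega>) = (\<Sum>t\<in>J m. T (r * m) t \<omega>)"
          using elim(2) by (intro sum.cong refl) (auto simp: T_def B_def)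
        also have "\<dots> = D m \<omega> * 2 ^ (r * m) + (\<Sum>t\<in>J m. expectation (T (r * m) t))"
          by (simp add: D_def sum_subtractf)
        also have "(\<Sum>t\<in>J m. expectation (T (r * m) t)) \<le> (\<Sum>t\<in>J m. e)"
        proof (rule sum_mono)
          fix t assume "t \<in> J m"
          then have t: "t \<in> I" using J by auto
          have "expectation (T (r * m) t) \<le> expectation (Y t)" by (intro integral_mono intT int t T)
          then show "expectation (T (r * m) t) \<le> e" using E[OF t] by simp
        qed
        also have "(\<Sum>t\<in>J m. e) \<le> (2 * 2 ^ (r * m)) * e"
        proof -
          have "real (card (J m)) \<le> 2 * 2 ^ (r * m)" by (rule cJ)
          then show ?thesis using e by simp
        qed
        also have "D m \<omega> * 2 ^ (r * m) \<le> (2 * e) * 2 ^ (r * m)" using elim(1) by (intro mult_right_mono) auto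
        finally show ?case by (simp add: algebra_simps)
      qed
    qed
  qed
qed

text \<open>The sets increase and the terms are nonnegative, so \<open>n\<close> is compared with
  the least power of two above it. That power is at most \<open>2 * n\<close>, which is where
  \<open>(2 * real n) ^ r\<close> comes from.\<close>

lemma polynomial_sum_bound:
  fixes Y :: "'i \<Rightarrow> 'a \<Rightarrow> real" and J :: "nat \<Rightarrow> 'i set"
  assumes ind: "indep_vars (\<lambda>_. borel) Y I" and Y0: "\<And>t \<omega>. Y t \<omega> \<ge> 0"
    and int: "\<And>t. t \<in> I \<Longrightarrow> integrable M (Y t)" and E: "\<And>t. t \<in> I \<Longrightarrow> expectation (Y t) \<le> e"
    and tails: "dyadic_tails I Y" and J: "\<And>n. J n \<subseteq> I" "\<And>n. finite (J n)" "\<And>n. card (J n) \<le> 2 * n ^ r"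
    and mono: "\<And>n n'. n \<le> n' \<Longrightarrow> J n \<subseteq> J n'" and r: "r > 0" and e: "e > 0"
  shows "AE \<omega> in M. eventually (\<lambda>n. (\<Sum>t\<in>J n. Y t \<omega>) \<le> 4 * e * (2 * real n) ^ r) sequentially"
proof -
  have "card (J (2 ^ m)) \<le> 2 * 2 ^ (r * m)" for m
    using J(3)[of "2 ^ m"] by (simp add: power_mult[symmetric] mult.commute)
  then have "AE \<omega> in M. eventually (\<lambda>m. (\<Sum>t\<in>J (2 ^ m). Y t \<omega>) \<le> 4 * e * 2 ^ (r * m)) sequentially"
    using J by (intro dyadic_sum_bound[OF ind Y0 int E tails _ _ _ r e]) auto
  then show ?thesis
  proof eventually_elim
    case (elim \<omega>)
    then obtain m0 where m0: "\<And>m. m \<ge> m0 \<Longrightarrow> (\<Sum>t\<in>J (2 ^ m). Y t \<omega>) \<le> 4 * e * 2 ^ (r * m)"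
      by (auto simp: eventually_sequentially)
    show ?case
    proof (rule eventually_sequentiallyI[of "2 ^ Suc m0"])
      fix n :: nat assume n: "2 ^ Suc m0 \<le> n"
      define m where "m = (LEAST m. n \<le> 2 ^ m)"
      have ex: "n \<le> 2 ^ n" by (simp add: less_imp_le)
      have m: "n \<le> 2 ^ m" unfolding m_def by (rule LeastI[of "\<lambda>m. n \<le> 2 ^ m", OF ex])
      have "(2::nat) ^ Suc m0 \<le> 2 ^ m" using n m by (rule order_trans)
      then have mm0: "m0 < m" using power_le_imp_le_exp[of "2::nat" "Suc m0" m] by simp
      then have "\<not> n \<le> 2 ^ (m - 1)" unfolding m_def by (intro not_less_Least) auto
      then have "2 ^ m \<le> 2 * n" using mm0 by (cases m) auto
      then have 2: "2 ^ m \<le> 2 * real n" by (metis of_nat_le_iff of_nat_mult of_nat_numeral of_nat_power)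
      have "(\<Sum>t\<in>J n. Y t \<omega>) \<le> (\<Sum>t\<in>J (2 ^ m). Y t \<omega>)"
        by (rule sum_mono2[OF J(2) mono[OF m]]) (rule Y0)
      also have "\<dots> \<le> 4 * e * (2 ^ m) ^ r" using m0[of m] mm0 by (simp add: power_mult[symmetric] mult.commute)
      also have "\<dots> \<le> 4 * e * (2 * real n) ^ r" using 2 e by (intro mult_left_mono power_mono) auto
      finally show "(\<Sum>t\<in>J n. Y t \<omega>) \<le> 4 * e * (2 * real n) ^ r" .
    qed
  qed
qed

section \<open>Truncation and standardization\<close>

lemma expectation_power2_le:
  fixes X :: "'a \<Rightarrow> real"
  assumes "integrable M X" "integrable M (\<lambda>\<omega>. (X \<omega>)\<^sup>2)"
  shows "(expectation X)\<^sup>2 \<le> expectation (\<lambda>\<omega>. (X \<omega>)\<^sup>2)"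
  using variance_positive[of X] variance_eq[OF assms] by simp

text \<open>Since \<open>E (x z) = (1 - \<tau>) / \<sigma>\<close> for \<open>z = (x 1{\<bar>x\<bar> \<le> C} - \<mu>) / \<sigma>\<close> with
  \<open>\<tau> = E (x\<^sup>2 1{\<bar>x\<bar> > C})\<close>, the error \<open>E (x - z)\<^sup>2 = 2 - 2 (1 - \<tau>) / \<sigma>\<close> is at most \<open>2 \<tau>\<close>.\<close>

lemma truncated_standardization_single:
  fixes x :: "'a \<Rightarrow> real"
  assumes x: "integrable M x" "integrable M (\<lambda>\<omega>. (x \<omega>)\<^sup>2)" "expectation x = 0" "expectation (\<lambda>\<omega>. (x \<omega>)\<^sup>2) = 1"
    and C: "C \<ge> 1" and \<tau>: "expectation (\<lambda>\<omega>. (x \<omega>)\<^sup>2 * of_bool (\<bar>x \<omega>\<bar> > C)) \<le> \<delta>" and \<delta>: "\<delta> \<le> 1 / 4"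
  shows "\<exists>\<mu> \<sigma>. \<sigma> > 0 \<and> (\<forall>y. \<bar>(y * of_bool (\<bar>y\<bar> \<le> C) - \<mu>) / \<sigma>\<bar> \<le> 4 * C) \<and>
    expectation (\<lambda>\<omega>. (x \<omega> * of_bool (\<bar>x \<omega>\<bar> \<le> C) - \<mu>) / \<sigma>) = 0 \<and>
    expectation (\<lambda>\<omega>. ((x \<omega> * of_bool (\<bar>x \<omega>\<bar> \<le> C) - \<mu>) / \<sigma>)\<^sup>2) = 1 \<and>
    integrable M (\<lambda>\<omega>. (x \<omega> - (x \<omega> * of_bool (\<bar>x \<omega>\<bar> \<le> C) - \<mu>) / \<sigma>)\<^sup>2) \<and>
    expectation (\<lambda>\<omega>. (x \<omega> - (x \<omega> * of_bool (\<bar>x \<omega>\<bar> \<le> C) - \<mu>) / \<sigma>)\<^sup>2) \<le> 2 * \<delta>"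
proof -
  define w where "w \<omega> = x \<omega> * of_bool (\<bar>x \<omega>\<bar> \<le> C)" for \<omega>
  define v where "v \<omega> = x \<omega> * of_bool (\<bar>x \<omega>\<bar> > C)" for \<omega>
  have mx [measurable]: "x \<in> borel_measurable M" using x(1) by (rule borel_measurable_integrable)
  have mw [measurable]: "w \<in> borel_measurable M" unfolding w_def by measurable
  have mv [measurable]: "v \<in> borel_measurable M" unfolding v_def by measurable
  have bw: "\<bar>w \<omega>\<bar> \<le> C" for \<omega> using C by (simp add: w_def)
  have iw: "integrable M w" using bw mw by (intro integrable_const_bound[of _ C]) auto
  have iw2: "integrable M (\<lambda>\<omega>. (w \<omega>)\<^sup>2)"
  proof (rule integrable_const_bound[of _ "C\<^sup>2"])
    show "AE \<omega> in M. norm ((w \<omega>)\<^sup>2) \<le> C\<^sup>2"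
      using bw C by (intro AE_I2) (simp add: abs_le_square_iff[symmetric])
  qed measurable
  have v: "v \<omega> = x \<omega> - w \<omega>" for \<omega> by (simp add: v_def w_def)
  have v2: "(v \<omega>)\<^sup>2 = (x \<omega>)\<^sup>2 - (w \<omega>)\<^sup>2" for \<omega> by (simp add: v_def w_def)
  have xw: "x \<omega> * w \<omega> = (w \<omega>)\<^sup>2" for \<omega> by (simp add: w_def power2_eq_square)
  have iv: "integrable M v" unfolding v using x(1) iw by (rule Bochner_Integration.integrable_diff)
  have iv2: "integrable M (\<lambda>\<omega>. (v \<omega>)\<^sup>2)" unfolding v2 using x(2) iw2 by (rule Bochner_Integration.integrable_diff)
  define \<mu> where "\<mu> = expectation w"
  define \<rho> where "\<rho> = expectation (\<lambda>\<omega>. (w \<omega>)\<^sup>2)"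
  have Ev2: "expectation (\<lambda>\<omega>. (v \<omega>)\<^sup>2) = 1 - \<rho>" unfolding v2 \<rho>_def using x iw2 by simp
  have "expectation (\<lambda>\<omega>. (v \<omega>)\<^sup>2) = expectation (\<lambda>\<omega>. (x \<omega>)\<^sup>2 * of_bool (\<bar>x \<omega>\<bar> > C))"
    by (intro Bochner_Integration.integral_cong refl) (simp add: v_def power_mult_distrib)
  then have \<rho>: "1 - \<rho> \<le> \<delta>" using \<tau> Ev2 by simp
  have "0 \<le> expectation (\<lambda>\<omega>. (v \<omega>)\<^sup>2)" by simp
  then have \<rho>1: "\<rho> \<le> 1" using Ev2 by simp
  \<comment> \<open>\<open>x\<close> has mean 0, so truncation shifts the mean by that of the tail
    \<open>v\<close>, whose square is at most \<open>1 - \<rho> \<le> \<delta>\<close>. With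
    \<open>\<delta> \<le> 1 / 4\<close> the variance of the truncated variable stays at least
    \<open>1 / 2\<close>.\<close>
  have "expectation v = - \<mu>" unfolding v \<mu>_def using x iw by simp
  then have \<mu>2: "\<mu>\<^sup>2 \<le> 1 - \<rho>" using expectation_power2_le[OF iv iv2] Ev2 by simp
  define \<sigma> where "\<sigma> = sqrt (\<rho> - \<mu>\<^sup>2)"
  have s2: "1 / 2 \<le> \<rho> - \<mu>\<^sup>2" "\<rho> - \<mu>\<^sup>2 \<le> 1" using \<mu>2 \<rho> \<rho>1 \<delta> zero_le_power2[of \<mu>] by linarith+
  have sq: "\<sigma>\<^sup>2 = \<rho> - \<mu>\<^sup>2" using s2 by (simp add: \<sigma>_def)
  have \<sigma>: "\<sigma> > 0" "\<sigma> \<le> 1" "1 / 2 \<le> \<sigma>"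
  proof -
    show "\<sigma> > 0" "\<sigma> \<le> 1" using s2 by (auto simp: \<sigma>_def)
    show "1 / 2 \<le> \<sigma>" unfolding \<sigma>_def using s2 by (intro real_le_rsqrt) (simp add: power2_eq_square)
  qed
  define z where "z \<omega> = (w \<omega> - \<mu>) / \<sigma>" for \<omega>
  have \<mu>b: "\<bar>\<mu>\<bar> \<le> 1"
  proof -
    have "\<mu>\<^sup>2 \<le> 1\<^sup>2" using \<mu>2 \<rho> \<delta> by simp
    then show ?thesis using abs_le_square_iff[of \<mu> 1] by simp
  qed
  \<comment> \<open>The numerator is at most \<open>C + 1 \<le> 2 * C\<close> and
    \<open>\<sigma> \<ge> 1 / 2\<close>.\<close>
  have bz: "\<bar>(y * of_bool (\<bar>y\<bar> \<le> C) - \<mu>) / \<sigma>\<bar> \<le> 4 * C" for y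
  proof -
    have "\<bar>y * of_bool (\<bar>y\<bar> \<le> C) - \<mu>\<bar> \<le> 2 * C"
      using \<mu>b C by (cases "\<bar>y\<bar> \<le> C") auto
    then have "\<bar>y * of_bool (\<bar>y\<bar> \<le> C) - \<mu>\<bar> / \<sigma> \<le> 2 * C / (1 / 2)"
      using \<sigma> C by (intro frac_le) auto
    then show ?thesis using \<sigma> by (simp add: abs_divide)
  qed
  have Ez: "expectation z = 0" unfolding z_def using iw by (simp add: \<mu>_def prob_space)
  have z2: "(z \<omega>)\<^sup>2 = ((w \<omega>)\<^sup>2 - 2 * \<mu> * w \<omega> + \<mu>\<^sup>2) / \<sigma>\<^sup>2" for \<omega>
    by (simp add: z_def power_divide power2_diff algebra_simps)
  have iz2: "integrable M (\<lambda>\<omega>. (z \<omega>)\<^sup>2)" unfolding z2 using iw iw2 by simp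
  have "expectation (\<lambda>\<omega>. (z \<omega>)\<^sup>2) = (\<rho> - 2 * \<mu> * \<mu> + \<mu>\<^sup>2) / \<sigma>\<^sup>2"
    unfolding z2 using iw iw2 by (simp add: \<rho>_def \<mu>_def prob_space)
  also have "\<rho> - 2 * \<mu> * \<mu> + \<mu>\<^sup>2 = \<sigma>\<^sup>2" unfolding sq by (simp add: power2_eq_square)
  finally have Ez2: "expectation (\<lambda>\<omega>. (z \<omega>)\<^sup>2) = 1" using \<sigma> by simp
  have d2: "(x \<omega> - z \<omega>)\<^sup>2 = (x \<omega>)\<^sup>2 - 2 * ((w \<omega>)\<^sup>2 - \<mu> * x \<omega>) / \<sigma> + (z \<omega>)\<^sup>2" for \<omega>
  proof -
    have "x \<omega> * z \<omega> = ((w \<omega>)\<^sup>2 - \<mu> * x \<omega>) / \<sigma>" unfolding xw[symmetric] z_def by (simp add: algebra_simps)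
    moreover have "(x \<omega> - z \<omega>)\<^sup>2 = (x \<omega>)\<^sup>2 - 2 * (x \<omega> * z \<omega>) + (z \<omega>)\<^sup>2" by (simp add: power2_diff)
    ultimately show ?thesis by simp
  qed
  have id2: "integrable M (\<lambda>\<omega>. (x \<omega> - z \<omega>)\<^sup>2)" unfolding d2 using x iw2 iz2 by simp
  have "expectation (\<lambda>\<omega>. (x \<omega> - z \<omega>)\<^sup>2) = 2 - 2 * \<rho> / \<sigma>"
    unfolding d2 using x iw2 iz2 by (simp add: Ez2 \<rho>_def)
  also have "\<rho> \<le> \<rho> / \<sigma>" using \<sigma> s2 \<rho> \<delta> by (simp add: field_simps)
  then have "2 - 2 * \<rho> / \<sigma> \<le> 2 * \<delta>" using \<rho> unfolding times_divide_eq_right[symmetric] by linarith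
  finally have Ed2: "expectation (\<lambda>\<omega>. (x \<omega> - z \<omega>)\<^sup>2) \<le> 2 * \<delta>" .
  show ?thesis
    using \<sigma>(1) bz Ez Ez2 id2 Ed2 unfolding z_def w_def by blast
qed

text \<open>Centring and scaling may depend on \<open>t\<close>, but \<open>z t\<close> remains a
  Borel function of \<open>x t\<close> alone, so \<open>z\<close> and the squared errors inherit
  independence. The errors also inherit dyadic tails, which makes them subject to the strong law
  bound.\<close>

lemma truncated_standardization:
  fixes x :: "'i \<Rightarrow> 'a \<Rightarrow> real"
  assumes ind: "indep_vars (\<lambda>_. borel) x I"
    and x: "\<And>t. t \<in> I \<Longrightarrow> integrable M (x t)" "\<And>t. t \<in> I \<Longrightarrow> integrable M (\<lambda>\<omega>. (x t \<omega>)\<^sup>2)"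
      "\<And>t. t \<in> I \<Longrightarrow> expectation (x t) = 0" "\<And>t. t \<in> I \<Longrightarrow> expectation (\<lambda>\<omega>. (x t \<omega>)\<^sup>2) = 1"
    and ui: "\<And>\<delta>. \<delta> > 0 \<Longrightarrow> \<exists>C\<ge>1. \<forall>t\<in>I. expectation (\<lambda>\<omega>. (x t \<omega>)\<^sup>2 * of_bool (\<bar>x t \<omega>\<bar> > C)) \<le> \<delta>"
    and tails: "dyadic_tails I (\<lambda>t \<omega>. (x t \<omega>)\<^sup>2)" and e: "e > 0"
  obtains z C where "C \<ge> 1" "indep_vars (\<lambda>_. borel) z I" "\<And>t \<omega>. t \<in> I \<Longrightarrow> \<bar>z t \<omega>\<bar> \<le> C"
    "\<And>t. t \<in> I \<Longrightarrow> expectation (z t) = 0" "\<And>t. t \<in> I \<Longrightarrow> expectation (\<lambda>\<omega>. (z t \<omega>)\<^sup>2) = 1"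
    "indep_vars (\<lambda>_. borel) (\<lambda>t \<omega>. (x t \<omega> - z t \<omega>)\<^sup>2) I"
    "\<And>t. t \<in> I \<Longrightarrow> integrable M (\<lambda>\<omega>. (x t \<omega> - z t \<omega>)\<^sup>2)"
    "\<And>t. t \<in> I \<Longrightarrow> expectation (\<lambda>\<omega>. (x t \<omega> - z t \<omega>)\<^sup>2) \<le> e"
    "dyadic_tails I (\<lambda>t \<omega>. (x t \<omega> - z t \<omega>)\<^sup>2)"
proof -
  define \<delta> where "\<delta> = min (e / 2) (1 / 4)"
  have \<delta>: "\<delta> > 0" "\<delta> \<le> 1 / 4" "2 * \<delta> \<le> e" using e by (auto simp: \<delta>_def)
  obtain C where C: "C \<ge> 1" "\<And>t. t \<in> I \<Longrightarrow> expectation (\<lambda>\<omega>. (x t \<omega>)\<^sup>2 * of_bool (\<bar>x t \<omega>\<bar> > C)) \<le> \<delta>"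
    using ui[OF \<delta>(1)] by blast
  define Q where "Q t ms \<longleftrightarrow> snd ms > 0 \<and> (\<forall>y. \<bar>(y * of_bool (\<bar>y\<bar> \<le> C) - fst ms) / snd ms\<bar> \<le> 4 * C) \<and>
    expectation (\<lambda>\<omega>. (x t \<omega> * of_bool (\<bar>x t \<omega>\<bar> \<le> C) - fst ms) / snd ms) = 0 \<and>
    expectation (\<lambda>\<omega>. ((x t \<omega> * of_bool (\<bar>x t \<omega>\<bar> \<le> C) - fst ms) / snd ms)\<^sup>2) = 1 \<and>
    integrable M (\<lambda>\<omega>. (x t \<omega> - (x t \<omega> * of_bool (\<bar>x t \<omega>\<bar> \<le> C) - fst ms) / snd ms)\<^sup>2) \<and>
    expectation (\<lambda>\<omega>. (x t \<omega> - (x t \<omega> * of_bool (\<bar>x t \<omega>\<bar> \<le> C) - fst ms) / snd ms)\<^sup>2) \<le> 2 * \<delta>" for t ms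
  have "\<exists>ms. Q t ms" if t: "t \<in> I" for t
  proof -
    obtain \<mu> \<sigma> where "Q t (\<mu>, \<sigma>)"
      using truncated_standardization_single[OF x(1)[OF t] x(2)[OF t] x(3)[OF t] x(4)[OF t] C(1) C(2)[OF t] \<delta>(2)]
      unfolding Q_def fst_conv snd_conv by blast
    then show ?thesis ..
  qed
  then obtain ms where "\<And>t. t \<in> I \<Longrightarrow> Q t (ms t)" by metis
  note ms = this[unfolded Q_def]
  define h where "h t y = (y * of_bool (\<bar>y\<bar> \<le> C) - fst (ms t)) / snd (ms t)" for t and y :: real
  have mh: "h t \<in> borel_measurable borel" for t unfolding h_def by measurable
  define z where "z t \<omega> = h t (x t \<omega>)" for t \<omega>
  note ms = ms[folded h_def, folded z_def]
  obtain g where g: "summable g" "\<And>t m. t \<in> I \<Longrightarrow> 2 ^ m * prob {\<omega>\<in>space M. (x t \<omega>)\<^sup>2 > 2 ^ m} \<le> g m"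
    using tails by (auto simp: dyadic_tails_def)
  \<comment> \<open>From this level on
    \<open>2 * z\<^sup>2 \<le> 32 * C\<^sup>2 \<le> 2 ^ l\<close>, so
    \<open>(x - z)\<^sup>2 > 4 * 2 ^ l\<close> forces \<open>x\<^sup>2 > 2 ^ l\<close>. The tail of
    the error is thus that of \<open>x\<^sup>2\<close> two levels lower, at the cost of a factor 4;
    \<open>g'\<close> uses the trivial bound on the first levels.\<close>
  obtain m1 :: nat where m1: "64 * C\<^sup>2 \<le> 2 ^ m1"
    by (metis real_arch_pow less_imp_le one_less_numeral_iff semiring_norm(76))
  define g' where "g' m = (if m < m1 + 2 then 2 ^ m else 4 * g (m - 2))" for m
  show thesis
  proof (rule that[of "4 * C" z])
    show "4 * C \<ge> 1" using C by simp
    show "indep_vars (\<lambda>_. borel) z I" unfolding z_def[abs_def] by (rule indep_vars_compose2[OF ind mh])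
    show "indep_vars (\<lambda>_. borel) (\<lambda>t \<omega>. (x t \<omega> - z t \<omega>)\<^sup>2) I"
      unfolding z_def
    proof (rule indep_vars_compose2[OF ind, of "\<lambda>t y. (y - h t y)\<^sup>2"])
      show "(\<lambda>y. (y - h t y)\<^sup>2) \<in> borel_measurable borel" for t using mh[of t] by measurable
    qed
    show "dyadic_tails I (\<lambda>t \<omega>. (x t \<omega> - z t \<omega>)\<^sup>2)"
      unfolding dyadic_tails_def
    proof (intro exI conjI ballI allI)
      have "summable (\<lambda>m. g' (m + (m1 + 2)))"
      proof -
        have "summable (\<lambda>m. g (m + m1))" using g(1) by (subst summable_iff_shift)
        then show ?thesis by (simp add: g'_def summable_mult)
      qed
      then show "summable g'" by (subst (asm) summable_iff_shift)
      fix t m assume t: "t \<in> I"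
      show "2 ^ m * prob {\<omega>\<in>space M. (x t \<omega> - z t \<omega>)\<^sup>2 > 2 ^ m} \<le> g' m"
      proof (cases "m < m1 + 2")
        case True
        then show ?thesis by (simp add: g'_def)
      next
        case False
        define l where "l = m - 2"
        have l: "m = l + 2" "l \<ge> m1" using False by (auto simp: l_def)
        have "2 ^ m1 \<le> (2::real) ^ l" using l by (intro power_increasing) auto
        then have Cl: "64 * C\<^sup>2 \<le> 2 ^ l" by (rule order_trans[OF m1])
        have mx: "x t \<in> borel_measurable M" using x(1)[OF t] by (rule borel_measurable_integrable)
        have "{\<omega>\<in>space M. (x t \<omega> - z t \<omega>)\<^sup>2 > 2 ^ m} \<subseteq> {\<omega>\<in>space M. (x t \<omega>)\<^sup>2 > 2 ^ l}"
        proof clarify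
          fix \<omega> assume gt: "2 ^ m < (x t \<omega> - z t \<omega>)\<^sup>2"
          have "\<bar>z t \<omega>\<bar> \<le> 4 * C" using ms[OF t] by (simp add: z_def)
          then have "\<bar>z t \<omega>\<bar>\<^sup>2 \<le> (4 * C)\<^sup>2" by (intro power_mono) auto
          then have "(z t \<omega>)\<^sup>2 \<le> 16 * C\<^sup>2" by (simp add: power_mult_distrib)
          then have "2 * (z t \<omega>)\<^sup>2 \<le> 2 ^ l" using Cl zero_le_power2[of C] by linarith
          moreover have "(x t \<omega> - z t \<omega>)\<^sup>2 \<le> 2 * (x t \<omega>)\<^sup>2 + 2 * (z t \<omega>)\<^sup>2"
            using sum_squares_bound[of "x t \<omega>" "- z t \<omega>"] by (simp add: power2_diff)
          moreover have "(0::real) < 2 ^ l" by simp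
          moreover have "4 * 2 ^ l < (x t \<omega> - z t \<omega>)\<^sup>2" using gt by (simp add: l(1) power_add)
          ultimately show "2 ^ l < (x t \<omega>)\<^sup>2" by linarith
        qed
        then have "prob {\<omega>\<in>space M. (x t \<omega> - z t \<omega>)\<^sup>2 > 2 ^ m} \<le> prob {\<omega>\<in>space M. (x t \<omega>)\<^sup>2 > 2 ^ l}"
          using mx by (intro finite_measure_mono) measurable
        then have "2 ^ m * prob {\<omega>\<in>space M. (x t \<omega> - z t \<omega>)\<^sup>2 > 2 ^ m} \<le> 4 * (2 ^ l * prob {\<omega>\<in>space M. (x t \<omega>)\<^sup>2 > 2 ^ l})"
          unfolding l(1) power_add by simp
        also have "\<dots> \<le> 4 * g l" using g(2)[OF t, of l] by simp
        finally show ?thesis using l by (simp add: g'_def)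
      qed
    qed
    show "\<bar>z t \<omega>\<bar> \<le> 4 * C" if "t \<in> I" for t \<omega> using ms[OF that] by (simp add: z_def)
    show "expectation (z t) = 0" "expectation (\<lambda>\<omega>. (z t \<omega>)\<^sup>2) = 1"
      "integrable M (\<lambda>\<omega>. (x t \<omega> - z t \<omega>)\<^sup>2)" if "t \<in> I" for t
      using ms[OF that] by (simp_all add: z_def[abs_def])
    show "expectation (\<lambda>\<omega>. (x t \<omega> - z t \<omega>)\<^sup>2) \<le> e" if "t \<in> I" for t
    proof -
      have "expectation (\<lambda>\<omega>. (x t \<omega> - z t \<omega>)\<^sup>2) \<le> 2 * \<delta>" using ms[OF that] by (simp add: z_def)
      then show ?thesis using \<delta>(3) by simp
    qed
  qed
qed

end

section \<open>Limiting spectral distributions\<close>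

lemma AE_ex_space:
  assumes "prob_space M" "AE \<omega> in M. P \<omega>"
  shows "\<exists>\<omega>. P \<omega>"
proof (rule ccontr)
  assume "\<nexists>\<omega>. P \<omega>"
  then have "AE \<omega> in M. False" using assms(2) by simp
  then show False using prob_space.AE_const[OF assms(1)] by blast
qed

text \<open>\<open>h\<close> recovers the 1-based index sum \<open>i + j\<close> from the letter, so that the sign matrix acts
  on the letters.\<close>

locale lsd_link = link L for L :: "nat \<Rightarrow> nat \<Rightarrow> 'i" +
  fixes h :: "'i \<Rightarrow> nat" and r :: nat
  assumes h_L: "h (L i j) = Suc i + Suc j"
    and r_pos: "r > 0"
    and card_letters: "card ((\<lambda>(i,j). L i j) ` ({..<n} \<times> {..<n})) \<le> 2 * n ^ r"
    and multiplicity: "card {(i,j) \<in> {..<n} \<times> {..<n}. L i j = t} * n ^ r \<le> 2 * n\<^sup>2"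
    and matching_convergent: "\<rho> \<in> pair_patterns (2*k) \<Longrightarrow> k > 0 \<Longrightarrow>
      convergent (\<lambda>n. card (matching (2*k) (cyc (2*k)) n \<rho>) / real n ^ Suc k)"
begin

text \<open>The exponent \<open>k + 2\<close> combines \<open>n ^ (- k / 2)\<close> from the matrix
  scaling with \<open>1 / n\<close> from averaging over the eigenvalues.\<close>

definition limit_moment :: "nat \<Rightarrow> real" where
  "limit_moment k = lim (\<lambda>n. card (pairing_circuits k n) / sqrt n ^ (k + 2))"

lemma sqrt_power_even: "sqrt (real n) ^ (2*k + 2) = real n ^ Suc k"
proof -
  have "sqrt (real n) ^ (2*k + 2) = (sqrt (real n) ^ 2) ^ Suc k" by (simp only: power_mult[symmetric]) simp
  then show ?thesis by simp
qed

text \<open>Odd lengths admit no pairing. For even \<open>k\<close> each pattern count is squeezed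
  between the \<open>matching\<close> count and the same count minus an error that is
  \<open>k ^ k / n\<close> after normalization; then the finitely many patterns are summed.\<close>

lemma pairing_circuits_tendsto:
  assumes k: "k > 0"
  shows "(\<lambda>n. card (pairing_circuits k n) / sqrt n ^ (k + 2)) \<longlonglongrightarrow> limit_moment k"
proof (cases "odd k")
  case True
  then show ?thesis by (simp add: limit_moment_def pairing_circuits_odd convergent_LIMSEQ_iff[symmetric])
next
  case False
  then obtain m where m: "k = 2 * m" by auto
  then have m0: "m > 0" using k by simp
  have ex: "convergent (\<lambda>n. card (exact k n \<rho>) / real n ^ Suc m)" if \<rho>: "\<rho> \<in> pair_patterns k" for \<rho>
  proof -
    obtain l where l: "(\<lambda>n. card (matching k (cyc k) n \<rho>) / real n ^ Suc m) \<longlonglongrightarrow> l"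
      using matching_convergent[of \<rho> m] \<rho> m m0 by (auto simp: convergent_def)
    have km: "Suc ((k - 1) div 2) = m" using m m0 by linarith
    have "(\<lambda>n. card (matching k (cyc k) n \<rho>) / real n ^ Suc m - real (k ^ k) / real n) \<longlonglongrightarrow> l - 0"
      by (intro tendsto_diff l lim_const_over_n)
    then have lower: "(\<lambda>n. card (matching k (cyc k) n \<rho>) / real n ^ Suc m - real (k ^ k) / real n) \<longlonglongrightarrow> l" by simp
    have ev1: "eventually (\<lambda>n. card (matching k (cyc k) n \<rho>) / real n ^ Suc m - real (k ^ k) / real n \<le> card (exact k n \<rho>) / real n ^ Suc m) sequentially"
    proof (rule eventually_sequentiallyI[of 1])
      fix n :: nat assume n: "1 \<le> n"
      have "real (card (matching k (cyc k) n \<rho>)) \<le> real (card (exact k n \<rho>) + k ^ k * n ^ m)"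
        using card_matching_exact(2)[OF \<rho> k, of n] unfolding km by (rule of_nat_mono)
      then have "card (matching k (cyc k) n \<rho>) / real n ^ Suc m \<le> (card (exact k n \<rho>) + real (k ^ k) * real n ^ m) / real n ^ Suc m"
        by (intro divide_right_mono) simp_all
      also have "\<dots> = card (exact k n \<rho>) / real n ^ Suc m + real (k ^ k) / real n"
        using n by (simp add: add_divide_distrib)
      finally show "card (matching k (cyc k) n \<rho>) / real n ^ Suc m - real (k ^ k) / real n \<le> card (exact k n \<rho>) / real n ^ Suc m" by simp
    qed
    have ev2: "eventually (\<lambda>n. card (exact k n \<rho>) / real n ^ Suc m \<le> card (matching k (cyc k) n \<rho>) / real n ^ Suc m) sequentially"
      using card_matching_exact(1)[OF \<rho> k] by (intro always_eventually allI divide_right_mono) auto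
    from tendsto_sandwich[OF ev1 ev2 lower l] show ?thesis by (rule convergentI)
  qed
  have "convergent (\<lambda>n. \<Sum>\<rho>\<in>pair_patterns k. card (exact k n \<rho>) / real n ^ Suc m)"
    by (intro convergent_sum ex)
  moreover have "(\<lambda>n. \<Sum>\<rho>\<in>pair_patterns k. card (exact k n \<rho>) / real n ^ Suc m)
    = (\<lambda>n. card (pairing_circuits k n) / sqrt n ^ (k + 2))"
    by (rule ext) (simp only: card_pairing_circuits m sqrt_power_even of_nat_sum sum_divide_distrib)
  ultimately show ?thesis by (simp add: limit_moment_def convergent_LIMSEQ_iff)
qed

lemma limit_moment_le:
  assumes k: "k > 0"
  shows "limit_moment (2*k) \<le> 4 ^ k * real (2*k) ^ k"
proof (rule LIMSEQ_le_const2[OF pairing_circuits_tendsto])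
  show "\<exists>N. \<forall>n\<ge>N. card (pairing_circuits (2*k) n) / sqrt n ^ (2*k + 2) \<le> 4 ^ k * real (2*k) ^ k"
  proof (intro exI[of _ 1] allI impI)
    fix n :: nat assume n: "1 \<le> n"
    have "real (card (pairing_circuits (2*k) n)) \<le> real (4 ^ k * (2*k) ^ k * n ^ Suc k)"
      using card_pairing_circuits_le[OF k, of n] by (rule of_nat_mono)
    then have "real (card (pairing_circuits (2*k) n)) \<le> 4 ^ k * real (2*k) ^ k * real n ^ Suc k" by simp
    then show "card (pairing_circuits (2*k) n) / sqrt n ^ (2*k + 2) \<le> 4 ^ k * real (2*k) ^ k"
      unfolding sqrt_power_even using n by (subst pos_divide_le_eq) auto
  qed
qed (use k in simp)

subsection \<open>Bounded entries\<close>

text \<open>\<open>b\<close> selects the signed matrix. The antidiagonal, with letter sum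
  \<open>n + 1\<close>, receives -1 instead of 0, so that every signed input keeps variance
  1.\<close>

definition pm_sign :: "bool \<Rightarrow> nat \<Rightarrow> 'i \<Rightarrow> real" where
  "pm_sign b n t = (if b \<and> h t > n then - 1 else 1)"

definition pm_entry :: "bool \<Rightarrow> ('i \<Rightarrow> real) \<Rightarrow> nat \<Rightarrow> nat \<Rightarrow> nat \<Rightarrow> real" where
  "pm_entry b w n i j = pm_sign b n (L i j) * w (L i j) / sqrt n"

lemma sym_pm_entry: "sym_on n (pm_entry b w n)"
  by (auto simp: sym_on_def pm_entry_def L_sym)

text \<open>For each \<open>n\<close> the signed inputs form their own bounded array. The pairing
  count and the error constants do not involve the signs, so the estimates are uniform in
  \<open>n\<close> and the limit does not depend on \<open>b\<close>.\<close>

lemma trace_moments_AE: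
  assumes P: "prob_space M" and L_in: "\<And>i j. L i j \<in> I"
    and ind: "prob_space.indep_vars M (\<lambda>_. borel) z I"
    and bd: "\<And>t \<omega>. t \<in> I \<Longrightarrow> \<bar>z t \<omega>\<bar> \<le> C" and C: "C \<ge> 1"
    and E: "\<And>t. t \<in> I \<Longrightarrow> prob_space.expectation M (z t) = 0"
    and V: "\<And>t. t \<in> I \<Longrightarrow> prob_space.expectation M (\<lambda>\<omega>. (z t \<omega>)\<^sup>2) = 1"
  shows "AE \<omega> in M. moments_tendsto (\<lambda>j. (Suc j)\<^sup>2)
           (\<lambda>j. spec ((Suc j)\<^sup>2) (pm_entry b (\<lambda>t. z t \<omega>) ((Suc j)\<^sup>2))) limit_moment"
proof -
  interpret prob_space M by (rule P)
  have BA: "bounded_array L M I (\<lambda>t \<omega>. pm_sign b n t * z t \<omega>) C" for n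
  proof
    show "L i j \<in> I" for i j by (rule L_in)
    show "indep_vars (\<lambda>_. borel) (\<lambda>t \<omega>. pm_sign b n t * z t \<omega>) I"
      by (rule indep_vars_compose2[OF ind]) measurable
    show "\<bar>pm_sign b n t * z t \<omega>\<bar> \<le> C" if "t \<in> I" for t \<omega>
      using bd[OF that] by (simp add: pm_sign_def)
    show "expectation (\<lambda>\<omega>. pm_sign b n t * z t \<omega>) = 0" if "t \<in> I" for t
      using E[OF that] by simp
    show "expectation (\<lambda>\<omega>. (pm_sign b n t * z t \<omega>)\<^sup>2) = 1" if "t \<in> I" for t
      using V[OF that] by (simp add: pm_sign_def power_mult_distrib)
  qed (rule C)
  define T where "T n = bounded_array.trace_sum L (\<lambda>t \<omega>. pm_sign b n t * z t \<omega>)" for n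
  note T_measurable = bounded_array.trace_sum_measurable[OF BA, folded T_def]
    and T_bounded = bounded_array.trace_sum_bounded[OF BA, folded T_def]
    and T_exp = bounded_array.expectation_trace_sum[OF BA, folded T_def]
    and T_var = bounded_array.variance_trace_sum[OF BA, folded T_def]
  have T_def': "T n k m \<omega> = (\<Sum>p\<in>circuits k m. \<Prod>i<k. pm_sign b n (letters (cyc k) p i) * z (letters (cyc k) p i) \<omega>)" for n k m \<omega>
    unfolding T_def bounded_array.trace_sum_def[OF BA] bounded_array.word_def[OF BA] ..
  have em: "emp_moment n (spec n (pm_entry b (\<lambda>t. z t \<omega>) n)) k = T n k n \<omega> / sqrt n ^ (k + 2)"
    if k: "k > 0" for n k \<omega>
  proof -
    have "(\<Sum>a<n. spec n (pm_entry b (\<lambda>t. z t \<omega>) n) a ^ k)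
       = (\<Sum>p\<in>circuits k n. \<Prod>i<k. pm_entry b (\<lambda>t. z t \<omega>) n (p i) (p (Suc i mod k)))"
      by (rule spec_power_sum[OF sym_pm_entry k])
    also have "\<dots> = T n k n \<omega> / sqrt n ^ k"
      unfolding T_def' sum_divide_distrib
      by (intro sum.cong refl) (simp add: pm_entry_def letters_def prod_dividef)
    finally show ?thesis by (simp add: emp_moment_def power2_eq_square)
  qed
  define N where "N j = (Suc j)\<^sup>2" for j
  have N: "filterlim N at_top sequentially"
    unfolding N_def by (rule filterlim_subseq) (auto simp: strict_mono_def intro: power_strict_mono)
  have "AE \<omega> in M. (\<lambda>j. T (N j) k (N j) \<omega> / sqrt (N j) ^ (k + 2)) \<longlonglongrightarrow> limit_moment k" if k: "k > 0" for k
  proof -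
    define K where "K = C ^ k * real (k ^ k)"
    have ET: "(\<lambda>n. expectation (T n k n) / sqrt n ^ (k + 2)) \<longlonglongrightarrow> limit_moment k"
    proof -
      have "(\<lambda>n. K / sqrt n) \<longlonglongrightarrow> 0" by real_asymp
      moreover have "eventually (\<lambda>n. norm ((expectation (T n k n) - card (pairing_circuits k n)) / sqrt n ^ (k + 2)) \<le> K / sqrt n) sequentially"
      proof (rule eventually_sequentiallyI[of 1])
        fix n :: nat assume n: "1 \<le> n"
        \<comment> \<open>\<open>2 * Suc ((k - 1) div 2) \<le> k + 1\<close>, one power of
          \<open>sqrt n\<close> below the normalization.\<close>
        have "real n ^ l = sqrt n ^ (2 * l)" for l by (simp add: power_mult)
        then have "real n ^ Suc ((k - 1) div 2) = sqrt n ^ (2 * Suc ((k - 1) div 2))" .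
        also have "\<dots> \<le> sqrt n ^ (k + 1)" using n k by (intro power_increasing) auto
        finally have p: "real n ^ Suc ((k - 1) div 2) \<le> sqrt n ^ (k + 1)" .
        have "\<bar>expectation (T n k n) - card (pairing_circuits k n)\<bar> \<le> K * real n ^ Suc ((k - 1) div 2)"
          using T_exp[OF k, of n n] by (simp add: K_def)
        also have "\<dots> \<le> K * sqrt n ^ (k + 1)" using p C by (intro mult_left_mono) (auto simp: K_def)
        finally have "\<bar>expectation (T n k n) - card (pairing_circuits k n)\<bar> / sqrt n ^ (k + 2) \<le> K * sqrt n ^ (k + 1) / sqrt n ^ (k + 2)"
          by (rule divide_right_mono) simp
        also have "\<dots> = K / sqrt n" using n by simp
        finally show "norm ((expectation (T n k n) - card (pairing_circuits k n)) / sqrt n ^ (k + 2)) \<le> K / sqrt n"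
          by (simp add: abs_divide)
      qed
      ultimately have "(\<lambda>n. (expectation (T n k n) - card (pairing_circuits k n)) / sqrt n ^ (k + 2)) \<longlonglongrightarrow> 0"
        by (rule Lim_null_comparison[rotated])
      from tendsto_add[OF this pairing_circuits_tendsto[OF k]]
      show ?thesis by (simp add: diff_divide_distrib)
    qed
    define Z where "Z j \<omega> = (T (N j) k (N j) \<omega> - expectation (T (N j) k (N j))) / sqrt (N j) ^ (k + 2)" for j \<omega>
    define K2 where "K2 = 2 * C ^ (2*k) * (real k * real ((2*k) ^ (2*k)))"
    have Tm: "T n k n \<in> borel_measurable M" for n by (rule T_measurable)
    have int: "integrable M (\<lambda>\<omega>. (Z j \<omega>)\<^sup>2)" for j
    proof -
      obtain B where B: "\<And>\<omega>. \<bar>T (N j) k (N j) \<omega>\<bar> \<le> B" using T_bounded[of "N j" k "N j"] by blast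
      let ?B = "(B + \<bar>expectation (T (N j) k (N j))\<bar>) / sqrt (N j) ^ (k + 2)"
      show ?thesis
      proof (rule integrable_const_bound[of _ "?B\<^sup>2"])
        show "(\<lambda>\<omega>. (Z j \<omega>)\<^sup>2) \<in> borel_measurable M" unfolding Z_def using Tm[of "N j"] by measurable
        have "\<bar>Z j \<omega>\<bar> \<le> ?B" for \<omega>
        proof -
          have "\<bar>T (N j) k (N j) \<omega> - expectation (T (N j) k (N j))\<bar> \<le> B + \<bar>expectation (T (N j) k (N j))\<bar>"
            using B[of \<omega>] by linarith
          then have "\<bar>T (N j) k (N j) \<omega> - expectation (T (N j) k (N j))\<bar> / sqrt (N j) ^ (k + 2) \<le> ?B"
            by (rule divide_right_mono) simp
          then show ?thesis by (simp add: Z_def abs_divide)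
        qed
        then have "\<bar>Z j \<omega>\<bar>\<^sup>2 \<le> ?B\<^sup>2" for \<omega> by (intro power_mono) auto
        then show "AE \<omega> in M. norm ((Z j \<omega>)\<^sup>2) \<le> ?B\<^sup>2" by simp
      qed
    qed
    \<comment> \<open>Along \<open>N j = (Suc j)\<^sup>2\<close> the variance bound
      O(\<open>1 / n\<close>) becomes summable.\<close>
    have EZ: "expectation (\<lambda>\<omega>. (Z j \<omega>)\<^sup>2) \<le> K2 / (real (Suc j))\<^sup>2" for j
    proof -
      let ?n = "N j"
      have n: "?n > 0" by (simp add: N_def)
      have s2: "(sqrt ?n ^ (k + 2))\<^sup>2 = real ?n ^ (k + 2)"
        by (metis of_nat_0_le_iff power_commutes power_mult mult.commute real_sqrt_pow2)
      have "expectation (\<lambda>\<omega>. (Z j \<omega>)\<^sup>2) = expectation (\<lambda>\<omega>. (T ?n k ?n \<omega> - expectation (T ?n k ?n))\<^sup>2) / real ?n ^ (k + 2)"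
        unfolding Z_def power_divide s2 by simp
      also have "\<dots> \<le> (K2 * real ?n ^ Suc k) / real ?n ^ (k + 2)"
        using T_var[of ?n k ?n] by (intro divide_right_mono) (simp_all add: K2_def mult.assoc)
      also have "\<dots> = K2 / real ?n" using n by simp
      finally show ?thesis by (simp add: N_def)
    qed
    have sK: "summable (\<lambda>j. K2 / (real (Suc j))\<^sup>2)"
    proof -
      have "summable (\<lambda>n. inverse ((real n)\<^sup>2))" by (rule inverse_power_summable) simp
      then have "summable (\<lambda>j. inverse ((real (Suc j))\<^sup>2))"
        by (rule summable_Suc_iff[of "\<lambda>n. inverse ((real n)\<^sup>2)", THEN iffD2])
      then show ?thesis unfolding divide_inverse by (rule summable_mult)
    qed
    have "summable (\<lambda>j. expectation (\<lambda>\<omega>. (Z j \<omega>)\<^sup>2))"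
    proof (rule summable_comparison_test'[OF sK, of 0])
      fix j
      have "0 \<le> expectation (\<lambda>\<omega>. (Z j \<omega>)\<^sup>2)" by (rule Bochner_Integration.integral_nonneg) simp
      then show "norm (expectation (\<lambda>\<omega>. (Z j \<omega>)\<^sup>2)) \<le> K2 / (real (Suc j))\<^sup>2"
        using EZ[of j] by (simp only: real_norm_def abs_of_nonneg)
    qed
    then have "AE \<omega> in M. (\<lambda>j. Z j \<omega>) \<longlonglongrightarrow> 0" by (rule AE_tendsto_0_of_summable[OF int])
    then show ?thesis
    proof eventually_elim
      case (elim \<omega>)
      have "(\<lambda>j. expectation (T (N j) k (N j)) / sqrt (N j) ^ (k + 2)) \<longlonglongrightarrow> limit_moment k"
        using filterlim_compose[OF ET N] .
      from tendsto_add[OF elim this] show ?case by (simp add: Z_def diff_divide_distrib)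
    qed
  qed
  then have "AE \<omega> in M. \<forall>k\<in>{0<..}. (\<lambda>j. T (N j) k (N j) \<omega> / sqrt (N j) ^ (k + 2)) \<longlonglongrightarrow> limit_moment k"
    by (subst AE_ball_countable) auto
  then show ?thesis
    by eventually_elim (simp add: moments_tendsto_def em[unfolded of_nat_power] em N_def)
qed

end

text \<open>What (A1), (A2) and (A3) have in common: the first part makes the truncation error small
  in mean square uniformly in the letter, the second controls it almost surely.\<close>

definition uniform_squares :: "'a measure \<Rightarrow> 'i set \<Rightarrow> ('i \<Rightarrow> 'a \<Rightarrow> real) \<Rightarrow> bool" where
  "uniform_squares P I x \<longleftrightarrow>
     (\<forall>\<delta>>0. \<exists>C\<ge>1. \<forall>t\<in>I. prob_space.expectation P (\<lambda>\<omega>. (x t \<omega>)\<^sup>2 * of_bool (\<bar>x t \<omega>\<bar> > C)) \<le> \<delta>) \<and>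
     prob_space.dyadic_tails P I (\<lambda>t \<omega>. (x t \<omega>)\<^sup>2)"

context prob_space
begin

text \<open>Serves (A1) and (A3). Markov's inequality for fourth powers bounds
  \<open>prob {x\<^sup>2 > 2 ^ m}\<close> by \<open>K / 4 ^ m\<close>, so the weighted tails decay
  geometrically.\<close>

lemma uniform_squares_of_fourth_moments:
  assumes x: "\<And>t. t \<in> I \<Longrightarrow> x t \<in> borel_measurable M"
    and K: "\<And>t. t \<in> I \<Longrightarrow> integrable M (\<lambda>\<omega>. \<bar>x t \<omega>\<bar> ^ 4)" "\<And>t. t \<in> I \<Longrightarrow> expectation (\<lambda>\<omega>. \<bar>x t \<omega>\<bar> ^ 4) \<le> K"
  shows "uniform_squares M I x"
  unfolding uniform_squares_def
proof (intro conjI allI impI)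
  define K' where "K' = max K 1"
  have K': "K' \<ge> 1" "\<And>t. t \<in> I \<Longrightarrow> expectation (\<lambda>\<omega>. \<bar>x t \<omega>\<bar> ^ 4) \<le> K'" using K(2) by (force simp: K'_def)+
  fix \<delta> :: real assume \<delta>: "\<delta> > 0"
  \<comment> \<open>Above \<open>C\<close> one has
    \<open>x\<^sup>2 \<le> \<bar>x\<bar> ^ 4 / C\<^sup>2\<close>, and this \<open>C\<close> makes
    \<open>K' / C\<^sup>2 \<le> \<delta>\<close>.\<close>
  define C where "C = max 1 (sqrt (K' / \<delta>))"
  have "sqrt (K' / \<delta>) \<le> C" by (simp add: C_def)
  then have "K' / \<delta> \<le> C\<^sup>2" using K' \<delta> by (metis real_sqrt_le_iff real_sqrt_abs abs_of_nonneg le_max_iff_disj C_def zero_le_one order_trans max.cobounded1)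
  then have CK: "K' / C\<^sup>2 \<le> \<delta>" using \<delta> by (simp add: field_simps C_def)
  have C1: "C \<ge> 1" by (simp add: C_def)
  show "\<exists>C\<ge>1. \<forall>t\<in>I. expectation (\<lambda>\<omega>. (x t \<omega>)\<^sup>2 * of_bool (\<bar>x t \<omega>\<bar> > C)) \<le> \<delta>"
  proof (intro exI[of _ C] conjI C1 ballI)
    fix t assume t: "t \<in> I"
    have le: "(x t \<omega>)\<^sup>2 * of_bool (\<bar>x t \<omega>\<bar> > C) \<le> \<bar>x t \<omega>\<bar> ^ 4 / C\<^sup>2" for \<omega>
    proof (cases "\<bar>x t \<omega>\<bar> > C")
      case True
      have "C\<^sup>2 \<le> \<bar>x t \<omega>\<bar>\<^sup>2" using True C1 by (intro power_mono) auto
      then have "(x t \<omega>)\<^sup>2 * C\<^sup>2 \<le> (x t \<omega>)\<^sup>2 * \<bar>x t \<omega>\<bar>\<^sup>2" by (intro mult_left_mono) auto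
      also have "\<dots> = \<bar>x t \<omega>\<bar> ^ 4" by (simp add: power2_eq_square power4_eq_xxxx)
      finally show ?thesis using True C1 by (simp add: field_simps)
    qed simp
    have i4: "integrable M (\<lambda>\<omega>. \<bar>x t \<omega>\<bar> ^ 4 / C\<^sup>2)" using K(1)[OF t] by simp
    have "integrable M (\<lambda>\<omega>. (x t \<omega>)\<^sup>2 * of_bool (\<bar>x t \<omega>\<bar> > C))"
    proof (rule Bochner_Integration.integrable_bound[OF i4])
      show "(\<lambda>\<omega>. (x t \<omega>)\<^sup>2 * of_bool (\<bar>x t \<omega>\<bar> > C)) \<in> borel_measurable M" using x[OF t] by measurable
      show "AE \<omega> in M. norm ((x t \<omega>)\<^sup>2 * of_bool (\<bar>x t \<omega>\<bar> > C)) \<le> norm (\<bar>x t \<omega>\<bar> ^ 4 / C\<^sup>2)"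
        using le by (intro AE_I2) simp
    qed
    then have "expectation (\<lambda>\<omega>. (x t \<omega>)\<^sup>2 * of_bool (\<bar>x t \<omega>\<bar> > C)) \<le> expectation (\<lambda>\<omega>. \<bar>x t \<omega>\<bar> ^ 4 / C\<^sup>2)"
      using le i4 by (intro integral_mono) auto
    also have "\<dots> \<le> K' / C\<^sup>2" using K'(2)[OF t] by (simp add: divide_right_mono)
    finally show "expectation (\<lambda>\<omega>. (x t \<omega>)\<^sup>2 * of_bool (\<bar>x t \<omega>\<bar> > C)) \<le> \<delta>" using CK by simp
  qed
next
  show "dyadic_tails I (\<lambda>t \<omega>. (x t \<omega>)\<^sup>2)"
    unfolding dyadic_tails_def
  proof (intro exI[of _ "\<lambda>m. K * (1/2) ^ m"] conjI ballI allI)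
    show "summable (\<lambda>m. K * (1/2) ^ m)" by (intro summable_mult summable_geometric) simp
    fix t and m :: nat assume t: "t \<in> I"
    have "prob {\<omega>\<in>space M. (x t \<omega>)\<^sup>2 > 2 ^ m} \<le> prob {\<omega>\<in>space M. \<bar>x t \<omega>\<bar> ^ 4 \<ge> 4 ^ m}"
    proof (rule finite_measure_mono)
      show "{\<omega>\<in>space M. \<bar>x t \<omega>\<bar> ^ 4 \<ge> 4 ^ m} \<in> events" using x[OF t] by measurable
      show "{\<omega>\<in>space M. (x t \<omega>)\<^sup>2 > 2 ^ m} \<subseteq> {\<omega>\<in>space M. \<bar>x t \<omega>\<bar> ^ 4 \<ge> 4 ^ m}"
      proof clarify
        fix \<omega> assume "2 ^ m < (x t \<omega>)\<^sup>2"
        then have "((2::real) ^ m)\<^sup>2 \<le> ((x t \<omega>)\<^sup>2)\<^sup>2" by (intro power_mono) auto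
        moreover have "((2::real) ^ m)\<^sup>2 = 4 ^ m" by (simp add: power2_eq_square flip: power_mult_distrib)
        moreover have "((x t \<omega>)\<^sup>2)\<^sup>2 = \<bar>x t \<omega>\<bar> ^ 4" by (simp flip: power_mult)
        ultimately show "4 ^ m \<le> \<bar>x t \<omega>\<bar> ^ 4" by simp
      qed
    qed
    also have "\<dots> \<le> expectation (\<lambda>\<omega>. \<bar>x t \<omega>\<bar> ^ 4) / 4 ^ m"
      by (rule integral_Markov_inequality_measure[OF K(1)[OF t], of "{}"]) auto
    also have "\<dots> \<le> K / 4 ^ m" by (intro divide_right_mono K(2) t) simp
    finally have "2 ^ m * prob {\<omega>\<in>space M. (x t \<omega>)\<^sup>2 > 2 ^ m} \<le> 2 ^ m * (K / 4 ^ m)" by (rule mult_left_mono) simp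
    also have "\<dots> = K * (1/2) ^ m"
    proof -
      have "(4::real) ^ m = 2 ^ m * 2 ^ m" by (simp flip: power_mult_distrib)
      then show ?thesis by (simp add: field_simps)
    qed
    finally show "2 ^ m * prob {\<omega>\<in>space M. (x t \<omega>)\<^sup>2 > 2 ^ m} \<le> K * (1/2) ^ m" .
  qed
qed

text \<open>The bound by \<open>min (2 ^ N) (2 * y)\<close> is inductive: a new term
  \<open>2 ^ N\<close> appears only if \<open>2 ^ N < y\<close>, and then doubling stays below
  \<open>2 * y\<close>.\<close>

lemma dyadic_sum_le:
  assumes "y \<ge> (0::real)"
  shows "(\<Sum>m<N. 2 ^ m * of_bool (y > 2 ^ m)) \<le> 2 * y"
proof -
  have "(\<Sum>m<N. 2 ^ m * of_bool (y > 2 ^ m)) \<le> min (2 ^ N) (2 * y)"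
  proof (induction N)
    case (Suc N)
    then show ?case by (auto simp: min_def split: if_splits)
  qed (use assms in auto)
  then show ?thesis by simp
qed

text \<open>Serves (A2). All expectations reduce to one variable \<open>x t0\<close>: the truncated
  second moments vanish by dominated convergence, and the weighted tails sum to at most twice the
  second moment.\<close>

lemma uniform_squares_of_identical_distribution:
  fixes x :: "'i \<Rightarrow> 'a \<Rightarrow> real"
  assumes x: "\<And>t. t \<in> I \<Longrightarrow> x t \<in> borel_measurable M"
    and x2: "\<And>t. t \<in> I \<Longrightarrow> integrable M (\<lambda>\<omega>. (x t \<omega>)\<^sup>2)"
    and id: "\<And>s t. s \<in> I \<Longrightarrow> t \<in> I \<Longrightarrow> distr M borel (x s) = distr M borel (x t)"
  shows "uniform_squares M I x"
proof (cases "I = {}")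
  case True
  then show ?thesis by (auto simp: uniform_squares_def dyadic_tails_def intro!: exI[of _ 1] exI[of _ "\<lambda>_. 0"])
next
  case False
  then obtain t0 where t0: "t0 \<in> I" by auto
  note [measurable] = x[OF t0]
  have same: "expectation (\<lambda>\<omega>. f (x t \<omega>)) = expectation (\<lambda>\<omega>. f (x t0 \<omega>))"
    if t: "t \<in> I" and f: "f \<in> borel_measurable borel" for t and f :: "real \<Rightarrow> real"
    using integral_distr[OF x[OF t] f] integral_distr[OF x[OF t0] f] id[OF t t0] by simp
  show ?thesis
    unfolding uniform_squares_def
  proof (intro conjI allI impI)
    fix \<delta> :: real assume \<delta>: "\<delta> > 0"
    have "(\<lambda>k. expectation (\<lambda>\<omega>. (x t0 \<omega>)\<^sup>2 * of_bool (\<bar>x t0 \<omega>\<bar> > real k))) \<longlonglongrightarrow> expectation (\<lambda>\<omega>. 0)"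
    proof (rule integral_dominated_convergence[OF _ _ x2[OF t0]])
      show "AE \<omega> in M. (\<lambda>k. (x t0 \<omega>)\<^sup>2 * of_bool (\<bar>x t0 \<omega>\<bar> > real k)) \<longlonglongrightarrow> 0"
      proof (rule AE_I2)
        fix \<omega>
        obtain N where "\<bar>x t0 \<omega>\<bar> \<le> real N" using real_arch_simple by blast
        then show "(\<lambda>k. (x t0 \<omega>)\<^sup>2 * of_bool (\<bar>x t0 \<omega>\<bar> > real k)) \<longlonglongrightarrow> 0"
          by (intro tendsto_eventually eventually_sequentiallyI[of N]) (simp add: not_less order_trans)
      qed
      show "(\<lambda>\<omega>. (x t0 \<omega>)\<^sup>2 * of_bool (\<bar>x t0 \<omega>\<bar> > real k)) \<in> borel_measurable M" for k by measurable
    qed (auto simp: of_bool_def)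
    then have "eventually (\<lambda>k. expectation (\<lambda>\<omega>. (x t0 \<omega>)\<^sup>2 * of_bool (\<bar>x t0 \<omega>\<bar> > real k)) < \<delta>) sequentially"
      using \<delta> by (intro order_tendstoD(2)) auto
    then have "eventually (\<lambda>k. k \<ge> 1 \<and> expectation (\<lambda>\<omega>. (x t0 \<omega>)\<^sup>2 * of_bool (\<bar>x t0 \<omega>\<bar> > real k)) < \<delta>) sequentially"
      by (intro eventually_conj eventually_ge_at_top)
    then obtain k :: nat where k: "k \<ge> 1" "expectation (\<lambda>\<omega>. (x t0 \<omega>)\<^sup>2 * of_bool (\<bar>x t0 \<omega>\<bar> > real k)) < \<delta>"
      by (auto simp: eventually_sequentially)
    show "\<exists>C\<ge>1. \<forall>t\<in>I. expectation (\<lambda>\<omega>. (x t \<omega>)\<^sup>2 * of_bool (\<bar>x t \<omega>\<bar> > C)) \<le> \<delta>"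
    proof (intro exI[of _ "real k"] conjI ballI)
      fix t assume t: "t \<in> I"
      have "(\<lambda>y::real. y\<^sup>2 * of_bool (\<bar>y\<bar> > real k)) \<in> borel_measurable borel" by measurable
      from same[OF t this] k(2) show "expectation (\<lambda>\<omega>. (x t \<omega>)\<^sup>2 * of_bool (\<bar>x t \<omega>\<bar> > real k)) \<le> \<delta>" by simp
    qed (use k in simp)
  next
    define B :: "nat \<Rightarrow> 'a \<Rightarrow> real" where "B m \<omega> = of_bool ((x t0 \<omega>)\<^sup>2 > 2 ^ m)" for m \<omega>
    have B: "B m \<in> borel_measurable M" for m unfolding B_def by measurable
    have iB: "integrable M (B m)" for m using B by (intro integrable_const_bound[of _ 1]) (auto simp: B_def)
    have prob_eq: "prob {\<omega>\<in>space M. (x t \<omega>)\<^sup>2 > 2 ^ m} = expectation (B m)" if t: "t \<in> I" for t m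
    proof -
      have "prob {\<omega>\<in>space M. (x t \<omega>)\<^sup>2 > 2 ^ m} = expectation (indicator {\<omega>\<in>space M. (x t \<omega>)\<^sup>2 > 2 ^ m})"
        by (simp add: Int_absorb2 subset_iff)
      also have "\<dots> = expectation (\<lambda>\<omega>. of_bool ((x t \<omega>)\<^sup>2 > 2 ^ m))"
        by (intro Bochner_Integration.integral_cong) (auto simp: indicator_def)
      also have "\<dots> = expectation (B m)"
        unfolding B_def by (rule same[OF t, of "\<lambda>y. of_bool (y\<^sup>2 > 2 ^ m)"]) measurable
      finally show ?thesis .
    qed
    show "dyadic_tails I (\<lambda>t \<omega>. (x t \<omega>)\<^sup>2)"
      unfolding dyadic_tails_def
    proof (intro exI[of _ "\<lambda>m. 2 ^ m * expectation (B m)"] conjI ballI allI)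
      have "(\<Sum>m<N. 2 ^ m * expectation (B m)) \<le> 2 * expectation (\<lambda>\<omega>. (x t0 \<omega>)\<^sup>2)" for N
      proof -
        have "(\<Sum>m<N. 2 ^ m * expectation (B m)) = expectation (\<lambda>\<omega>. \<Sum>m<N. 2 ^ m * B m \<omega>)"
          using iB by simp
        also have "\<dots> \<le> expectation (\<lambda>\<omega>. 2 * (x t0 \<omega>)\<^sup>2)"
        proof (rule integral_mono)
          show "integrable M (\<lambda>\<omega>. \<Sum>m<N. 2 ^ m * B m \<omega>)" using iB by simp
          show "integrable M (\<lambda>\<omega>. 2 * (x t0 \<omega>)\<^sup>2)" using x2[OF t0] by simp
          show "(\<Sum>m<N. 2 ^ m * B m \<omega>) \<le> 2 * (x t0 \<omega>)\<^sup>2" for \<omega>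
            unfolding B_def by (rule dyadic_sum_le) simp
        qed
        finally show ?thesis by simp
      qed
      then show "summable (\<lambda>m. 2 ^ m * expectation (B m))"
        by (intro summableI_nonneg_bounded[where x="2 * expectation (\<lambda>\<omega>. (x t0 \<omega>)\<^sup>2)"]) (auto simp: B_def)
    qed (simp add: prob_eq)
  qed
qed

end

lemma std_indep_inputsD:
  assumes "std_indep_inputs P I x"
  shows "prob_space P" "prob_space.indep_vars P (\<lambda>_. borel) x I"
    "\<And>t. t \<in> I \<Longrightarrow> x t \<in> borel_measurable P"
    "\<And>t. t \<in> I \<Longrightarrow> integrable P (x t)" "\<And>t. t \<in> I \<Longrightarrow> integrable P (\<lambda>\<omega>. (x t \<omega>)\<^sup>2)"
    "\<And>t. t \<in> I \<Longrightarrow> prob_space.expectation P (x t) = 0"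
    "\<And>t. t \<in> I \<Longrightarrow> prob_space.expectation P (\<lambda>\<omega>. (x t \<omega>)\<^sup>2) = 1"
  using assms unfolding std_indep_inputs_def by auto

lemma admissible_inputs_uniform_squares:
  assumes "admissible_inputs P I x"
  shows "std_indep_inputs P I x" "uniform_squares P I x"
proof -
  show std: "std_indep_inputs P I x"
    using assms by (auto simp: admissible_inputs_def assumption_A1_def assumption_A2_def assumption_A3_def)
  note sd = std_indep_inputsD[OF std]
  interpret prob_space P by (rule sd(1))
  from assms consider (A1) "assumption_A1 P I x" | (A2) "assumption_A2 P I x" | (A3) "assumption_A3 P I x"
    by (auto simp: admissible_inputs_def)
  then show "uniform_squares P I x"
  proof cases
    case A1
    then obtain C where C: "\<And>i. i \<in> I \<Longrightarrow> AE \<omega> in P. \<bar>x i \<omega>\<bar> \<le> C" by (auto simp: assumption_A1_def)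
    have C4: "AE \<omega> in P. \<bar>x i \<omega>\<bar> ^ 4 \<le> C ^ 4" if "i \<in> I" for i
      using C[OF that] by eventually_elim (rule power_mono, simp_all)
    show ?thesis
    proof (rule uniform_squares_of_fourth_moments[OF sd(3)])
      fix t assume t: "t \<in> I"
      show i: "integrable P (\<lambda>\<omega>. \<bar>x t \<omega>\<bar> ^ 4)"
      proof (rule integrable_const_bound[of _ "C ^ 4"])
        show "AE \<omega> in P. norm (\<bar>x t \<omega>\<bar> ^ 4) \<le> C ^ 4" using C4[OF t] by simp
        show "(\<lambda>\<omega>. \<bar>x t \<omega>\<bar> ^ 4) \<in> borel_measurable P" using sd(3)[OF t] by measurable
      qed
      have "expectation (\<lambda>\<omega>. \<bar>x t \<omega>\<bar> ^ 4) \<le> expectation (\<lambda>\<omega>. C ^ 4)"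
        using i C4[OF t] by (intro integral_mono_AE) auto
      then show "expectation (\<lambda>\<omega>. \<bar>x t \<omega>\<bar> ^ 4) \<le> C ^ 4" by (simp add: prob_space)
    qed
  next
    case A2
    show ?thesis
    proof (rule uniform_squares_of_identical_distribution[OF sd(3) sd(5)])
      show "distr P borel (x s) = distr P borel (x t)" if "s \<in> I" "t \<in> I" for s t
        using A2 that unfolding assumption_A2_def by blast
    qed
  next
    case A3
    then obtain K where K: "\<forall>i\<in>I. integrable P (\<lambda>\<omega>. \<bar>x i \<omega>\<bar> ^ 4) \<and> expectation (\<lambda>\<omega>. \<bar>x i \<omega>\<bar> ^ 4) \<le> K"
      unfolding assumption_A3_def by meson
    show ?thesis
    proof (rule uniform_squares_of_fourth_moments[OF sd(3)])
      show "integrable P (\<lambda>\<omega>. \<bar>x t \<omega>\<bar> ^ 4)" "expectation (\<lambda>\<omega>. \<bar>x t \<omega>\<bar> ^ 4) \<le> K" if "t \<in> I" for t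
        using K that by blast+
    qed
  qed
qed

section \<open>Comparison of spectra of different sizes\<close>

lemma spec_char_emp_char: "spec_char n f t = emp_char n (spec n f) t"
  by (simp add: spec_char_def emp_char_def)

lemma cmod_emp_char_le: "cmod (emp_char n s t) \<le> 1"
proof (cases "n = 0")
  case False
  have "cmod (\<Sum>a<n. iexp (t * s a)) \<le> (\<Sum>a<n. 1)" by (intro sum_norm_le) simp
  then show ?thesis using False by (simp add: emp_char_def norm_divide)
qed (simp add: emp_char_def)

text \<open>The smaller matrix is padded with zeros to size \<open>n\<close>. The added zero
  eigenvalues change the normalized characteristic function by \<open>(n - m) / n\<close> times a
  number of modulus at most 2; the rest is the Frobenius estimate.\<close>

lemma spec_char_resize:
  assumes symf: "sym_on n f" and symg: "sym_on m g" and mn: "m \<le> n" and m: "m > 0"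
  shows "cmod (emp_char n (spec n f) t - emp_char m (spec m g) t)
    \<le> \<bar>t\<bar> * sqrt ((\<Sum>i<n. \<Sum>j<n. (f i j - (if i < m \<and> j < m then g i j else 0))\<^sup>2) / n) + 2 * (real n - real m) / n"
proof -
  define G where "G = (\<lambda>i j. if i < m \<and> j < m then g i j else 0)"
  note pad = spec_char_pad[OF symg mn, folded G_def]
  have n: "n > 0" using m mn by simp
  define S where "S = (\<Sum>a<m. iexp (t * spec m g a))"
  define E where "E = emp_char m (spec m g) t"
  have S: "S = of_nat m * E" using m by (simp add: S_def E_def emp_char_def)
  have "emp_char n (spec n G) t - E = (of_nat m * E + of_nat (n - m)) / of_nat n - E"
    unfolding emp_char_def[of n] pad(2)[of t] S_def[symmetric] S ..
  also have "\<dots> = of_nat (n - m) * (1 - E) / of_nat n"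
    using n mn by (simp add: field_simps of_nat_diff)
  finally have "cmod (emp_char n (spec n G) t - E) = real (n - m) * cmod (1 - E) / n"
    by (simp add: norm_mult norm_divide)
  also have "\<dots> \<le> real (n - m) * 2 / n"
  proof (intro divide_right_mono mult_left_mono)
    have "cmod (1 - E) \<le> cmod 1 + cmod E" by (rule norm_triangle_ineq4)
    then show "cmod (1 - E) \<le> 2" using cmod_emp_char_le[of m "spec m g" t] by (simp add: E_def)
  qed auto
  finally have 1: "cmod (emp_char n (spec n G) t - E) \<le> 2 * (real n - real m) / n"
    using mn by (simp add: of_nat_diff mult.commute)
  have 2: "cmod (emp_char n (spec n f) t - emp_char n (spec n G) t) \<le> \<bar>t\<bar> * sqrt ((\<Sum>i<n. \<Sum>j<n. (f i j - G i j)\<^sup>2) / n)"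
    using spec_char_perturb[OF symf pad(1), of t] by (simp add: spec_char_emp_char)
  have "cmod (emp_char n (spec n f) t - E) \<le> cmod (emp_char n (spec n f) t - emp_char n (spec n G) t) + cmod (emp_char n (spec n G) t - E)"
    using norm_triangle_ineq[of "emp_char n (spec n f) t - emp_char n (spec n G) t" "emp_char n (spec n G) t - E"] by simp
  then show ?thesis using 1 2 by (simp add: E_def G_def)
qed

context lsd_link
begin

subsection \<open>Interpolation between perfect squares\<close>

text \<open>Three kinds of exceptional positions: new rows, new columns, and the band of
  antidiagonals on which the sign for size \<open>m\<close> is already negative while that for size
  \<open>n\<close> is still positive. Each kind has at most \<open>(n - m) * n\<close> positions;
  the 2 converts to indices counted from 1.\<close>

lemma count_sign_changes:
  assumes "m \<le> n"
  shows "(\<Sum>i<n. \<Sum>j<n. of_bool (i \<ge> m \<or> j \<ge> m \<or> (m < i + j + 2 \<and> i + j + 2 \<le> n)) :: real) \<le> 3 * (real n - real m) * n"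
proof -
  have c1: "(\<Sum>j<n. of_bool (j \<ge> m) :: real) = real n - real m"
  proof -
    have "(\<Sum>j<n. of_bool (j \<ge> m) :: real) = card ({..<n} \<inter> {j. m \<le> j})"
      by (simp add: of_bool_def sum.If_cases)
    also have "{..<n} \<inter> {j. m \<le> j} = {m..<n}" by auto
    finally show ?thesis using assms by (simp add: of_nat_diff)
  qed
  have c2: "(\<Sum>j<n. of_bool (m < i + j + 2 \<and> i + j + 2 \<le> n) :: real) \<le> real n - real m" for i
  proof -
    have "(\<Sum>j<n. of_bool (m < i + j + 2 \<and> i + j + 2 \<le> n) :: real) = card ({..<n} \<inter> {j. m < i + j + 2 \<and> i + j + 2 \<le> n})"
      by (simp add: of_bool_def sum.If_cases)
    also have "card ({..<n} \<inter> {j. m < i + j + 2 \<and> i + j + 2 \<le> n}) \<le> card {m<..n}"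
      by (rule card_inj_on_le[where f="\<lambda>j. i + j + 2"]) (auto simp: inj_on_def)
    finally show ?thesis using assms by (simp add: of_nat_diff)
  qed
  have "(\<Sum>i<n. \<Sum>j<n. of_bool (i \<ge> m \<or> j \<ge> m \<or> (m < i + j + 2 \<and> i + j + 2 \<le> n)) :: real)
    \<le> (\<Sum>i<n. \<Sum>j<n. of_bool (i \<ge> m) + of_bool (j \<ge> m) + of_bool (m < i + j + 2 \<and> i + j + 2 \<le> n))"
    by (intro sum_mono) (auto simp: of_bool_def)
  also have "\<dots> = (\<Sum>i<n. real n * of_bool (i \<ge> m) + (real n - real m) + (\<Sum>j<n. of_bool (m < i + j + 2 \<and> i + j + 2 \<le> n)))"
    by (simp only: sum.distrib c1) simp
  also have "\<dots> \<le> (\<Sum>i<n. real n * of_bool (i \<ge> m) + (real n - real m) + (real n - real m))"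
    by (intro sum_mono add_left_mono c2)
  also have "\<dots> = real n * (real n - real m) + real n * (real n - real m) + real n * (real n - real m)"
    by (simp only: sum.distrib sum_distrib_left[symmetric] c1) simp
  finally show ?thesis by (simp add: algebra_simps)
qed

text \<open>\<open>25 = 1 + 24\<close>. Ordinary positions differ only through the normalization, by
  at most \<open>C * d\<close>, with total at most \<open>C\<^sup>2 / q\<close>. Exceptional ones
  differ by at most \<open>2 * C / q\<close>, and there are at most \<open>3 * 2 * q * n\<close> of
  them, which gives \<open>24 * C\<^sup>2 / q\<close>.\<close>

lemma interpolation_frobenius:
  assumes bd: "\<And>i j. \<bar>w (L i j)\<bar> \<le> C" and q: "q > 0" "q\<^sup>2 \<le> n" "n < (Suc q)\<^sup>2"
  shows "(\<Sum>i<n. \<Sum>j<n. (pm_entry b w n i j - (if i < q\<^sup>2 \<and> j < q\<^sup>2 then pm_entry b w (q\<^sup>2) i j else 0))\<^sup>2) / n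
    \<le> 25 * C\<^sup>2 / q"
proof -
  let ?m = "q\<^sup>2"
  have n: "n > 0" using q by (metis gr0I le_zero_eq power_eq_0_iff not_gr0)
  have C0: "0 \<le> C" using bd[of 0 0] by linarith
  have sm: "sqrt (real ?m) = q" by simp
  have sn: "real q \<le> sqrt n" "sqrt n \<le> real q + 1"
  proof -
    show "real q \<le> sqrt n" using q(2) by (intro real_le_rsqrt) (simp flip: of_nat_power)
    have "real n \<le> (real q + 1)\<^sup>2" using q(3) by (metis add.commute less_imp_le of_nat_Suc of_nat_le_iff of_nat_power)
    then show "sqrt n \<le> real q + 1" by (intro real_le_lsqrt) auto
  qed
  have dn: "real n - real ?m \<le> 2 * real q"
  proof -
    have "n \<le> q\<^sup>2 + 2 * q" using q(3) by (simp add: power2_eq_square)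
    then have "real n \<le> real (q\<^sup>2 + 2 * q)" by (rule of_nat_mono)
    then show ?thesis by simp
  qed
  define d where "d = 1 / real q - 1 / sqrt n"
  define bad where "bad i j = (of_bool (i \<ge> ?m \<or> j \<ge> ?m \<or> (?m < i + j + 2 \<and> i + j + 2 \<le> n)) :: real)" for i j
  have e: "\<bar>pm_entry b w N i j\<bar> \<le> C / sqrt N" for N i j
    using bd[of i j] by (auto simp: pm_entry_def pm_sign_def abs_mult divide_right_mono)
  have pt: "(pm_entry b w n i j - (if i < ?m \<and> j < ?m then pm_entry b w ?m i j else 0))\<^sup>2 \<le> C\<^sup>2 * d\<^sup>2 + 4 * C\<^sup>2 / ?m * bad i j" for i j
  proof (cases "i \<ge> ?m \<or> j \<ge> ?m \<or> (?m < i + j + 2 \<and> i + j + 2 \<le> n)")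
    case True
    have "\<bar>pm_entry b w n i j\<bar> \<le> C / q"
    proof -
      have "C / sqrt n \<le> C / q" using sn(1) q C0 by (intro divide_left_mono mult_pos_pos) (use n in auto)
      then show ?thesis using e[of n i j] by simp
    qed
    moreover have "\<bar>if i < ?m \<and> j < ?m then pm_entry b w ?m i j else 0\<bar> \<le> C / q"
      using e[of ?m i j] C0 by (simp add: sm)
    ultimately have "\<bar>pm_entry b w n i j - (if i < ?m \<and> j < ?m then pm_entry b w ?m i j else 0)\<bar> \<le> 2 * (C / q)" by linarith
    then have "\<bar>pm_entry b w n i j - (if i < ?m \<and> j < ?m then pm_entry b w ?m i j else 0)\<bar>\<^sup>2 \<le> (2 * (C / q))\<^sup>2"
      by (intro power_mono) auto
    also have "(2 * (C / q))\<^sup>2 = 4 * C\<^sup>2 / ?m" by (simp add: power2_eq_square)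
    also have "\<dots> \<le> C\<^sup>2 * d\<^sup>2 + 4 * C\<^sup>2 / ?m * bad i j" using True by (simp add: bad_def)
    finally show ?thesis by (simp only: power2_abs)
  next
    case False
    then have bad0: "bad i j = 0" unfolding bad_def by (simp only: of_bool_eq_0_iff) simp
    from False have "pm_sign b n (L i j) = pm_sign b ?m (L i j)" using q(2) by (auto simp: pm_sign_def h_L)
    then have "pm_entry b w n i j - (if i < ?m \<and> j < ?m then pm_entry b w ?m i j else 0) = - (pm_sign b n (L i j) * w (L i j) * d)"
      using False by (simp add: pm_entry_def d_def sm algebra_simps)
    then have "(pm_entry b w n i j - (if i < ?m \<and> j < ?m then pm_entry b w ?m i j else 0))\<^sup>2 = (w (L i j))\<^sup>2 * d\<^sup>2"
      by (simp add: power_mult_distrib pm_sign_def)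
    also have "\<dots> \<le> C\<^sup>2 * d\<^sup>2"
    proof (rule mult_right_mono)
      have "\<bar>w (L i j)\<bar>\<^sup>2 \<le> C\<^sup>2" by (intro power_mono bd) simp
      then show "(w (L i j))\<^sup>2 \<le> C\<^sup>2" by simp
    qed simp
    finally show ?thesis using bad0 by simp
  qed
  have "(\<Sum>i<n. \<Sum>j<n. (pm_entry b w n i j - (if i < ?m \<and> j < ?m then pm_entry b w ?m i j else 0))\<^sup>2)
    \<le> (\<Sum>i<n. \<Sum>j<n. C\<^sup>2 * d\<^sup>2 + 4 * C\<^sup>2 / ?m * bad i j)"
    by (intro sum_mono pt)
  also have "\<dots> = (real n)\<^sup>2 * (C\<^sup>2 * d\<^sup>2) + 4 * C\<^sup>2 / ?m * (\<Sum>i<n. \<Sum>j<n. bad i j)"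
    by (simp add: sum.distrib sum_distrib_left power2_eq_square)
  also have "(\<Sum>i<n. \<Sum>j<n. bad i j) \<le> 3 * (2 * real q) * real n"
  proof -
    have "(\<Sum>i<n. \<Sum>j<n. bad i j) \<le> 3 * (real n - real ?m) * n"
      unfolding bad_def by (rule count_sign_changes[OF q(2)])
    also have "\<dots> \<le> 3 * (2 * real q) * real n" using dn by (intro mult_right_mono mult_left_mono) auto
    finally show ?thesis .
  qed
  then have "(real n)\<^sup>2 * (C\<^sup>2 * d\<^sup>2) + 4 * C\<^sup>2 / ?m * (\<Sum>i<n. \<Sum>j<n. bad i j)
     \<le> (real n)\<^sup>2 * (C\<^sup>2 * d\<^sup>2) + 4 * C\<^sup>2 / ?m * (3 * (2 * real q) * real n)"
    by (intro add_left_mono mult_left_mono) auto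
  finally have "(\<Sum>i<n. \<Sum>j<n. (pm_entry b w n i j - (if i < ?m \<and> j < ?m then pm_entry b w ?m i j else 0))\<^sup>2) / n
    \<le> ((real n)\<^sup>2 * (C\<^sup>2 * d\<^sup>2) + 4 * C\<^sup>2 / ?m * (3 * (2 * real q) * real n)) / n"
    by (rule divide_right_mono) simp
  also have "\<dots> = C\<^sup>2 * (real n * d\<^sup>2) + 24 * C\<^sup>2 / q"
    using n q(1) by (simp add: field_simps power2_eq_square)
  also have "real n * d\<^sup>2 \<le> 1 / q"
  proof -
    have "sqrt n * d = (sqrt n - q) / q" using n q(1) by (simp add: d_def field_simps)
    moreover have "0 \<le> (sqrt n - q) / q" "(sqrt n - q) / q \<le> 1 / q" using sn q(1) by (auto simp: divide_right_mono)
    ultimately have "(sqrt n * d)\<^sup>2 \<le> (1 / q)\<^sup>2" by (simp only: power_mono)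
    moreover have "(sqrt n * d)\<^sup>2 = real n * d\<^sup>2" by (simp add: power_mult_distrib)
    moreover have "(1 / real q)\<^sup>2 = 1 / q * (1 / q)" by (rule power2_eq_square)
    ultimately have "real n * d\<^sup>2 \<le> 1 / q * (1 / q)" by simp
    also have "\<dots> \<le> 1 / q * 1" using q(1) by (intro mult_left_mono) auto
    finally show ?thesis by simp
  qed
  then have "C\<^sup>2 * (real n * d\<^sup>2) + 24 * C\<^sup>2 / q \<le> C\<^sup>2 * (1 / q) + 24 * C\<^sup>2 / q"
    by (intro add_right_mono mult_left_mono) auto
  finally show ?thesis by simp
qed

lemma pm_entry_tendsto:
  assumes bd: "\<And>i j. \<bar>w (L i j)\<bar> \<le> C"
    and sq: "\<And>t. (\<lambda>j. emp_char ((Suc j)\<^sup>2) (spec ((Suc j)\<^sup>2) (pm_entry b w ((Suc j)\<^sup>2))) t) \<longlonglongrightarrow> \<phi> t"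
  shows "(\<lambda>n. emp_char n (spec n (pm_entry b w n)) t) \<longlonglongrightarrow> \<phi> t"
proof -
  let ?e = "\<lambda>n. emp_char n (spec n (pm_entry b w n)) t"
  define q where "q n = nat \<lfloor>sqrt (real n)\<rfloor>" for n
  have q: "q n > 0" "(q n)\<^sup>2 \<le> n" "n < (Suc (q n))\<^sup>2" if "n \<ge> 1" for n
  proof -
    have "real (q n) = of_int \<lfloor>sqrt (real n)\<rfloor>" by (simp add: q_def)
    then have b: "real (q n) \<le> sqrt n" "sqrt n < real (q n) + 1" by linarith+
    have "1 \<le> sqrt (real n)" using that by simp
    then show "q n > 0" using b by linarith
    have "(real (q n))\<^sup>2 \<le> (sqrt n)\<^sup>2" by (intro power_mono b) simp
    then have "real ((q n)\<^sup>2) \<le> real n" by simp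
    then show "(q n)\<^sup>2 \<le> n" by (simp only: of_nat_le_iff)
    have "(sqrt n)\<^sup>2 < (real (q n) + 1)\<^sup>2" by (intro power_strict_mono b) auto
    then have "real n < real ((Suc (q n))\<^sup>2)" by (simp add: add.commute)
    then show "n < (Suc (q n))\<^sup>2" by (simp only: of_nat_less_iff)
  qed
  have qlim: "filterlim (\<lambda>n. real (q n)) at_top sequentially"
    unfolding q_def by real_asymp
  then have qlim': "filterlim q at_top sequentially" by (simp add: filterlim_sequentially_iff_filterlim_real)
  \<comment> \<open>The hypothesis indexes squares by \<open>Suc j\<close>, so the subsequence is
    taken at \<open>j = q n - 1\<close>.\<close>
  have "filterlim (\<lambda>n. q n - 1) at_top sequentially"
    using qlim' filterlim_compose filterlim_minus_const_nat_at_top by blast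
  from filterlim_compose[OF sq this] have "(\<lambda>n. ?e ((Suc (q n - 1))\<^sup>2)) \<longlonglongrightarrow> \<phi> t" .
  then have main: "(\<lambda>n. ?e ((q n)\<^sup>2)) \<longlonglongrightarrow> \<phi> t"
    by (rule Lim_transform_eventually) (use q(1) in \<open>auto intro!: eventually_sequentiallyI[of 1]\<close>)
  have C0: "0 \<le> C" using bd[of 0 0] by linarith
  have inv: "(\<lambda>n. 1 / real (q n)) \<longlonglongrightarrow> 0"
    using tendsto_inverse_0_at_top[OF qlim] by (simp add: inverse_eq_divide)
  have "(\<lambda>n. \<bar>t\<bar> * sqrt (25 * C\<^sup>2 * (1 / real (q n))) + 4 * (1 / real (q n))) \<longlonglongrightarrow> \<bar>t\<bar> * sqrt (25 * C\<^sup>2 * 0) + 4 * 0"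
    by (intro tendsto_add tendsto_mult tendsto_const tendsto_real_sqrt inv)
  then have z: "(\<lambda>n. \<bar>t\<bar> * sqrt (25 * C\<^sup>2 * (1 / real (q n))) + 4 * (1 / real (q n))) \<longlonglongrightarrow> 0" by simp
  have "(\<lambda>n. ?e n - ?e ((q n)\<^sup>2)) \<longlonglongrightarrow> 0"
  proof (rule Lim_null_comparison[OF _ z], rule eventually_sequentiallyI[of 1])
    fix n :: nat assume n: "1 \<le> n"
    have "cmod (?e n - ?e ((q n)\<^sup>2)) \<le> \<bar>t\<bar> * sqrt ((\<Sum>i<n. \<Sum>j<n. (pm_entry b w n i j -
       (if i < (q n)\<^sup>2 \<and> j < (q n)\<^sup>2 then pm_entry b w ((q n)\<^sup>2) i j else 0))\<^sup>2) / n) + 2 * (real n - real ((q n)\<^sup>2)) / n"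
      by (rule spec_char_resize[OF sym_pm_entry sym_pm_entry]) (use q[OF n] in auto)
    also have "\<dots> \<le> \<bar>t\<bar> * sqrt (25 * C\<^sup>2 / q n) + 4 / q n"
    proof (intro add_mono mult_left_mono real_sqrt_le_mono)
      show "(\<Sum>i<n. \<Sum>j<n. (pm_entry b w n i j -
       (if i < (q n)\<^sup>2 \<and> j < (q n)\<^sup>2 then pm_entry b w ((q n)\<^sup>2) i j else 0))\<^sup>2) / n \<le> 25 * C\<^sup>2 / q n"
        by (rule interpolation_frobenius[OF _ q[OF n]]) (rule bd)
      have "n \<le> (q n)\<^sup>2 + 2 * q n" using q(3)[OF n] by (simp add: power2_eq_square)
      then have "real n \<le> real ((q n)\<^sup>2 + 2 * q n)" by (rule of_nat_mono)
      then have a: "2 * (real n - real ((q n)\<^sup>2)) \<le> 4 * real (q n)" by simp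
      have "real (q n) * real (q n) \<le> n" using of_nat_mono[OF q(2)[OF n], where 'a=real] by (simp add: power2_eq_square)
      then have "4 * real (q n) / n \<le> 4 / q n" using q(1)[OF n] n by (simp add: field_simps)
      then show "2 * (real n - real ((q n)\<^sup>2)) / n \<le> 4 / q n"
        using divide_right_mono[OF a, of "real n"] by simp
    qed simp
    finally show "norm (?e n - ?e ((q n)\<^sup>2)) \<le> \<bar>t\<bar> * sqrt (25 * C\<^sup>2 * (1 / real (q n))) + 4 * (1 / real (q n))" by simp
  qed
  from tendsto_add[OF this main] show ?thesis by simp
qed

end

context lsd_link
begin

subsection \<open>Removing the truncation\<close>

text \<open>The true sign with 0 on the antidiagonal, in contrast to \<open>pm_sign\<close>.\<close>

definition letter_sign :: "bool \<Rightarrow> nat \<Rightarrow> 'i \<Rightarrow> real" where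
  "letter_sign b n t = (if \<not> b \<or> h t < n + 1 then 1 else if h t = n + 1 then 0 else - 1)"

definition signed_entry :: "bool \<Rightarrow> ('i \<Rightarrow> real) \<Rightarrow> nat \<Rightarrow> nat \<Rightarrow> nat \<Rightarrow> real" where
  "signed_entry b w n i j = letter_sign b n (L i j) * w (L i j) / sqrt n"

lemma sym_signed_entry: "sym_on n (signed_entry b w n)"
  by (auto simp: sym_on_def signed_entry_def L_sym)

definition letter_set :: "nat \<Rightarrow> 'i set" where
  "letter_set n = (\<lambda>(i,j). L i j) ` ({..<n} \<times> {..<n})"

text \<open>Each letter fills at most \<open>2 * n\<^sup>2 / n ^ r\<close> positions. Here
  \<open>n ^ r\<close> is the order of the number of letters, so a bound of that order on sums over
  letters becomes one of order \<open>n\<^sup>2\<close> on sums over entries.\<close>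

lemma sum_letters_le:
  assumes g: "\<And>t. g t \<ge> (0::real)" and n: "n > 0"
  shows "(\<Sum>i<n. \<Sum>j<n. g (L i j)) \<le> 2 * (real n)\<^sup>2 / real n ^ r * (\<Sum>t\<in>letter_set n. g t)"
proof -
  let ?A = "{..<n} \<times> {..<n}"
  have "(\<Sum>i<n. \<Sum>j<n. g (L i j)) = (\<Sum>x\<in>?A. g (case x of (i,j) \<Rightarrow> L i j))"
    by (simp add: sum.cartesian_product case_prod_unfold)
  also have "\<dots> = (\<Sum>t\<in>letter_set n. \<Sum>x\<in>{x\<in>?A. (case x of (i,j) \<Rightarrow> L i j) = t}. g (case x of (i,j) \<Rightarrow> L i j))"
    unfolding letter_set_def by (rule sum.image_gen) simp
  also have "\<dots> = (\<Sum>t\<in>letter_set n. card {x\<in>?A. (case x of (i,j) \<Rightarrow> L i j) = t} * g t)"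
    by (intro sum.cong refl) simp
  also have "\<dots> \<le> (\<Sum>t\<in>letter_set n. 2 * (real n)\<^sup>2 / real n ^ r * g t)"
  proof (intro sum_mono mult_right_mono g)
    fix t
    have "{x\<in>?A. (case x of (i,j) \<Rightarrow> L i j) = t} = {(i,j) \<in> ?A. L i j = t}" by auto
    then have "real (card {x\<in>?A. (case x of (i,j) \<Rightarrow> L i j) = t} * n ^ r) \<le> real (2 * n\<^sup>2)"
      using multiplicity[of n t] by (intro of_nat_mono) simp
    then show "real (card {x\<in>?A. (case x of (i,j) \<Rightarrow> L i j) = t}) \<le> 2 * (real n)\<^sup>2 / real n ^ r"
      using n by (simp add: field_simps)
  qed
  finally show ?thesis by (simp add: sum_distrib_left)
qed

text \<open>Two errors enter the Frobenius norm. Truncation gives \<open>8 * 2 ^ r * e\<close>,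
  composed of the multiplicity factor 2 and \<open>4 * 2 ^ r\<close> from the hypothesis; at most
  \<open>n\<close> antidiagonal entries of size at most \<open>C / sqrt n\<close> give
  \<open>C\<^sup>2 / n\<close>.\<close>

lemma emp_char_untruncate:
  assumes v: "\<And>i j. \<bar>v (L i j)\<bar> \<le> C" and n: "n > 0"
    and e: "(\<Sum>t\<in>letter_set n. (w t - v t)\<^sup>2) \<le> 4 * e * (2 * real n) ^ r"
  shows "cmod (emp_char n (spec n (signed_entry b w n)) t - emp_char n (spec n (pm_entry b v n)) t)
     \<le> \<bar>t\<bar> * sqrt (8 * 2 ^ r * e + C\<^sup>2 / n)"
proof -
  have pt: "(signed_entry b w n i j - pm_entry b v n i j)\<^sup>2 \<le> ((w (L i j) - v (L i j))\<^sup>2 + C\<^sup>2 * of_bool (i + j + 2 = n + 1)) / n" for i j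
  proof (cases "b \<and> i + j + 2 = n + 1")
    case True
    then have "signed_entry b w n i j - pm_entry b v n i j = v (L i j) / sqrt n"
      by (simp add: signed_entry_def pm_entry_def letter_sign_def pm_sign_def h_L)
    then have "(signed_entry b w n i j - pm_entry b v n i j)\<^sup>2 = \<bar>v (L i j)\<bar>\<^sup>2 / n" by (simp add: power_divide)
    also have "\<dots> \<le> C\<^sup>2 / n" by (intro divide_right_mono power_mono v) auto
    also have "\<dots> \<le> ((w (L i j) - v (L i j))\<^sup>2 + C\<^sup>2 * of_bool (i + j + 2 = n + 1)) / n"
      using True by (intro divide_right_mono) auto
    finally show ?thesis .
  next
    case False
    then have "letter_sign b n (L i j) = pm_sign b n (L i j)" by (auto simp: letter_sign_def pm_sign_def h_L)
    then have "signed_entry b w n i j - pm_entry b v n i j = pm_sign b n (L i j) * (w (L i j) - v (L i j)) / sqrt n"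
      by (simp add: signed_entry_def pm_entry_def diff_divide_distrib right_diff_distrib)
    then have "(signed_entry b w n i j - pm_entry b v n i j)\<^sup>2 = (w (L i j) - v (L i j))\<^sup>2 / n"
      by (simp add: power_divide power_mult_distrib pm_sign_def)
    also have "\<dots> \<le> ((w (L i j) - v (L i j))\<^sup>2 + C\<^sup>2 * of_bool (i + j + 2 = n + 1)) / n"
      by (intro divide_right_mono) auto
    finally show ?thesis .
  qed
  have diag: "(\<Sum>i<n. \<Sum>j<n. of_bool (i + j + 2 = n + 1) :: real) \<le> n"
  proof -
    have "(\<Sum>j<n. of_bool (i + j + 2 = n + 1) :: real) \<le> 1" for i
    proof -
      have "(\<Sum>j<n. of_bool (i + j + 2 = n + 1) :: real) \<le> (\<Sum>j<n. if j = n - 1 - i then 1 else 0)"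
        by (intro sum_mono) auto
      also have "\<dots> \<le> 1" by simp
      finally show ?thesis .
    qed
    then have "(\<Sum>i<n. \<Sum>j<n. of_bool (i + j + 2 = n + 1) :: real) \<le> (\<Sum>i<n. 1)" by (intro sum_mono)
    then show ?thesis by simp
  qed
  have "(\<Sum>i<n. \<Sum>j<n. (signed_entry b w n i j - pm_entry b v n i j)\<^sup>2)
     \<le> (\<Sum>i<n. \<Sum>j<n. ((w (L i j) - v (L i j))\<^sup>2 + C\<^sup>2 * of_bool (i + j + 2 = n + 1)) / n)"
    by (intro sum_mono pt)
  also have "\<dots> = ((\<Sum>i<n. \<Sum>j<n. (w (L i j) - v (L i j))\<^sup>2) + C\<^sup>2 * (\<Sum>i<n. \<Sum>j<n. of_bool (i + j + 2 = n + 1))) / n"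
    by (simp only: sum_divide_distrib[symmetric] sum.distrib sum_distrib_left)
  also have "\<dots> \<le> (8 * 2 ^ r * e * (real n)\<^sup>2 + C\<^sup>2 * n) / n"
  proof (intro divide_right_mono add_mono mult_left_mono diag)
    have "(\<Sum>i<n. \<Sum>j<n. (w (L i j) - v (L i j))\<^sup>2) \<le> 2 * (real n)\<^sup>2 / real n ^ r * (\<Sum>t\<in>letter_set n. (w t - v t)\<^sup>2)"
      by (rule sum_letters_le[OF _ n]) simp
    also have "\<dots> \<le> 2 * (real n)\<^sup>2 / real n ^ r * (4 * e * (2 * real n) ^ r)"
      by (intro mult_left_mono e) simp
    also have "\<dots> = 8 * 2 ^ r * e * (real n)\<^sup>2" using n by (simp add: power_mult_distrib)
    finally show "(\<Sum>i<n. \<Sum>j<n. (w (L i j) - v (L i j))\<^sup>2) \<le> 8 * 2 ^ r * e * (real n)\<^sup>2" .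
  qed auto
  finally have "(\<Sum>i<n. \<Sum>j<n. (signed_entry b w n i j - pm_entry b v n i j)\<^sup>2) / n \<le> (8 * 2 ^ r * e * (real n)\<^sup>2 + C\<^sup>2 * n) / n / n"
    by (rule divide_right_mono) simp
  also have "\<dots> = 8 * 2 ^ r * e + C\<^sup>2 / n" using n by (simp add: add_divide_distrib power2_eq_square)
  finally have le: "(\<Sum>i<n. \<Sum>j<n. (signed_entry b w n i j - pm_entry b v n i j)\<^sup>2) / n \<le> 8 * 2 ^ r * e + C\<^sup>2 / n" .
  have "cmod (emp_char n (spec n (signed_entry b w n)) t - emp_char n (spec n (pm_entry b v n)) t)
     \<le> \<bar>t\<bar> * sqrt ((\<Sum>i<n. \<Sum>j<n. (signed_entry b w n i j - pm_entry b v n i j)\<^sup>2) / n)"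
    using spec_char_perturb[OF sym_signed_entry sym_pm_entry] by (simp add: spec_char_emp_char)
  also have "\<dots> \<le> \<bar>t\<bar> * sqrt (8 * 2 ^ r * e + C\<^sup>2 / n)"
    by (intro mult_left_mono real_sqrt_le_mono le) simp
  finally show ?thesis .
qed

text \<open>The truncation index \<open>m\<close> is fixed first to make the truncation error small.
  The bound \<open>C m\<close> may grow with \<open>m\<close>, but for fixed \<open>m\<close> its
  contribution \<open>(C m)\<^sup>2 / n\<close> vanishes.\<close>

lemma emp_char_signed_entry_tendsto:
  assumes v: "\<And>m i j. \<bar>v m (L i j)\<bar> \<le> C m"
    and lim: "\<And>m t. (\<lambda>n. emp_char n (spec n (pm_entry b (v m) n)) t) \<longlonglongrightarrow> \<phi> t"
    and e: "\<And>m. eventually (\<lambda>n. (\<Sum>t\<in>letter_set n. (w t - v m t)\<^sup>2) \<le> 4 * (1 / real (Suc m)) * (2 * real n) ^ r) sequentially"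
  shows "(\<lambda>n. emp_char n (spec n (signed_entry b w n)) t) \<longlonglongrightarrow> \<phi> t"
proof (rule tendstoI)
  fix \<epsilon> :: real assume \<epsilon>: "\<epsilon> > 0"
  have "(\<lambda>m. \<bar>t\<bar> * sqrt (8 * 2 ^ r * (1 / real (Suc m)) + 1 / real (Suc m))) \<longlonglongrightarrow> \<bar>t\<bar> * sqrt (8 * 2 ^ r * 0 + 0)"
    by (intro tendsto_mult tendsto_const tendsto_real_sqrt tendsto_add LIMSEQ_Suc[OF lim_1_over_n])
  then have "eventually (\<lambda>m. \<bar>t\<bar> * sqrt (8 * 2 ^ r * (1 / real (Suc m)) + 1 / real (Suc m)) < \<epsilon> / 2) sequentially"
    using \<epsilon> by (intro order_tendstoD(2)[where y="\<bar>t\<bar> * sqrt (8 * 2 ^ r * 0 + 0)"]) auto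
  then obtain m where m: "\<bar>t\<bar> * sqrt (8 * 2 ^ r * (1 / real (Suc m)) + 1 / real (Suc m)) < \<epsilon> / 2"
    by (auto simp: eventually_sequentially)
  have "(\<lambda>n. (C m)\<^sup>2 / real n) \<longlonglongrightarrow> 0" by (rule lim_const_over_n)
  then have "eventually (\<lambda>n. (C m)\<^sup>2 / real n < 1 / real (Suc m)) sequentially"
    by (rule order_tendstoD(2)) simp
  moreover have "eventually (\<lambda>n. dist (emp_char n (spec n (pm_entry b (v m) n)) t) (\<phi> t) < \<epsilon> / 2) sequentially"
    using lim[of m t] \<epsilon> by (intro tendstoD) auto
  ultimately show "eventually (\<lambda>n. dist (emp_char n (spec n (signed_entry b w n)) t) (\<phi> t) < \<epsilon>) sequentially"
    using e[of m] eventually_gt_at_top[of 0]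
  proof eventually_elim
    case (elim n)
    have "dist (emp_char n (spec n (signed_entry b w n)) t) (emp_char n (spec n (pm_entry b (v m) n)) t)
       \<le> \<bar>t\<bar> * sqrt (8 * 2 ^ r * (1 / real (Suc m)) + (C m)\<^sup>2 / n)"
      unfolding dist_norm by (rule emp_char_untruncate[OF v elim(4,3)])
    also have "\<dots> \<le> \<bar>t\<bar> * sqrt (8 * 2 ^ r * (1 / real (Suc m)) + 1 / real (Suc m))"
      using elim(1) by (intro mult_left_mono real_sqrt_le_mono) auto
    finally have "dist (emp_char n (spec n (signed_entry b w n)) t) (emp_char n (spec n (pm_entry b (v m) n)) t) < \<epsilon> / 2"
      using m by simp
    then show ?case using elim(2) dist_triangle[of "emp_char n (spec n (signed_entry b w n)) t" "\<phi> t" "emp_char n (spec n (pm_entry b (v m) n)) t"]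
      by linarith
  qed
qed

text \<open>The law \<open>\<mu>\<close> stands before the quantifier over \<open>b\<close>: signed
  and unsigned matrices share it, which is the equality of the two limits.\<close>

theorem limiting_spectral_distribution:
  assumes std: "std_indep_inputs P I x" and us: "uniform_squares P I x" and L_in: "\<And>i j. L i j \<in> I"
  shows "\<exists>\<mu>. real_distribution \<mu> \<and>
    (\<forall>b. AE \<omega> in P. weak_conv (\<lambda>n. esd (fun_mat n (signed_entry b (\<lambda>t. x t \<omega>) n))) (cdf \<mu>))"
proof -
  note sd = std_indep_inputsD[OF std]
  interpret prob_space P by (rule sd(1))
  define R where "R m zC \<longleftrightarrow> (case zC of (z, C) \<Rightarrow> C \<ge> 1 \<and> indep_vars (\<lambda>_. borel) z I \<and> (\<forall>t\<in>I. \<forall>\<omega>. \<bar>z t \<omega>\<bar> \<le> C) \<and>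
    (\<forall>t\<in>I. expectation (z t) = 0 \<and> expectation (\<lambda>\<omega>. (z t \<omega>)\<^sup>2) = 1) \<and>
    indep_vars (\<lambda>_. borel) (\<lambda>t \<omega>. (x t \<omega> - z t \<omega>)\<^sup>2) I \<and>
    (\<forall>t\<in>I. integrable P (\<lambda>\<omega>. (x t \<omega> - z t \<omega>)\<^sup>2) \<and> expectation (\<lambda>\<omega>. (x t \<omega> - z t \<omega>)\<^sup>2) \<le> 1 / real (Suc m)) \<and>
    dyadic_tails I (\<lambda>t \<omega>. (x t \<omega> - z t \<omega>)\<^sup>2))" for m :: nat and zC :: "('i \<Rightarrow> 'a \<Rightarrow> real) \<times> real"
  have "\<exists>zC. R m zC" for m
  proof -
    have ui: "\<exists>C\<ge>1. \<forall>t\<in>I. expectation (\<lambda>\<omega>. (x t \<omega>)\<^sup>2 * of_bool (C < \<bar>x t \<omega>\<bar>)) \<le> \<delta>" if "\<delta> > 0" for \<delta>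
      using us that unfolding uniform_squares_def by blast
    have tails: "dyadic_tails I (\<lambda>t \<omega>. (x t \<omega>)\<^sup>2)" using us unfolding uniform_squares_def by blast
    have pos: "0 < 1 / real (Suc m)" by simp
    show ?thesis
    proof (rule truncated_standardization[OF sd(2) sd(4) sd(5) sd(6) sd(7) ui tails pos])
      fix z C assume "C \<ge> 1" "indep_vars (\<lambda>_. borel) z I" "\<And>t \<omega>. t \<in> I \<Longrightarrow> \<bar>z t \<omega>\<bar> \<le> C"
        "\<And>t. t \<in> I \<Longrightarrow> expectation (z t) = 0" "\<And>t. t \<in> I \<Longrightarrow> expectation (\<lambda>\<omega>. (z t \<omega>)\<^sup>2) = 1"
        "indep_vars (\<lambda>_. borel) (\<lambda>t \<omega>. (x t \<omega> - z t \<omega>)\<^sup>2) I"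
        "\<And>t. t \<in> I \<Longrightarrow> integrable P (\<lambda>\<omega>. (x t \<omega> - z t \<omega>)\<^sup>2)"
        "\<And>t. t \<in> I \<Longrightarrow> expectation (\<lambda>\<omega>. (x t \<omega> - z t \<omega>)\<^sup>2) \<le> 1 / real (Suc m)"
        "dyadic_tails I (\<lambda>t \<omega>. (x t \<omega> - z t \<omega>)\<^sup>2)"
      then have "R m (z, C)" unfolding R_def by simp
      then show ?thesis ..
    qed
  qed
  then obtain zC where zC: "\<And>m. R m (zC m)" by metis
  define z C where "z m = fst (zC m)" and "C m = snd (zC m)" for m
  have R: "R m (z m, C m)" for m using zC[of m] by (simp add: z_def C_def)
  have z: "C m \<ge> 1" "indep_vars (\<lambda>_. borel) (z m) I" "\<And>t \<omega>. t \<in> I \<Longrightarrow> \<bar>z m t \<omega>\<bar> \<le> C m"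
      "\<And>t. t \<in> I \<Longrightarrow> expectation (z m t) = 0" "\<And>t. t \<in> I \<Longrightarrow> expectation (\<lambda>\<omega>. (z m t \<omega>)\<^sup>2) = 1"
      "indep_vars (\<lambda>_. borel) (\<lambda>t \<omega>. (x t \<omega> - z m t \<omega>)\<^sup>2) I"
      "\<And>t. t \<in> I \<Longrightarrow> integrable P (\<lambda>\<omega>. (x t \<omega> - z m t \<omega>)\<^sup>2)"
      "\<And>t. t \<in> I \<Longrightarrow> expectation (\<lambda>\<omega>. (x t \<omega> - z m t \<omega>)\<^sup>2) \<le> 1 / real (Suc m)"
      "dyadic_tails I (\<lambda>t \<omega>. (x t \<omega> - z m t \<omega>)\<^sup>2)" for m
    using R[of m] unfolding R_def by auto
  have mom: "AE \<omega> in P. moments_tendsto (\<lambda>j. (Suc j)\<^sup>2)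
           (\<lambda>j. spec ((Suc j)\<^sup>2) (pm_entry b (\<lambda>t. z m t \<omega>) ((Suc j)\<^sup>2))) limit_moment" for b m
    by (rule trace_moments_AE[OF sd(1) L_in z(2) z(3) z(1) z(4) z(5)])
  \<comment> \<open>One good sample point of the unsigned matrix at truncation index 0 suffices to
    produce \<open>\<mu>\<close>. All other truncation indices, sample points and signs have the
    same limit moments, hence the same limit of characteristic functions.\<close>
  obtain \<omega>0 where "moments_tendsto (\<lambda>j. (Suc j)\<^sup>2)
           (\<lambda>j. spec ((Suc j)\<^sup>2) (pm_entry False (\<lambda>t. z 0 t \<omega>0) ((Suc j)\<^sup>2))) limit_moment"
    using AE_ex_space[OF sd(1) mom] by blast
  from moment_limit_distribution[OF this limit_moment_le] obtain \<mu> where \<mu>: "real_distribution \<mu>"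
    "\<And>N' s' t. moments_tendsto N' s' limit_moment \<Longrightarrow> (\<lambda>n. emp_char (N' n) (s' n) t) \<longlonglongrightarrow> char \<mu> t"
    by blast
  have fr: "AE \<omega> in P. eventually (\<lambda>n. (\<Sum>t\<in>letter_set n. (x t \<omega> - z m t \<omega>)\<^sup>2) \<le> 4 * (1 / real (Suc m)) * (2 * real n) ^ r) sequentially" for m
  proof (rule polynomial_sum_bound[OF z(6) _ z(7) z(8) z(9)])
    show "letter_set n \<subseteq> I" "finite (letter_set n)" for n using L_in by (auto simp: letter_set_def)
    show "card (letter_set n) \<le> 2 * n ^ r" for n unfolding letter_set_def by (rule card_letters)
    show "letter_set n \<subseteq> letter_set n'" if "n \<le> n'" for n n'
      unfolding letter_set_def using that by (intro image_mono Sigma_mono) auto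
  qed (use r_pos in auto)
  have "AE \<omega> in P. weak_conv (\<lambda>n. esd (fun_mat n (signed_entry b (\<lambda>t. x t \<omega>) n))) (cdf \<mu>)" for b
  proof -
    \<comment> \<open>Countably many truncation indices, so a single null set serves all of
      them.\<close>
    have "AE \<omega> in P. \<forall>m. moments_tendsto (\<lambda>j. (Suc j)\<^sup>2)
           (\<lambda>j. spec ((Suc j)\<^sup>2) (pm_entry b (\<lambda>t. z m t \<omega>) ((Suc j)\<^sup>2))) limit_moment"
      using mom by (subst AE_all_countable) blast
    moreover have "AE \<omega> in P. \<forall>m. eventually (\<lambda>n. (\<Sum>t\<in>letter_set n. (x t \<omega> - z m t \<omega>)\<^sup>2) \<le> 4 * (1 / real (Suc m)) * (2 * real n) ^ r) sequentially"
      using fr by (subst AE_all_countable) blast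
    ultimately show ?thesis
    proof eventually_elim
      case (elim \<omega>)
      have "(\<lambda>n. emp_char n (spec n (pm_entry b (\<lambda>t. z m t \<omega>) n)) t) \<longlonglongrightarrow> char \<mu> t" for m t
        by (rule pm_entry_tendsto[where C="C m"]) (use z(3) L_in \<mu>(2) elim(1) in blast)+
      then have "(\<lambda>n. emp_char n (spec n (signed_entry b (\<lambda>t. x t \<omega>) n)) t) \<longlonglongrightarrow> char \<mu> t" for t
        by (rule emp_char_signed_entry_tendsto[where C=C and v="\<lambda>m t. z m t \<omega>", rotated]) (use z(3) L_in elim(2) in blast)+
      then have "weak_conv (\<lambda>n y. card {a\<in>{..<n}. spec n (signed_entry b (\<lambda>t. x t \<omega>) n) a \<le> y} / n) (cdf \<mu>)"
        by (rule weak_conv_of_char[OF \<mu>(1)])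
      moreover have "(\<lambda>n y. card {a\<in>{..<n}. spec n (signed_entry b (\<lambda>t. x t \<omega>) n) a \<le> y} / n)
         = (\<lambda>n. esd (fun_mat n (signed_entry b (\<lambda>t. x t \<omega>) n)))"
        by (intro ext) (simp only: esd_fun_mat[OF sym_signed_entry])
      ultimately show ?case by simp
    qed
  qed
  with \<mu>(1) show ?thesis by blast
qed

end

section \<open>The Wigner and Hankel instances\<close>

interpretation wigner: lsd_link wigner_link "\<lambda>(a,b). a + b" 2
proof
  fix i j n t
  show "(case wigner_link i j of (a,b) \<Rightarrow> a + b) = Suc i + Suc j"
    by (simp add: wigner_link_def min_def max_def)
  show "card ((\<lambda>(i,j). wigner_link i j) ` ({..<n} \<times> {..<n})) \<le> 2 * n ^ 2"
  proof -
    have "card ((\<lambda>(i,j). wigner_link i j) ` ({..<n} \<times> {..<n})) \<le> card ({..<n} \<times> {..<n})" by (rule card_image_le) simp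
    then show ?thesis by (simp add: power2_eq_square)
  qed
  show "card {(i,j) \<in> {..<n} \<times> {..<n}. wigner_link i j = t} * n ^ 2 \<le> 2 * n\<^sup>2"
  proof -
    have "{(i,j) \<in> {..<n} \<times> {..<n}. wigner_link i j = t} \<subseteq> {(fst t - 1, snd t - 1), (snd t - 1, fst t - 1)}"
    proof (rule subsetI)
      fix p assume "p \<in> {(i,j) \<in> {..<n} \<times> {..<n}. wigner_link i j = t}"
      then obtain i j where p: "p = (i,j)" and t: "t = wigner_link i j" by blast
      show "p \<in> {(fst t - 1, snd t - 1), (snd t - 1, fst t - 1)}"
        unfolding p t by (cases "i \<le> j") (simp_all add: wigner_link_def)
    qed
    then have "card {(i,j) \<in> {..<n} \<times> {..<n}. wigner_link i j = t} \<le> card {(fst t - 1, snd t - 1), (snd t - 1, fst t - 1)}"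
      by (rule card_mono[rotated]) simp
    also have "card {u, v} \<le> 2" for u v :: "nat \<times> nat" by (cases "u = v") auto
    then have "card {(fst t - 1, snd t - 1), (snd t - 1, fst t - 1)} \<le> 2" .
    finally have "card {(i,j) \<in> {..<n} \<times> {..<n}. wigner_link i j = t} \<le> 2" .
    then show ?thesis by (rule mult_right_mono) simp
  qed
qed (simp_all add: wigner_matching_convergent del: power_Suc)

interpretation hankel: lsd_link hankel_link "\<lambda>t. t" 1
proof
  fix i j n t
  show "hankel_link i j = Suc i + Suc j" by (simp add: hankel_link_def)
  show "card ((\<lambda>(i,j). hankel_link i j) ` ({..<n} \<times> {..<n})) \<le> 2 * n ^ 1"
  proof -
    have "(\<lambda>(i,j). hankel_link i j) ` ({..<n} \<times> {..<n}) \<subseteq> {1..2*n}" by (auto simp: hankel_link_def)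
    then have "card ((\<lambda>(i,j). hankel_link i j) ` ({..<n} \<times> {..<n})) \<le> card {1..2*n}" by (intro card_mono) auto
    then show ?thesis by simp
  qed
  show "card {(i,j) \<in> {..<n} \<times> {..<n}. hankel_link i j = t} * n ^ 1 \<le> 2 * n\<^sup>2"
  proof -
    have "card {(i,j) \<in> {..<n} \<times> {..<n}. hankel_link i j = t} \<le> card {..<n}"
      by (rule card_inj_on_le[where f=fst]) (auto simp: inj_on_def hankel_link_def)
    then have "card {(i,j) \<in> {..<n} \<times> {..<n}. hankel_link i j = t} * n \<le> n * n" by (intro mult_right_mono) auto
    also have "n * n \<le> 2 * n\<^sup>2" by (simp add: power2_eq_square)
    finally show ?thesis by (simp only: power_one_right)
  qed
qed (simp_all add: hankel_matching_convergent del: power_Suc)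

text \<open>The \<open>Suc\<close> in the link matches the shift in \<open>mat_1based\<close>;
  \<open>b = False\<close> gives the plain matrix and \<open>b = True\<close> the product with the
  sign matrix.\<close>

lemma wigner_mat_eq:
  "(1 / sqrt (real n)) \<cdot>\<^sub>m wigner_mat x n \<omega> = fun_mat n (wigner.signed_entry False (\<lambda>t. x t \<omega>) n)"
  "(1 / sqrt (real n)) \<cdot>\<^sub>m (sign_mat n \<odot> wigner_mat x n \<omega>) = fun_mat n (wigner.signed_entry True (\<lambda>t. x t \<omega>) n)"
  by (rule eq_matI; auto simp: wigner_mat_def mat_1based_def fun_mat_def schur_hadamard_def sign_mat_def
      wigner.signed_entry_def wigner.letter_sign_def wigner_link_def min_def max_def)+

lemma hankel_mat_eq:
  "(1 / sqrt (real n)) \<cdot>\<^sub>m hankel_mat y n \<omega> = fun_mat n (hankel.signed_entry False (\<lambda>t. y t \<omega>) n)"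
  "(1 / sqrt (real n)) \<cdot>\<^sub>m (sign_mat n \<odot> hankel_mat y n \<omega>) = fun_mat n (hankel.signed_entry True (\<lambda>t. y t \<omega>) n)"
  by (rule eq_matI; auto simp: hankel_mat_def mat_1based_def fun_mat_def schur_hadamard_def sign_mat_def
      hankel.signed_entry_def hankel.letter_sign_def hankel_link_def)+

theorem mainTheorem7:
  fixes P :: "'a measure" and x :: "nat \<times> nat \<Rightarrow> 'a \<Rightarrow> real"
    and Q :: "'b measure" and y :: "nat \<Rightarrow> 'b \<Rightarrow> real"
  shows "(admissible_inputs P wigner_index x \<longrightarrow>
           (\<exists>F. is_LSD P (\<lambda>n \<omega>. (1 / sqrt (real n)) \<cdot>\<^sub>m wigner_mat x n \<omega>) F \<and>
                is_LSD P (\<lambda>n \<omega>. (1 / sqrt (real n)) \<cdot>\<^sub>m (sign_mat n \<odot> wigner_mat x n \<omega>)) F))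
       \<and> (admissible_inputs Q UNIV y \<longrightarrow>
           (\<exists>F. is_LSD Q (\<lambda>n \<omega>. (1 / sqrt (real n)) \<cdot>\<^sub>m hankel_mat y n \<omega>) F \<and>
                is_LSD Q (\<lambda>n \<omega>. (1 / sqrt (real n)) \<cdot>\<^sub>m (sign_mat n \<odot> hankel_mat y n \<omega>)) F))"
proof (intro conjI impI)
  assume "admissible_inputs P wigner_index x"
  note adm = admissible_inputs_uniform_squares[OF this]
  have "wigner_link i j \<in> wigner_index" for i j
    by (auto simp: wigner_link_def wigner_index_def)
  \<comment> \<open>The witness is \<open>F = cdf \<mu>\<close>; the two values of \<open>b\<close>
    give the two claims with the same \<open>\<mu>\<close>.\<close>
  from wigner.limiting_spectral_distribution[OF adm this]
  show "\<exists>F. is_LSD P (\<lambda>n \<omega>. (1 / sqrt (real n)) \<cdot>\<^sub>m wigner_mat x n \<omega>) F \<and>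
            is_LSD P (\<lambda>n \<omega>. (1 / sqrt (real n)) \<cdot>\<^sub>m (sign_mat n \<odot> wigner_mat x n \<omega>)) F"
    unfolding is_LSD_def wigner_mat_eq by blast
next
  assume "admissible_inputs Q UNIV y"
  note adm = admissible_inputs_uniform_squares[OF this]
  from hankel.limiting_spectral_distribution[OF adm UNIV_I]
  show "\<exists>F. is_LSD Q (\<lambda>n \<omega>. (1 / sqrt (real n)) \<cdot>\<^sub>m hankel_mat y n \<omega>) F \<and>
            is_LSD Q (\<lambda>n \<omega>. (1 / sqrt (real n)) \<cdot>\<^sub>m (sign_mat n \<odot> hankel_mat y n \<omega>)) F"
    unfolding is_LSD_def hankel_mat_eq by blast
qed

end
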